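(* The sampling allocations made by Algorithm 3 satisfy the following almost surely: \[ \lim_{n \rightarrow \infty} \Big\{\left(\tfrac{\alpha_{i^b, n}(\theta_b)}{\lambda_{i^b}(\theta_b)}\right)^2 - \sum_{j \neq i^b}\left(\tfrac{\alpha_{j, n}(\theta_b)}{\lambda_j(\theta_b)}\right)^2\Big\} = 0, \forall\theta_b \mbox{ and } \lim_{n \rightarrow \infty}\tfrac{W^{\textup{ACC}}_{i}(\theta_b)G_{i ,n}(\theta_b)}{W^{\textup{ACC}}_{j}(\theta_c)G_{j, n}(\theta_c)} = 1, \forall (i, \theta_b), (j, \theta_c) \in \Xi\cup\Xi^{\textup{adv}}. \] Also, $\limsup_{n \rightarrow \infty} {N^n_i(\theta_b)}/{N^n_j(\theta_{b^\prime})} < \infty$ for all $(i, \theta_b) \neq (j, \theta_{b^\prime})$. For Algorithm 4, the same statements hold when $W^{\textup{ACC}}_{i}(\theta_b)$ is replaced with $W^{\textup{FN}}_{i}(\theta_b)$.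
   Context: Setting: $k$ solutions and an uncertain input parameter $\theta$ with finite support $\{\theta_1,\dots,\theta_B\}$ and probabilities $p_b>0$, $\sum_b p_b=1$. Let $y_i(\theta_b)$ be the mean simulation output of solution $i$ given $\theta_b$; the conditional optimum $i^b=\arg\min_i y_i(\theta_b)$ is assumed unique for each $b$, and the most probable best $i^*=\arg\max_i \sum_b p_b\mathbf 1\{i=i^b\}$ is assumed unique. Favorable set $\Theta_{i}=\{\theta_b: i^b=i\}$. Define $d_j=\sum_b p_b\mathbf 1\{i^*=i^b\}-\sum_b p_b\mathbf 1\{j=i^b\}$, $\Xi=\{(i,\theta_b): i\neq i^*, i\neq i^b\}$ and $\Xi^{\textup{adv}}=\{(i^*,\theta_b):\theta_b\notin\Theta_{i^*}\}$. For $(i,\theta_b)\in\Xi$, $W_i(\theta_b)=\max\{\min(\min_{j\neq i^*}d_j, d_i/2)/p_b,1\}$ if $\theta_b\in\Theta_{i^*}$ and $W_i(\theta_b)=\max\{d_i/p_b,1\}$ otherwise. Balance weights: $W^{\textup{ACC}}_i(\theta_b)=1$ if $\theta_b\in\Theta_{i^*}$ or $(i,\theta_b)\in\Xi^{\textup{adv}}$, and $=W_i(\theta_b)$ if $\theta_b\notin\Theta_{i^*}$ (with $(i,\theta_b)\in\Xi$); $W^{\textup{FN}}_i(\theta_b)=W_i(\theta_b)$ on $\Xi$ and $=1$ on $\Xi^{\textup{adv}}$; both are $\infty$ outside $\Xi\cup\Xi^{\textup{adv}}$. Simulation outputs $Y_i(\theta_b)$ are independent normal with mean $y_i(\theta_b)$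 and known variance $\lambda_i^2(\theta_b)$; with a noninformative normal prior the posterior mean $\mu_{i,n}(\theta_b)$ is the sample mean of the $N^n_i(\theta_b)$ replications allocated to $(i,\theta_b)$ after $n$ total replications, and $\alpha_{i,n}(\theta_b)=N^n_i(\theta_b)/n$. Sample rate $G_{i,n}(\theta_b)=(\mu_{i,n}(\theta_b)-\mu_{i_n^b,n}(\theta_b))^2/\big(2(\lambda_i^2(\theta_b)/\alpha_{i,n}(\theta_b)+\lambda_{i_n^b}^2(\theta_b)/\alpha_{i_n^b,n}(\theta_b))\big)$ for $i\neq i_n^b$. Algorithm 3: allocate $n_0$ initial replications to every $(i,\theta_b)$; then repeatedly: compute $\mu_{i,n}(\theta_b)$, $i_n^b=\arg\min_i\mu_{i,n}(\theta_b)$, $i_n^*=\arg\max_i\sum_b p_b\mathbf 1\{i=i_n^b\}$ (ties broken by choosing $\arg\max_{j}\min_{b:i_n^b\neq j}G_{j,n}(\theta_b)$ among tied $j$); form plug-in weights $W^{\textup{ACC}}_{i,n}(\theta_b)$ by replacing $i^b,i^*$ with $i_n^b,i_n^*$; find $(i,\theta_b)$ minimizing $W^{\textup{ACC}}_{i,n}(\theta_b)G_{i,n}(\theta_b)$; if $(N^n_{i_n^b}(\theta_b)/\lambda_{i_n^b}(\theta_b))^2<\sum_{j\neq i_n^b}(N^n_j(\theta_b)/\lambda_j(\theta_b))^2$ run a replication at $(i_n^b,\theta_b)$, otherwise at $(i,\theta_b)$. Algorithm 4 is identical with $W^{\textup{FN}}$ in place of $W^{\textup{ACC}}$. *)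

theory Defs
  imports "HOL-Probability.Probability"
begin

text \<open>Solutions are indexed by 0..k-1, parameter values theta_b by b = 0..B-1.
  X i b m w is the m-th simulation replication run at (i, theta_b).\<close>

datatype variant = ACC | FN

definition freq :: "nat \<Rightarrow> (nat \<Rightarrow> real) \<Rightarrow> (nat \<Rightarrow> nat) \<Rightarrow> nat \<Rightarrow> real" where
  "freq B p ib j = (\<Sum>b<B. if ib b = j then p b else 0)"

definition cond_opt :: "nat \<Rightarrow> (nat \<Rightarrow> nat \<Rightarrow> real) \<Rightarrow> nat \<Rightarrow> nat" where
  "cond_opt k y b = (LEAST i. i < k \<and> (\<forall>j<k. y i b \<le> y j b))"

definition mpb :: "nat \<Rightarrow> nat \<Rightarrow> (nat \<Rightarrow> real) \<Rightarrow> (nat \<Rightarrow> nat) \<Rightarrow> nat" where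
  "mpb k B p ib = (LEAST i. i < k \<and> (\<forall>j<k. freq B p ib j \<le> freq B p ib i))"

definition dd :: "nat \<Rightarrow> (nat \<Rightarrow> real) \<Rightarrow> (nat \<Rightarrow> nat) \<Rightarrow> nat \<Rightarrow> nat \<Rightarrow> real" where
  "dd B p ib ist j = freq B p ib ist - freq B p ib j"

definition inXi :: "nat \<Rightarrow> nat \<Rightarrow> (nat \<Rightarrow> nat) \<Rightarrow> nat \<Rightarrow> nat \<Rightarrow> nat \<Rightarrow> bool" where
  "inXi k B ib ist i b \<longleftrightarrow> i < k \<and> b < B \<and> i \<noteq> ist \<and> i \<noteq> ib b"

definition inXiadv :: "nat \<Rightarrow> (nat \<Rightarrow> nat) \<Rightarrow> nat \<Rightarrow> nat \<Rightarrow> nat \<Rightarrow> bool" where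
  "inXiadv B ib ist i b \<longleftrightarrow> i = ist \<and> b < B \<and> ib b \<noteq> ist"

definition cand :: "nat \<Rightarrow> nat \<Rightarrow> (nat \<Rightarrow> nat) \<Rightarrow> nat \<Rightarrow> (nat \<times> nat) set" where
  "cand k B ib ist = {(i, b). inXi k B ib ist i b \<or> inXiadv B ib ist i b}"

definition Wbase :: "nat \<Rightarrow> nat \<Rightarrow> (nat \<Rightarrow> real) \<Rightarrow> (nat \<Rightarrow> nat) \<Rightarrow> nat \<Rightarrow> nat \<Rightarrow> nat \<Rightarrow> real" where
  "Wbase k B p ib ist i b =
     (if ib b = ist
      then max (min (Min {dd B p ib ist j | j. j < k \<and> j \<noteq> ist}) (dd B p ib ist i / 2) / p b) 1
      else max (dd B p ib ist i / p b) 1)"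

text \<open>balance weights W^ACC and W^FN, on Xi \<union> Xi^adv (they are +infinity elsewhere,
  which only matters through the restriction of minimisations to cand)\<close>
definition Wt :: "variant \<Rightarrow> nat \<Rightarrow> nat \<Rightarrow> (nat \<Rightarrow> real) \<Rightarrow> (nat \<Rightarrow> nat) \<Rightarrow> nat \<Rightarrow> nat \<Rightarrow> nat \<Rightarrow> real" where
  "Wt v k B p ib ist i b =
     (case v of
        ACC \<Rightarrow> (if ib b = ist \<or> inXiadv B ib ist i b then 1 else Wbase k B p ib ist i b)
      | FN \<Rightarrow> (if inXiadv B ib ist i b then 1 else Wbase k B p ib ist i b))"

definition smean :: "(nat \<Rightarrow> nat \<Rightarrow> nat \<Rightarrow> 'a \<Rightarrow> real) \<Rightarrow> (nat \<Rightarrow> nat \<Rightarrow> nat) \<Rightarrow> 'a \<Rightarrow> nat \<Rightarrow> nat \<Rightarrow> real" where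
  "smean X N w i b = (\<Sum>m<N i b. X i b m w) / real (N i b)"

definition total :: "nat \<Rightarrow> nat \<Rightarrow> (nat \<Rightarrow> nat \<Rightarrow> nat) \<Rightarrow> nat" where
  "total k B N = (\<Sum>i<k. \<Sum>b<B. N i b)"

definition frac :: "nat \<Rightarrow> nat \<Rightarrow> (nat \<Rightarrow> nat \<Rightarrow> nat) \<Rightarrow> nat \<Rightarrow> nat \<Rightarrow> real" where
  "frac k B N i b = real (N i b) / real (total k B N)"

definition sbest :: "nat \<Rightarrow> (nat \<Rightarrow> nat \<Rightarrow> nat \<Rightarrow> 'a \<Rightarrow> real) \<Rightarrow> (nat \<Rightarrow> nat \<Rightarrow> nat) \<Rightarrow> 'a \<Rightarrow> nat \<Rightarrow> nat" where
  "sbest k X N w b = (LEAST i. i < k \<and> (\<forall>j<k. smean X N w i b \<le> smean X N w j b))"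

definition Grate :: "nat \<Rightarrow> nat \<Rightarrow> (nat \<Rightarrow> nat \<Rightarrow> real) \<Rightarrow> (nat \<Rightarrow> nat \<Rightarrow> nat \<Rightarrow> 'a \<Rightarrow> real)
    \<Rightarrow> (nat \<Rightarrow> nat \<Rightarrow> nat) \<Rightarrow> 'a \<Rightarrow> nat \<Rightarrow> nat \<Rightarrow> real" where
  "Grate k B lam X N w i b =
     (let ibb = sbest k X N w b in
      (smean X N w i b - smean X N w ibb b)\<^sup>2 /
      (2 * ((lam i b)\<^sup>2 / frac k B N i b + (lam ibb b)\<^sup>2 / frac k B N ibb b)))"

definition sstar :: "nat \<Rightarrow> nat \<Rightarrow> (nat \<Rightarrow> real) \<Rightarrow> (nat \<Rightarrow> nat \<Rightarrow> real) \<Rightarrow> (nat \<Rightarrow> nat \<Rightarrow> nat \<Rightarrow> 'a \<Rightarrow> real)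
    \<Rightarrow> (nat \<Rightarrow> nat \<Rightarrow> nat) \<Rightarrow> 'a \<Rightarrow> nat" where
  "sstar k B p lam X N w =
     (let ib = sbest k X N w;
          T = {j. j < k \<and> (\<forall>j'<k. freq B p ib j' \<le> freq B p ib j)};
          sc = (\<lambda>j. Min {Grate k B lam X N w j b | b. b < B \<and> ib b \<noteq> j})
      in LEAST j. j \<in> T \<and> (\<forall>j'\<in>T. sc j' \<le> sc j))"

text \<open>one step of Algorithm 3 (v = ACC) / Algorithm 4 (v = FN): the pair receiving the next replication.
  Ties in the minimisation of W G are broken by an arbitrary (Hilbert-choice) rule.\<close>
definition next_pair :: "variant \<Rightarrow> nat \<Rightarrow> nat \<Rightarrow> (nat \<Rightarrow> real) \<Rightarrow> (nat \<Rightarrow> nat \<Rightarrow> real)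
    \<Rightarrow> (nat \<Rightarrow> nat \<Rightarrow> nat \<Rightarrow> 'a \<Rightarrow> real) \<Rightarrow> (nat \<Rightarrow> nat \<Rightarrow> nat) \<Rightarrow> 'a \<Rightarrow> nat \<times> nat" where
  "next_pair v k B p lam X N w =
     (let ib = sbest k X N w;
          ist = sstar k B p lam X N w;
          C = cand k B ib ist;
          val = (\<lambda>(i, b). Wt v k B p ib ist i b * Grate k B lam X N w i b);
          (i0, b0) = (SOME ib0. ib0 \<in> C \<and> (\<forall>q\<in>C. val ib0 \<le> val q))
      in if (real (N (ib b0) b0) / lam (ib b0) b0)\<^sup>2
              < (\<Sum>j\<in>{..<k} - {ib b0}. (real (N j b0) / lam j b0)\<^sup>2)
         then (ib b0, b0) else (i0, b0))"

text \<open>allocation N^n after t sequential steps (total n = n0*k*B + t replications)\<close>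
primrec alloc :: "variant \<Rightarrow> nat \<Rightarrow> nat \<Rightarrow> nat \<Rightarrow> (nat \<Rightarrow> real) \<Rightarrow> (nat \<Rightarrow> nat \<Rightarrow> real)
    \<Rightarrow> (nat \<Rightarrow> nat \<Rightarrow> nat \<Rightarrow> 'a \<Rightarrow> real) \<Rightarrow> 'a \<Rightarrow> nat \<Rightarrow> (nat \<Rightarrow> nat \<Rightarrow> nat)" where
  "alloc v n0 k B p lam X w 0 = (\<lambda>i b. n0)"
| "alloc v n0 k B p lam X w (Suc t) =
     (let N = alloc v n0 k B p lam X w t;
          (i, b) = next_pair v k B p lam X N w
      in N(i := (N i)(b := Suc (N i b))))"

end

theory Submission
  imports Defs "HOL-Real_Asymp.Real_Asymp"
begin

text \<open>Multiplying all rates by the number of replications turns \<open>G\<close> into a quantity \<open>V\<close> that depends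
  only on the counts and sample means of a pair and of the sample best; write \<open>x = N / \<lambda>\<close>.

  Consistency. If some pair were sampled only finitely often, its \<open>V\<close>, and hence the minimal weighted
  \<open>V\<close>, would stay below a constant \<open>K\<close>. Since non-optimal solutions may have equal means, the law of
  large numbers does not exclude this. Instead, by Borel--Cantelli, almost surely there are arbitrarily
  large scales \<open>q\<close> at which the sample means at \<open>\<theta>\<^sub>b\<close> are pairwise separated, uniformly over all sample
  sizes with \<open>q \<le> x \<le> k\<^sup>k q\<close>, so strongly that two solutions inside this window have \<open>V > K\<close>. Inside
  the window only the sample best can then receive replications, and only while its \<open>x\<close> is below the
  Euclidean norm of the others. So no count ever leaves the window, which is absurd for some \<open>b\<close>.

  Limits. Once all counts diverge, the sample best is \<open>i\<^sup>b\<close> and the weights are the true ones. The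
  sampling rule keeps \<open>x\<close> of \<open>i\<^sup>b\<close> asymptotic to the norm of the others, and since a non-optimal
  solution is sampled only when its weighted rate is minimal, no weighted rate can rise above the
  minimal one by more than a factor tending to 1.\<close>

section \<open>Sampling paths\<close>

subsection \<open>All counts diverge\<close>

text \<open>The scale is critical: about \<open>q\<close> replications leave a fluctuation of order
  \<open>1 / sqrt q\<close>, and a gap \<open>g / sqrt q\<close> at \<open>x \<ge> q\<close> makes
  \<open>V\<close> at least of order \<open>g\<^sup>2\<close>, free of \<open>q\<close>. Excursions
  by a fixed multiple of the standard deviation therefore beat any prescribed \<open>K\<close>, with
  a probability that does not decay with the scale. The width \<open>k ^ k\<close> comes from the
  norm rule: each of the \<open>k\<close> solutions that reaches the window can raise the ceiling by
  a factor \<open>k\<close>. Sampling is adaptive, but the streams of replications are fixed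
  beforehand and a window speaks of all its sample sizes at once. So the probabilistic part never
  mentions the algorithm, which is treated path by path. Consistency relies on
  \<open>1 \<le> W \<le> Wm\<close> only, so wrong plug-in optima do no harm in the meantime. The
  obstacle in the limits is that replications at \<open>i\<^sup>b\<close> raise the rates of the
  other solutions at \<open>\<theta>\<^sub>b\<close> without sampling them. A rate can thus rise
  after it was last minimal, and the minimal rate over all parameter values must be shown to rise
  along with it.\<close>

text \<open>One sample path of the algorithm: \<open>mu i b s\<close> is the mean of the first \<open>s\<close> replications at
  \<open>(i, \<theta>\<^sub>b)\<close>, time \<open>t\<close> counts the steps after the initial stage, and \<open>(si t, sb t)\<close> is the pair
  minimizing the weighted rate at time \<open>t\<close>.\<close>

locale sampling_path =
  fixes k B n0 :: nat and lam :: "nat \<Rightarrow> nat \<Rightarrow> real" and mu :: "nat \<Rightarrow> nat \<Rightarrow> nat \<Rightarrow> real"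
    and N :: "nat \<Rightarrow> nat \<Rightarrow> nat \<Rightarrow> nat" and best :: "nat \<Rightarrow> nat \<Rightarrow> nat"
    and W :: "nat \<Rightarrow> nat \<Rightarrow> nat \<Rightarrow> real" and Wm :: real and si sb :: "nat \<Rightarrow> nat"
    and V :: "nat \<Rightarrow> nat \<Rightarrow> nat \<Rightarrow> real" and x :: "nat \<Rightarrow> nat \<Rightarrow> nat \<Rightarrow> real"
  defines "V t i b \<equiv> (mu i b (N t i b) - mu (best t b) b (N t (best t b) b))\<^sup>2 /
      (2 * ((lam i b)\<^sup>2 / real (N t i b) + (lam (best t b) b)\<^sup>2 / real (N t (best t b) b)))"
    and "x t i b \<equiv> real (N t i b) / lam i b"
  assumes k2: "2 \<le> k" and n0: "1 \<le> n0"
    and lam_pos: "\<And>i b. i < k \<Longrightarrow> b < B \<Longrightarrow> 0 < lam i b"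
    and N_0: "\<And>i b. N 0 i b = n0"
    and best_less: "\<And>t b. b < B \<Longrightarrow> best t b < k"
    and best_le: "\<And>t b j. b < B \<Longrightarrow> j < k \<Longrightarrow>
      mu (best t b) b (N t (best t b) b) \<le> mu j b (N t j b)"
    and si_less: "\<And>t. si t < k" and sb_less: "\<And>t. sb t < B"
    and si_neq: "\<And>t. si t \<noteq> best t (sb t)"
    and sel_min: "\<And>t i b. i < k \<Longrightarrow> b < B \<Longrightarrow> i \<noteq> best t b \<Longrightarrow>
      W t (si t) (sb t) * V t (si t) (sb t) \<le> W t i b * V t i b"
    and W_ge: "\<And>t i b. i < k \<Longrightarrow> b < B \<Longrightarrow> i \<noteq> best t b \<Longrightarrow> 1 \<le> W t i b"
    and W_le: "\<And>t i b. i < k \<Longrightarrow> b < B \<Longrightarrow> i \<noteq> best t b \<Longrightarrow> W t i b \<le> Wm"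
    and N_Suc: "\<And>t i b. N (Suc t) i b = N t i b +
      (if b = sb t \<and> i = (if (x t (best t b) b)\<^sup>2 < (\<Sum>j\<in>{..<k} - {best t b}. (x t j b)\<^sup>2)
                          then best t b else si t) then 1 else 0)"
begin

section \<open>Elementary dynamics of the counts\<close>

definition arm :: "nat \<Rightarrow> nat \<Rightarrow> nat" where
  "arm t b = (if (x t (best t b) b)\<^sup>2 < (\<Sum>j\<in>{..<k} - {best t b}. (x t j b)\<^sup>2)
              then best t b else si t)"

lemma N_step: "N (Suc t) i b = N t i b + (if b = sb t \<and> i = arm t b then 1 else 0)"
  unfolding N_Suc arm_def ..

lemma x_step: "x (Suc t) i b = x t i b + (if b = sb t \<and> i = arm t b then 1 / lam i b else 0)"
  by (simp add: x_def N_step add_divide_distrib)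

lemma arm_less: "b < B \<Longrightarrow> arm t b < k"
  using si_less best_less by (simp add: arm_def)

lemma N_mono: "t \<le> t' \<Longrightarrow> N t i b \<le> N t' i b"
  by (rule lift_Suc_mono_le[where f="\<lambda>t. N t i b"]) (simp_all add: N_step)

lemma N_pos: "0 < N t i b"
  using N_mono[of 0 t i b] n0 by (simp add: N_0)

lemma x_pos: "i < k \<Longrightarrow> b < B \<Longrightarrow> 0 < x t i b"
  using N_pos lam_pos by (simp add: x_def)

lemma x_mono: "i < k \<Longrightarrow> b < B \<Longrightarrow> t \<le> t' \<Longrightarrow> x t i b \<le> x t' i b"
  using N_mono lam_pos by (simp add: x_def divide_right_mono less_imp_le)

lemma V_eq: "i < k \<Longrightarrow> b < B \<Longrightarrow> V t i b =
  (mu i b (N t i b) - mu (best t b) b (N t (best t b) b))\<^sup>2 /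
  (2 * (lam i b / x t i b + lam (best t b) b / x t (best t b) b))"
  by (simp add: V_def x_def power2_eq_square)

lemma V_nonneg: "i < k \<Longrightarrow> b < B \<Longrightarrow> 0 \<le> V t i b"
  by (simp add: V_def)

lemma N_total: "(\<Sum>i<k. \<Sum>b<B. N t i b) = n0 * k * B + t"
proof (induction t)
  case 0
  show ?case by (simp add: N_0)
next
  case (Suc t)
  let ?b = "sb t" and ?i = "arm t (sb t)"
  have i: "?i < k" using arm_less sb_less by simp
  have "(\<Sum>i<k. \<Sum>b<B. N (Suc t) i b)
      = (\<Sum>i<k. \<Sum>b<B. N t i b + (if b = ?b then (if i = ?i then 1 else 0) else 0))"
    by (intro sum.cong refl) (auto simp: N_step)
  also have "\<dots> = (\<Sum>i<k. \<Sum>b<B. N t i b) + 1"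
    unfolding sum.distrib using i sb_less by (simp add: sum.delta)
  finally show ?case using Suc by simp
qed

text \<open>A solution inside the window cannot be selected against a sample best that is inside
  too, since separation would give \<open>V > K\<close>. What remains is growth of the sample best,
  which the norm test ties to the others. Separation also fixes the order of the means inside the
  window for all times.\<close>

lemma window_bound:
  fixes q g K :: real and l u :: "nat \<Rightarrow> real"
  assumes b: "b < B" and q: "\<And>i. i < k \<Longrightarrow> real n0 / lam i b < q"
    and K: "\<And>t. sb t = b \<Longrightarrow> V t (si t) b \<le> K"
    and win: "\<And>i s. i < k \<Longrightarrow> q \<le> real s / lam i b \<Longrightarrow> real s / lam i b \<le> real k ^ k * q \<Longrightarrow>
      l i \<le> mu i b s \<and> mu i b s \<le> u i"
    and lu: "\<And>i. i < k \<Longrightarrow> l i \<le> u i"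
    and sep: "\<And>i j. i < k \<Longrightarrow> j < k \<Longrightarrow> i \<noteq> j \<Longrightarrow> u i + g \<le> l j \<or> u j + g \<le> l i" and g: "0 < g"
    and gap: "\<And>i j. i < k \<Longrightarrow> j < k \<Longrightarrow> K < g\<^sup>2 * q / (2 * (lam i b + lam j b))"
    and i: "i < k"
  shows "x t i b \<le> real k ^ k * q"
proof -
  define P where "P t = {i. i < k \<and> q \<le> x t i b}" for t
  define inv where "inv t \<longleftrightarrow> (\<forall>i\<in>P t. x t i b \<le> real k ^ card (P t) * q \<and>
      ((\<exists>j\<in>P t. l j < l i) \<longrightarrow> x t i b \<le> real k ^ (card (P t) - 1) * q))" for t
  \<comment> \<open>Only the sample best, which has the least \<open>l\<close> in \<open>P t\<close>, can grow within the window; the power of \<open>k\<close>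
    pays for a change of the sample best each time a solution enters \<open>P t\<close>.\<close>
  have q0: "0 < q" using q[of 0] k2 b lam_pos[of 0 b] n0
    by (smt (verit) divide_nonneg_pos of_nat_0_le_iff order_less_le_trans zero_less_numeral)
  have lam_q: "1 / lam i b < q" if "i < k" for i
    using q[OF that] n0 lam_pos[OF that b] divide_right_mono[of 1 "real n0" "lam i b"] by simp
  have finP: "finite (P t)" and Pk: "P t \<subseteq> {..<k}" for t by (auto simp: P_def)
  have cardP: "card (P t) \<le> k" for t using card_mono[OF _ Pk] by fastforce
  have k1: "1 \<le> real k" using k2 by simp
  have big: "x t i b \<le> real k ^ k * q" if "inv t" "i < k" for t i
  proof (cases "i \<in> P t")
    case True
    then have "x t i b \<le> real k ^ card (P t) * q" using that by (auto simp: inv_def)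
    also have "\<dots> \<le> real k ^ k * q"
      using q0 power_increasing[OF cardP k1] by simp
    finally show ?thesis .
  next
    case False
    then have "x t i b \<le> 1 * q" using that by (simp add: P_def)
    also have "\<dots> \<le> real k ^ k * q" using q0 k1 by (intro mult_right_mono one_le_power) auto
    finally show ?thesis .
  qed
  have "inv t" for t
  proof (induction t)
    case 0
    have "P 0 = {}" using q by (force simp: P_def x_def N_0)
    then show ?case by (simp add: inv_def)
  next
    case (Suc t)
    show ?case
    proof (cases "sb t = b")
      case False
      then have "x (Suc t) i b = x t i b" for i by (simp add: x_step)
      then show ?thesis using Suc by (simp add: inv_def P_def)
    next
      case True
      define j where "j = best t b"
      define a where "a = arm t b"
      have jk: "j < k" and sk: "si t < k" and sj: "si t \<noteq> j"
        using best_less[OF b] si_less si_neq[of t] True by (auto simp: j_def)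
      have ak: "a < k" using arm_less[OF b] by (simp add: a_def)
      have xo: "x (Suc t) i b = x t i b" if "i \<noteq> a" for i
        using that by (simp add: x_step a_def)
      have xa: "x (Suc t) a b = x t a b + 1 / lam a b"
        using True by (simp add: x_step a_def)
      have Pmem: "i \<in> P (Suc t) \<longleftrightarrow> i \<in> P t" if "i \<noteq> a" for i
        using that by (simp add: P_def xo)
      have inwin: "l i \<le> mu i b (N t i b) \<and> mu i b (N t i b) \<le> u i" if "i \<in> P t" for i
        using win[of i "N t i b"] that big[OF Suc, of i] by (auto simp: P_def x_def)
      \<comment> \<open>Both means lie in intervals at distance \<open>g\<close> and both
        \<open>x\<close> are at least \<open>q\<close>, so the numerator of \<open>V\<close> is at
        least \<open>g\<^sup>2\<close>, its denominator is of order \<open>1 / q\<close>, and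
        \<open>gap\<close> contradicts \<open>K\<close>.\<close>
      have notboth: "\<not> (si t \<in> P t \<and> j \<in> P t)"
      proof
        assume *: "si t \<in> P t \<and> j \<in> P t"
        have "g \<le> \<bar>mu (si t) b (N t (si t) b) - mu j b (N t j b)\<bar>"
          using sep[OF sk jk sj] inwin[of j] inwin[of "si t"] * by auto
        then have g2: "g\<^sup>2 \<le> (mu (si t) b (N t (si t) b) - mu j b (N t j b))\<^sup>2"
          using g by (metis abs_le_square_iff abs_of_pos)
        have "lam (si t) b / x t (si t) b + lam j b / x t j b \<le> lam (si t) b / q + lam j b / q"
          using * q0 lam_pos[OF sk b] lam_pos[OF jk b]
          by (intro add_mono divide_left_mono) (auto simp: P_def x_pos b)
        then have d: "2 * (lam (si t) b / x t (si t) b + lam j b / x t j b)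
            \<le> 2 * ((lam (si t) b + lam j b) / q)"
          by (simp add: add_divide_distrib)
        have p: "0 < lam (si t) b / x t (si t) b + lam j b / x t j b"
          using sk jk b by (intro add_pos_pos divide_pos_pos lam_pos x_pos)
        have "g\<^sup>2 * q / (2 * (lam (si t) b + lam j b)) = g\<^sup>2 / (2 * ((lam (si t) b + lam j b) / q))"
          by simp
        also have "\<dots> \<le> V t (si t) b"
          unfolding V_eq[OF sk b] j_def[symmetric] using g2 d p by (intro frac_le) auto
        finally show False using gap[OF sk jk] K[OF True] by simp
      qed
      \<comment> \<open>If \<open>si t\<close> were sampled while in \<open>P t\<close>, the failed
        norm test would give \<open>x t j b \<ge> x t (si t) b \<ge> q\<close>, putting the sample
        best into \<open>P t\<close> as well.\<close>
      have aP: "a = j \<and> (x t j b)\<^sup>2 < (\<Sum>m\<in>{..<k} - {j}. (x t m b)\<^sup>2)" if "a \<in> P t"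
      proof (rule ccontr)
        assume "\<not> ?thesis"
        then have as: "a = si t" and "\<not> (x t j b)\<^sup>2 < (\<Sum>m\<in>{..<k} - {j}. (x t m b)\<^sup>2)"
          by (auto simp: a_def arm_def j_def split: if_splits)
        moreover have "(x t (si t) b)\<^sup>2 \<le> (\<Sum>m\<in>{..<k} - {j}. (x t m b)\<^sup>2)"
          using sk sj by (intro member_le_sum) auto
        ultimately have "(x t (si t) b)\<^sup>2 \<le> (x t j b)\<^sup>2" by simp
        then have "x t (si t) b \<le> x t j b"
          using x_pos[OF jk b, of t] by (simp add: power2_le_iff_abs_le)
        then have "j \<in> P t" using that jk by (auto simp: P_def as)
        then show False using notboth that as by simp
      qed
      have lj: "l j < l m" if "j \<in> P t" "m \<in> P t" "m \<noteq> j" for m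
      proof -
        have mk: "m < k" using that by (simp add: P_def)
        have "mu j b (N t j b) \<le> mu m b (N t m b)"
          using best_le[OF b mk] by (simp add: j_def)
        then show ?thesis
          using sep[OF jk mk] that inwin[of j] inwin[of m] lu[OF jk] g by force
      qed
      consider (out) "a \<notin> P (Suc t)" "a \<notin> P t" | (enter) "a \<notin> P t" "a \<in> P (Suc t)" | (stay) "a \<in> P t"
        by blast
      then show ?thesis
      proof cases
        case out
        then have "P (Suc t) = P t" using Pmem by (intro set_eqI) (metis insert_iff)
        then show ?thesis using Suc out xo by (force simp: inv_def)
      next
        case enter
        then have PS: "P (Suc t) = insert a (P t)"
          using Pmem by (intro set_eqI) (metis insert_iff)
        have c: "card (P (Suc t)) = Suc (card (P t))" using enter finP by (simp add: PS)
        \<comment> \<open>A newcomer was below \<open>q\<close> and moved by one replication. Since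
          \<open>2 \<le> k\<close>, the bound \<open>2 * q\<close> fits under
          \<open>k ^ c * q\<close> for every \<open>c \<ge> 1\<close>. The old members keep the
          exponent \<open>card (P t)\<close>, which is now one less than the cardinality.\<close>
        have xa2: "x (Suc t) a b \<le> 2 * q" using enter ak lam_q[OF ak] by (auto simp: P_def xa)
        have kc: "2 * q \<le> real k ^ c * q" if "1 \<le> c" for c
        proof -
          have "2 \<le> real k ^ 1" using k2 by simp
          also have "\<dots> \<le> real k ^ c" using that k1 by (intro power_increasing)
          finally show ?thesis using q0 by simp
        qed
        have kq: "real k ^ card (P t) * q \<le> real k ^ Suc (card (P t)) * q"
          using q0 k1 by (intro mult_right_mono power_increasing) auto
        have ne: "1 \<le> card (P t)" if "\<exists>j\<in>P (Suc t). l j < l a"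
        proof -
          have "P t \<noteq> {}" using that by (auto simp: PS)
          then show ?thesis using finP by (simp add: Suc_leI card_gt_0_iff)
        qed
        show ?thesis unfolding inv_def
        proof (intro ballI)
          fix i assume i: "i \<in> P (Suc t)"
          show "x (Suc t) i b \<le> real k ^ card (P (Suc t)) * q \<and>
              ((\<exists>j\<in>P (Suc t). l j < l i) \<longrightarrow> x (Suc t) i b \<le> real k ^ (card (P (Suc t)) - 1) * q)"
          proof (cases "i = a")
            case True
            have "x (Suc t) a b \<le> real k ^ card (P (Suc t)) * q"
              using xa2 kc[of "Suc (card (P t))"] unfolding c by linarith
            moreover have "x (Suc t) a b \<le> real k ^ (card (P (Suc t)) - 1) * q"
              if "\<exists>j\<in>P (Suc t). l j < l a"
              using xa2 kc[OF ne[OF that]] unfolding c by simp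
            ultimately show ?thesis using True by blast
          next
            case False
            then have "i \<in> P t" using i PS by auto
            then have "x t i b \<le> real k ^ card (P t) * q" using Suc by (auto simp: inv_def)
            then show ?thesis using kq False by (simp add: c xo)
          qed
        qed
      next
        case stay
        then have aj: "a = j" and xj: "(x t j b)\<^sup>2 < (\<Sum>m\<in>{..<k} - {j}. (x t m b)\<^sup>2)"
          using aP by auto
        have "P (Suc t) = P t"
        proof -
          have "q \<le> x (Suc t) a b" using stay lam_pos[OF ak b] by (simp add: P_def xa add_increasing2)
          then have "a \<in> P (Suc t)" using ak by (simp add: P_def)
          then show ?thesis using stay Pmem by (intro set_eqI) metis
        qed
        \<comment> \<open>\<open>c\<close> bounds all other solutions: those in \<open>P t\<close>
          have a larger \<open>l\<close> than the sample best, hence the smaller exponent, and those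
          outside are below \<open>q\<close>. The norm test then gives
          \<open>x t j b < (k - 1) * c\<close>, and the next replication costs at most
          \<open>q \<le> c\<close>.\<close>
        define c where "c = real k ^ (card (P t) - 1) * q"
        have cq: "q \<le> c" using q0 k1 by (simp add: c_def)
        have cardpos: "0 < card (P t)" using stay finP by (auto simp: card_gt_0_iff)
        then have kc: "real k ^ card (P t) * q = real k * c"
          by (cases "card (P t)") (auto simp: c_def)
        have xm: "x t m b \<le> c" if "m \<in> {..<k} - {j}" for m
        proof (cases "m \<in> P t")
          case True
          then show ?thesis using lj[of m] that stay Suc aj unfolding inv_def c_def by auto
        next
          case False
          then show ?thesis using that cq by (auto simp: P_def)
        qed
        have "(\<Sum>m\<in>{..<k} - {j}. (x t m b)\<^sup>2) \<le> (\<Sum>m\<in>{..<k} - {j}. c\<^sup>2)"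
          using xm x_pos[OF _ b] by (intro sum_mono power_mono) (auto simp: less_imp_le)
        also have "\<dots> = real (k - 1) * c\<^sup>2" using jk by simp
        also have "\<dots> \<le> (real (k - 1) * c)\<^sup>2"
          using k2 cq q0 by (simp add: power_mult_distrib power2_eq_square)
        finally have "(x t j b)\<^sup>2 < (real (k - 1) * c)\<^sup>2" using xj by simp
        then have "x t j b < real (k - 1) * c"
          using cq q0 by (meson mult_nonneg_nonneg of_nat_0_le_iff order_less_imp_le order_trans power2_less_imp_less)
        then have "x (Suc t) j b < real (k - 1) * c + q" using xa lam_q[OF ak] aj by simp
        also have "\<dots> \<le> real k * c" using k2 cq by (simp add: of_nat_diff algebra_simps)
        finally have *: "x (Suc t) j b \<le> real k ^ card (P t) * q" using kc by simp
        show ?thesis unfolding inv_def \<open>P (Suc t) = P t\<close>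
        proof (intro ballI)
          fix i assume i: "i \<in> P t"
          have no: "\<not> l m < l j" if "m \<in> P t" for m using lj[of m] that stay aj by (cases "m = j") auto
          show "x (Suc t) i b \<le> real k ^ card (P t) * q \<and>
              ((\<exists>j\<in>P t. l j < l i) \<longrightarrow> x (Suc t) i b \<le> real k ^ (card (P t) - 1) * q)"
            using Suc i * no aj xo[of i] unfolding inv_def by (cases "i = j") auto
        qed
      qed
    qed
  qed
  then show ?thesis using big i by blast
qed

end

text \<open>\<open>[l i, u i]\<close> contains the sample means of solution \<open>i\<close> throughout the window, and \<open>g\<close> is large
  enough for any two solutions in the window to have \<open>V > K\<close>.\<close>

definition separated_window ::
    "nat \<Rightarrow> (nat \<Rightarrow> real) \<Rightarrow> (nat \<Rightarrow> nat \<Rightarrow> real) \<Rightarrow> real \<Rightarrow> real \<Rightarrow> bool" where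
  "separated_window k lam mu K q \<longleftrightarrow> (\<exists>l u g. 0 < g \<and> (\<forall>i<k. l i \<le> u i) \<and>
     (\<forall>i<k. \<forall>s. q \<le> real s / lam i \<longrightarrow> real s / lam i \<le> real k ^ k * q \<longrightarrow>
        l i \<le> mu i s \<and> mu i s \<le> u i) \<and>
     (\<forall>i<k. \<forall>j<k. i \<noteq> j \<longrightarrow> u i + g \<le> l j \<or> u j + g \<le> l i) \<and>
     (\<forall>i<k. \<forall>j<k. K < g\<^sup>2 * q / (2 * (lam i + lam j))))"

context sampling_path
begin

text \<open>A bounded count keeps its term in the denominator of \<open>V\<close> away from 0, which
  bounds \<open>V\<close> for some competing pair. Minimality carries the bound to the selected
  pair, at the price of the bounds \<open>1\<close> and \<open>Wm\<close> on the weights.\<close>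

lemma selected_le_if_count_bounded:
  assumes i: "i < k" and b: "b < B" and c: "\<And>t. N t i b \<le> c"
    and M: "\<And>i b s. i < k \<Longrightarrow> b < B \<Longrightarrow> \<bar>mu i b s\<bar> \<le> M"
  shows "V t (si t) (sb t) \<le> Wm * ((2 * M)\<^sup>2 / (2 * ((lam i b)\<^sup>2 / real c)))"
proof -
  let ?j = "best t b"
  \<comment> \<open>The competitor whose denominator contains the count of \<open>i\<close>:
    \<open>i\<close> itself, or any other solution at \<open>b\<close> when \<open>i\<close> is the
    sample best.\<close>
  obtain a where a: "a < k" "a \<noteq> ?j" "a = i \<or> ?j = i"
  proof (cases "i = ?j")
    case True
    define a where "a = (if i = 0 then 1 else 0 :: nat)"
    have "a < k" "a \<noteq> ?j" using k2 True by (auto simp: a_def)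
    then show ?thesis using that True by blast
  qed (use i that in blast)
  have j: "?j < k" using best_less[OF b] .
  have M0: "0 \<le> M" using M[OF i b, of 0] by linarith
  have lc: "(lam i b)\<^sup>2 / real c \<le> (lam i b)\<^sup>2 / real (N t i b)"
    using c[of t] N_pos[of t i b] by (intro divide_left_mono) auto
  have "(lam i b)\<^sup>2 / real c \<le> (lam a b)\<^sup>2 / real (N t a b) + (lam ?j b)\<^sup>2 / real (N t ?j b)"
    using a(3) lc by (smt (verit) divide_nonneg_nonneg of_nat_0_le_iff zero_le_power2)
  moreover have "0 < (lam i b)\<^sup>2 / real c"
    using c[of t] N_pos[of t i b] lam_pos[OF i b] by (intro divide_pos_pos) auto
  moreover have "(mu a b (N t a b) - mu ?j b (N t ?j b))\<^sup>2 \<le> (2 * M)\<^sup>2"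
    using M[OF a(1) b, of "N t a b"] M[OF j b, of "N t ?j b"] M0
    by (intro power2_le_iff_abs_le[THEN iffD2]) auto
  ultimately have Va: "V t a b \<le> (2 * M)\<^sup>2 / (2 * ((lam i b)\<^sup>2 / real c))"
    unfolding V_def by (intro frac_le) auto
  have "V t (si t) (sb t) \<le> W t (si t) (sb t) * V t (si t) (sb t)"
    using mult_right_mono[OF W_ge[OF si_less sb_less si_neq] V_nonneg[OF si_less sb_less, of t]]
    by simp
  also have "\<dots> \<le> W t a b * V t a b" by (rule sel_min[OF a(1) b a(2)])
  also have "\<dots> \<le> Wm * V t a b"
    by (intro mult_right_mono W_le V_nonneg a b)
  also have "\<dots> \<le> Wm * ((2 * M)\<^sup>2 / (2 * ((lam i b)\<^sup>2 / real c)))"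
    using Va W_ge[OF a(1) b a(2)] W_le[OF a(1) b a(2)] by (intro mult_left_mono) auto
  finally show ?thesis .
qed

lemma counts_at_top:
  assumes M: "\<And>i b s. i < k \<Longrightarrow> b < B \<Longrightarrow> \<bar>mu i b s\<bar> \<le> M"
    and win: "\<And>b K q0. b < B \<Longrightarrow>
      \<exists>q>q0. separated_window k (\<lambda>i. lam i b) (\<lambda>i. mu i b) K q"
    and i: "i < k" and b: "b < B"
  shows "filterlim (\<lambda>t. N t i b) at_top sequentially"
proof (rule ccontr)
  assume "\<not> ?thesis"
  then obtain c where "\<And>t0. \<exists>t\<ge>t0. N t i b < c"
    by (auto simp: filterlim_at_top eventually_sequentially not_le)
  then have c: "N t i b \<le> c" for t
    by (meson N_mono less_imp_le order_trans)
  \<comment> \<open>One \<open>K\<close> serves all times and, as the selection minimizes over all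
    parameter values, every \<open>b'\<close>. It depends on the path, which is why
    \<open>win\<close> is stated for every \<open>K\<close>.\<close>
  define K where "K = Wm * ((2 * M)\<^sup>2 / (2 * ((lam i b)\<^sup>2 / real c)))"
  have K: "V t (si t) (sb t) \<le> K" for t
    unfolding K_def by (rule selected_le_if_count_bounded[OF i b c M])
  have "\<exists>Q::nat. \<forall>t. \<forall>i<k. N t i b' \<le> Q" if b': "b' < B" for b'
  proof -
    \<comment> \<open>Beyond \<open>q0\<close> all solutions start below the window.\<close>
    define q0 where "q0 = (\<Sum>i<k. real n0 / lam i b')"
    have q0: "real n0 / lam i b' \<le> q0" if "i < k" for i
      unfolding q0_def using that lam_pos[OF _ b'] 
      by (intro member_le_sum) (auto intro!: divide_nonneg_pos)
    obtain q where q_gt: "q0 < q" and sw: "separated_window k (\<lambda>i. lam i b') (\<lambda>i. mu i b') K q"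
      using win[OF b'] by blast
    from sw obtain l u g where q: "0 < g" "\<forall>i<k. l i \<le> u i"
        "\<forall>i<k. \<forall>s. q \<le> real s / lam i b' \<longrightarrow> real s / lam i b' \<le> real k ^ k * q \<longrightarrow>
           l i \<le> mu i b' s \<and> mu i b' s \<le> u i"
        "\<forall>i<k. \<forall>j<k. i \<noteq> j \<longrightarrow> u i + g \<le> l j \<or> u j + g \<le> l i"
        "\<forall>i<k. \<forall>j<k. K < g\<^sup>2 * q / (2 * (lam i b' + lam j b'))"
      unfolding separated_window_def by (elim exE conjE) (rule that)
    have x: "x t i b' \<le> real k ^ k * q" if "i < k" for t i
    proof (rule window_bound[OF b', of q K l u g])
      show "real n0 / lam i b' < q" if "i < k" for i using q0[OF that] q_gt by simp
      show "V t (si t) b' \<le> K" if "sb t = b'" for t using K[of t] that by simp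
    qed (use q that in auto)
    define Q where "Q = (\<Sum>i<k. real k ^ k * q * lam i b')"
    have "real (N t i b') \<le> Q" if "i < k" for t i
    proof -
      have qp: "0 \<le> q" using x[OF that, of t] x_pos[OF that b', of t] k2
        by (smt (verit) mult_nonneg_nonpos of_nat_0_le_iff zero_le_power)
      have "real (N t i b') \<le> real k ^ k * q * lam i b'"
        using x[OF that, of t] lam_pos[OF that b'] by (simp add: x_def divide_le_eq)
      also have "\<dots> \<le> Q" unfolding Q_def
        using that lam_pos[OF _ b'] qp by (intro member_le_sum) (auto intro!: mult_nonneg_nonneg simp: less_imp_le)
      finally show ?thesis .
    qed
    then have "\<forall>t. \<forall>i<k. N t i b' \<le> nat \<lceil>Q\<rceil>"
      using real_nat_ceiling_ge[of Q] of_nat_le_iff[where 'a=real] order_trans by metis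
    then show ?thesis by blast
  qed
  then obtain Q where Q: "\<And>b t i. b < B \<Longrightarrow> i < k \<Longrightarrow> N t i b \<le> (Q b :: nat)" by metis
  \<comment> \<open>Bounded counts at every parameter value contradict the total, which grows by one
    per step.\<close>
  have "n0 * k * B + t \<le> (\<Sum>i<k. \<Sum>b<B. Q b)" for t
    unfolding N_total[symmetric] by (intro sum_mono Q) auto
  from this[of "Suc (\<Sum>i<k. \<Sum>b<B. Q b)"] show False by simp
qed

lemma last_step:
  assumes "t1 \<le> t" "N t1 i b < N t i b"
  obtains s where "t1 \<le> s" "s < t" "sb s = b" "arm s b = i" "N (Suc s) i b = N t i b"
proof -
  have "\<exists>s\<ge>t1. s < t \<and> sb s = b \<and> arm s b = i \<and> N (Suc s) i b = N t i b"
    using assms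
  proof (induction t)
    case (Suc t)
    show ?case
    proof (cases "sb t = b \<and> arm t b = i")
      case True
      have "t1 \<le> t" using Suc.prems by (cases "t1 = Suc t") auto
      then show ?thesis using True by auto
    next
      case False
      then have eq: "N (Suc t) i b = N t i b" by (auto simp: N_step)
      then have "t1 \<le> t" using Suc.prems by (cases "t1 = Suc t") auto
      then show ?thesis using Suc eq by (metis less_Suc_eq)
    qed
  qed simp
  then show ?thesis using that by blast
qed

end

subsection \<open>Balance of the weighted rates\<close>

text \<open>\<open>1 / (p / x + r / y)\<close> is nondecreasing in \<open>x\<close> and
  \<open>y\<close> and homogeneous of degree one.\<close>

lemma harmonic_scale:
  fixes p r c :: real
  assumes "0 < p" "0 < r" "0 < c" "0 < x" "0 < y" "0 < x'" "0 < y'" "c * x \<le> x'" "c * y \<le> y'"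
  shows "c * (1 / (p / x + r / y)) \<le> 1 / (p / x' + r / y')"
proof -
  have "p / x' + r / y' \<le> p / (c * x) + r / (c * y)"
    using assms by (intro add_mono divide_left_mono) auto
  also have "\<dots> = (p / x + r / y) / c" using assms by (simp add: field_simps)
  finally have "1 / ((p / x + r / y) / c) \<le> 1 / (p / x' + r / y')"
    using assms by (intro divide_left_mono mult_pos_pos divide_pos_pos add_pos_pos) auto
  then show ?thesis by simp
qed

locale consistent_sampling_path = sampling_path +
  fixes y :: "nat \<Rightarrow> nat \<Rightarrow> real" and ib :: "nat \<Rightarrow> nat" and Ws :: "nat \<Rightarrow> nat \<Rightarrow> real"
  assumes mu_lim: "\<And>i b. i < k \<Longrightarrow> b < B \<Longrightarrow> mu i b \<longlonglongrightarrow> y i b"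
    and N_top: "\<And>i b. i < k \<Longrightarrow> b < B \<Longrightarrow> filterlim (\<lambda>t. N t i b) at_top sequentially"
    and ib_less: "\<And>b. b < B \<Longrightarrow> ib b < k"
    and ib_opt: "\<And>b j. b < B \<Longrightarrow> j < k \<Longrightarrow> j \<noteq> ib b \<Longrightarrow> y (ib b) b < y j b"
    and W_lim: "\<And>t i b. \<forall>b<B. best t b = ib b \<Longrightarrow> i < k \<Longrightarrow> b < B \<Longrightarrow> i \<noteq> ib b \<Longrightarrow> W t i b = Ws i b"
    and Ws_pos: "\<And>i b. i < k \<Longrightarrow> b < B \<Longrightarrow> i \<noteq> ib b \<Longrightarrow> 0 < Ws i b"
begin

lemma mu_N_lim: "i < k \<Longrightarrow> b < B \<Longrightarrow> (\<lambda>t. mu i b (N t i b)) \<longlonglongrightarrow> y i b"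
  by (rule filterlim_compose[OF mu_lim N_top])

lemma eventually_best: "\<forall>\<^sub>F t in sequentially. \<forall>b\<in>{..<B}. best t b = ib b"
proof (intro eventually_ball_finite ballI)
  fix b assume "b \<in> {..<B}"
  then have b: "b < B" by simp
  have "\<forall>\<^sub>F t in sequentially. \<forall>j\<in>{..<k} - {ib b}. mu (ib b) b (N t (ib b) b) < mu j b (N t j b)"
  proof (intro eventually_ball_finite ballI)
    fix j assume "j \<in> {..<k} - {ib b}"
    then have j: "j < k" "j \<noteq> ib b" by auto
    obtain c where c: "y (ib b) b < c" "c < y j b" using dense[OF ib_opt[OF b j]] by blast
    show "\<forall>\<^sub>F t in sequentially. mu (ib b) b (N t (ib b) b) < mu j b (N t j b)"
      using order_tendstoD(2)[OF mu_N_lim[OF ib_less[OF b] b] c(1)]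
        order_tendstoD(1)[OF mu_N_lim[OF j(1) b] c(2)]
      by eventually_elim simp
  qed simp
  then show "\<forall>\<^sub>F t in sequentially. best t b = ib b"
  proof eventually_elim
    case (elim t)
    show ?case
    proof (rule ccontr)
      assume "best t b \<noteq> ib b"
      then have "mu (ib b) b (N t (ib b) b) < mu (best t b) b (N t (best t b) b)"
        using elim best_less[OF b] by blast
      then show False using best_le[OF b ib_less[OF b], of t] by simp
    qed
  qed
qed simp

section \<open>Balance between the conditional optimum and the other solutions\<close>

definition sig :: "nat \<Rightarrow> nat \<Rightarrow> real" where
  "sig t b = sqrt (\<Sum>j\<in>{..<k} - {ib b}. (x t j b)\<^sup>2)"

text \<open>Once \<open>best t b = ib b\<close>, \<open>v\<close> is the product of
  \<open>gam\<close> and a function of the two \<open>x\<close> values. \<open>gam\<close> has a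
  positive limit, so the other factor is the one to be controlled.\<close>

definition gam :: "nat \<Rightarrow> nat \<Rightarrow> nat \<Rightarrow> real" where
  "gam t i b = Ws i b * (mu i b (N t i b) - mu (ib b) b (N t (ib b) b))\<^sup>2 / 2"

definition v :: "nat \<Rightarrow> nat \<Rightarrow> nat \<Rightarrow> real" where
  "v t i b = Ws i b * V t i b"

definition vmin :: "nat \<Rightarrow> real" where
  "vmin t = v t (si t) (sb t)"

lemma x_top: "i < k \<Longrightarrow> b < B \<Longrightarrow> filterlim (\<lambda>t. x t i b) at_top sequentially"
  unfolding x_def divide_inverse
  using lam_pos by (intro filterlim_at_top_mult_tendsto_pos[OF tendsto_const]
    filterlim_compose[OF filterlim_real_sequentially N_top]) auto

lemma sig_pos: "b < B \<Longrightarrow> 0 < sig t b"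
proof -
  assume b: "b < B"
  obtain j where "j < k" "j \<noteq> ib b"
    using k2 by (cases "ib b = 0") (auto intro: that[of 0] that[of 1])
  then show ?thesis unfolding sig_def real_sqrt_gt_0_iff
    using x_pos[of j b t] b by (intro sum_pos2[of _ j]) auto
qed

text \<open>Once the sample best is right, the norm test is negative feedback on the difference of
  squares: a negative value is raised, a nonnegative one lowered. Its modulus therefore never
  exceeds both its old value and the size of one step, and a step is linear in the counts while the
  squares are quadratic.\<close>

lemma imbalance_bound:
  assumes b: "b < B"
  shows "\<exists>C0 C. \<forall>t. \<bar>(x t (ib b) b)\<^sup>2 - (sig t b)\<^sup>2\<bar> \<le> C0 + C * (\<Sum>i<k. x t i b)"
proof -
  define D where "D t = (x t (ib b) b)\<^sup>2 - (sig t b)\<^sup>2" for t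
  define X where "X t = (\<Sum>i<k. x t i b)" for t
  obtain T where T: "\<And>t. t \<ge> T \<Longrightarrow> best t b = ib b"
    using eventually_best b unfolding eventually_sequentially by auto
  define L where "L = (\<Sum>i<k. 1 / lam i b)"
  have L: "1 / lam i b \<le> L" if "i < k" for i
    unfolding L_def using that lam_pos[OF _ b]
    by (intro member_le_sum) (auto simp: less_imp_le)
  have L0: "0 \<le> L" unfolding L_def using lam_pos[OF _ b] by (intro sum_nonneg) (auto simp: less_imp_le)
  have sig2: "(sig t b)\<^sup>2 = (\<Sum>j\<in>{..<k} - {ib b}. (x t j b)\<^sup>2)" for t
    unfolding sig_def by (intro real_sqrt_pow2 sum_nonneg) auto
  have X_ge: "x t i b \<le> X t" if "i < k" for t i
    unfolding X_def using that x_pos[OF _ b] by (intro member_le_sum) (auto simp: less_imp_le)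
  have X_mono: "X t \<le> X (Suc t)" for t
    unfolding X_def by (intro sum_mono x_mono b) auto
  have X0: "0 \<le> X t" for t unfolding X_def using x_pos[OF _ b] by (intro sum_nonneg) (auto simp: less_imp_le)
  have sq: "(x (Suc t) a b)\<^sup>2 - (x t a b)\<^sup>2 \<le> 2 * L * X t + L\<^sup>2 \<and> (x t a b)\<^sup>2 \<le> (x (Suc t) a b)\<^sup>2"
    if a: "a < k" for a t
  proof -
    let ?d = "x (Suc t) a b - x t a b"
    have d: "0 \<le> ?d" "?d \<le> L" using x_mono[OF a b, of t "Suc t"] L[OF a] L0 by (auto simp: x_step)
    have "(x (Suc t) a b)\<^sup>2 - (x t a b)\<^sup>2 = 2 * ?d * x t a b + ?d\<^sup>2"
      by (simp add: power2_eq_square algebra_simps)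
    also have "\<dots> \<le> 2 * L * X t + L\<^sup>2"
      using d X_ge[OF a] x_pos[OF a b, of t] L0 by (intro add_mono mult_mono power_mono) auto
    finally show ?thesis using d x_pos[OF a b, of t] by (simp add: power_mono)
  qed
  have step: "\<bar>D (Suc t)\<bar> \<le> max \<bar>D t\<bar> (2 * L * X t + L\<^sup>2)" if "t \<ge> T" for t
  proof (cases "sb t = b")
    case False
    then have "D (Suc t) = D t" by (simp add: D_def sig2 x_step)
    then show ?thesis by simp
  next
    case True
    show ?thesis
    proof (cases "D t < 0")
      case neg: True
      then have a: "arm t b = ib b" using T[OF that] by (simp add: arm_def D_def sig2)
      have "sig (Suc t) b = sig t b"
        unfolding sig_def by (intro arg_cong[where f=sqrt] sum.cong) (auto simp: x_step a)
      then show ?thesis using sq[OF ib_less[OF b], of t] neg by (auto simp: D_def)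
    next
      case pos: False
      then have a: "arm t b = si t" using T[OF that] by (simp add: arm_def D_def sig2)
      have si: "si t \<in> {..<k} - {ib b}" using si_less si_neq[of t] True T[OF that] by auto
      have "(sig (Suc t) b)\<^sup>2 - (sig t b)\<^sup>2 = (x (Suc t) (si t) b)\<^sup>2 - (x t (si t) b)\<^sup>2"
        unfolding sig2 by (subst (1 2) sum.remove[OF _ si]) (auto simp: x_step a)
      moreover have "x (Suc t) (ib b) b = x t (ib b) b" using si by (simp add: x_step a)
      ultimately show ?thesis using sq[OF si_less, of t t] pos by (auto simp: D_def)
    qed
  qed
  have late: "\<bar>D t\<bar> \<le> \<bar>D T\<bar> + L\<^sup>2 + 2 * L * X t" if "t \<ge> T" for t
    using that
  proof (induction t rule: dec_induct)
    case base
    then show ?case using X0[of T] L0 by simp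
  next
    case (step t)
    have "2 * L * X t \<le> 2 * L * X (Suc t)" using X_mono[of t] L0 by (intro mult_left_mono) auto
    then show ?case using step.IH \<open>\<And>t. T \<le> t \<Longrightarrow> \<bar>D (Suc t)\<bar> \<le> _\<close>[OF step.hyps(1)]
      by (smt (verit) abs_ge_zero zero_le_power2)
  qed
  \<comment> \<open>The finitely many times before \<open>T\<close>, when the sample best may be
    wrong, are absorbed here.\<close>
  define C0 where "C0 = \<bar>D T\<bar> + L\<^sup>2 + (\<Sum>t<T. \<bar>D t\<bar>)"
  have "\<bar>D t\<bar> \<le> C0 + 2 * L * X t" for t
  proof (cases "t \<ge> T")
    case True
    moreover have "0 \<le> (\<Sum>t<T. \<bar>D t\<bar>)" by (simp add: sum_nonneg)
    ultimately show ?thesis using late[OF True] unfolding C0_def by linarith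
  next
    case False
    then have "\<bar>D t\<bar> \<le> (\<Sum>t<T. \<bar>D t\<bar>)" by (intro member_le_sum) auto
    also have "\<dots> \<le> C0 + 2 * L * X t" using X0[of t] L0 by (simp add: C0_def)
    finally show ?thesis .
  qed
  then show ?thesis unfolding D_def X_def by blast
qed

lemma sig_sq: "(sig t b)\<^sup>2 = (\<Sum>j\<in>{..<k} - {ib b}. (x t j b)\<^sup>2)"
  unfolding sig_def by (intro real_sqrt_pow2 sum_nonneg) auto

lemma x_le_sig:
  assumes "b < B" "j < k" "j \<noteq> ib b"
  shows "x t j b \<le> sig t b"
proof -
  have "(x t j b)\<^sup>2 \<le> (sig t b)\<^sup>2"
    unfolding sig_sq using assms member_le_sum[of j "{..<k} - {ib b}" "\<lambda>j. (x t j b)\<^sup>2"] by auto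
  then show ?thesis by (rule power2_le_imp_le[OF _ less_imp_le[OF sig_pos[OF assms(1)]]])
qed

lemma balance_lim:
  assumes b: "b < B"
  shows "(\<lambda>t. sig t b / x t (ib b) b) \<longlonglongrightarrow> 1"
proof -
  let ?xb = "\<lambda>t. x t (ib b) b"
  obtain C0 C where C: "\<And>t. \<bar>(?xb t)\<^sup>2 - (sig t b)\<^sup>2\<bar> \<le> C0 + C * (\<Sum>i<k. x t i b)"
    using imbalance_bound[OF b] by blast
  define X where "X t = (\<Sum>i<k. x t i b)" for t
  \<comment> \<open>By Cauchy-Schwarz the sum of both squares is at least
    \<open>(X t)\<^sup>2 / k\<close>, against a numerator linear in \<open>X t\<close>. The desired
    ratio is recovered as \<open>sqrt ((1 - d t) / (1 + d t))\<close>.\<close>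
  define d where "d t = ((?xb t)\<^sup>2 - (sig t b)\<^sup>2) / ((?xb t)\<^sup>2 + (sig t b)\<^sup>2)" for t
  have xb: "0 < ?xb t" for t by (rule x_pos[OF ib_less[OF b] b])
  have Xp: "0 < X t" for t
    unfolding X_def using k2 x_pos[OF _ b] by (intro sum_pos) (auto simp: lessThan_empty_iff)
  have Xtop: "filterlim X at_top sequentially"
  proof (rule filterlim_at_top_mono[OF x_top[OF ib_less[OF b] b]])
    show "\<forall>\<^sub>F t in sequentially. ?xb t \<le> X t"
      unfolding X_def using x_pos[OF _ b] ib_less[OF b]
      by (intro always_eventually allI member_le_sum) (auto simp: less_imp_le)
  qed
  have X2: "(X t)\<^sup>2 \<le> real k * ((?xb t)\<^sup>2 + (sig t b)\<^sup>2)" for t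
  proof -
    have "(X t)\<^sup>2 \<le> (\<Sum>i<k. (x t i b)\<^sup>2) * (\<Sum>i<k. 1\<^sup>2)"
      unfolding X_def using Cauchy_Schwarz_ineq_sum[of "\<lambda>i. x t i b" "\<lambda>_. 1" "{..<k}"] by simp
    also have "(\<Sum>i<k. (x t i b)\<^sup>2) = (?xb t)\<^sup>2 + (sig t b)\<^sup>2"
      unfolding sig_sq using ib_less[OF b] by (subst sum.remove[of _ "ib b"]) auto
    finally show ?thesis by (simp add: mult.commute)
  qed
  have "d \<longlonglongrightarrow> 0"
  proof (rule Lim_null_comparison)
    show "\<forall>\<^sub>F t in sequentially. norm (d t) \<le> real k * ((C0 + C * X t) / (X t)\<^sup>2)"
    proof (intro always_eventually allI)
      fix t
      have p: "0 < (?xb t)\<^sup>2 + (sig t b)\<^sup>2" using xb[of t] by (intro add_pos_nonneg) auto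
      have "norm (d t) = \<bar>(?xb t)\<^sup>2 - (sig t b)\<^sup>2\<bar> / ((?xb t)\<^sup>2 + (sig t b)\<^sup>2)"
        using p by (simp add: d_def abs_divide)
      also have "\<dots> \<le> (C0 + C * X t) / ((X t)\<^sup>2 / real k)"
      proof (rule frac_le)
        show "(X t)\<^sup>2 / real k \<le> (?xb t)\<^sup>2 + (sig t b)\<^sup>2"
          using X2[of t] k2 by (simp add: divide_le_eq mult.commute)
        show "0 \<le> C0 + C * X t" using order_trans[OF abs_ge_zero C] by (simp add: X_def)
      qed (use C[of t] Xp[of t] k2 in \<open>auto simp: X_def[symmetric]\<close>)
      finally show "norm (d t) \<le> real k * ((C0 + C * X t) / (X t)\<^sup>2)" by (simp add: mult.commute)
    qed
    have "((\<lambda>z. real k * ((C0 + C * z) / z\<^sup>2)) \<longlongrightarrow> 0) at_top"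
      by real_asymp
    then show "(\<lambda>t. real k * ((C0 + C * X t) / (X t)\<^sup>2)) \<longlonglongrightarrow> 0"
      by (rule filterlim_compose[OF _ Xtop])
  qed
  then have "(\<lambda>t. sqrt ((1 - d t) / (1 + d t))) \<longlonglongrightarrow> sqrt ((1 - 0) / (1 + 0))"
    by (intro tendsto_intros) auto
  moreover have "sqrt ((1 - d t) / (1 + d t)) = sig t b / ?xb t" for t
  proof -
    have p: "0 < (?xb t)\<^sup>2 + (sig t b)\<^sup>2" using xb[of t] by (intro add_pos_nonneg) auto
    let ?s = "(?xb t)\<^sup>2 + (sig t b)\<^sup>2"
    have "1 = ?s / ?s" using p by (metis divide_self less_irrefl)
    then have "1 - d t = (?s - ((?xb t)\<^sup>2 - (sig t b)\<^sup>2)) / ?s"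
        "1 + d t = (?s + ((?xb t)\<^sup>2 - (sig t b)\<^sup>2)) / ?s"
      unfolding d_def diff_divide_distrib[of ?s] add_divide_distrib[of ?s] by simp_all
    then have "(1 - d t) / (1 + d t) = (sig t b)\<^sup>2 / (?xb t)\<^sup>2"
      using less_imp_neq[OF p] by simp
    then show ?thesis using xb[of t] sig_pos[OF b, of t] by (simp add: real_sqrt_divide)
  qed
  ultimately show ?thesis by simp
qed

section \<open>No weighted rate exceeds the minimal one asymptotically\<close>

definition settled :: "real \<Rightarrow> nat \<Rightarrow> bool" where
  "settled \<eta> T \<longleftrightarrow> (\<forall>t\<ge>T. \<forall>b\<in>{..<B}. best t b = ib b \<and>
     \<eta> * x t (ib b) b \<le> sig t b \<and> \<eta> * sig t b \<le> x t (ib b) b \<and>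
     (\<forall>i\<in>{..<k} - {ib b}. 0 < gam t i b \<and> (\<forall>t'\<ge>T. \<eta> * gam t' i b \<le> gam t i b) \<and>
        \<eta> * (x t i b + 1 / lam i b) \<le> x t i b))"

lemma gam_lim:
  assumes "b < B" "i < k" "i \<noteq> ib b"
  shows "(\<lambda>t. gam t i b) \<longlonglongrightarrow> Ws i b * (y i b - y (ib b) b)\<^sup>2 / 2"
  unfolding gam_def using assms ib_less by (intro tendsto_intros mu_N_lim) auto

text \<open>One \<open>\<eta>\<close> close to 1 records all that holds up to a factor from some
  time on: balance of the optimum with the others, near constancy of \<open>gam\<close>, negligible
  effect of one replication. The comparison of rates then consists of exact inequalities that lose
  explicit powers of \<open>\<eta>\<close>.\<close>

lemma settled_exists:
  assumes \<eta>: "0 < \<eta>" "\<eta> < 1"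
  shows "\<exists>T. settled \<eta> T"
proof -
  define c where "c i b = Ws i b * (y i b - y (ib b) b)\<^sup>2 / 2" for i b
  have c: "0 < c i b" if "b < B" "i < k" "i \<noteq> ib b" for i b
    unfolding c_def using Ws_pos[of i b] ib_opt[of b i] that
    by (intro divide_pos_pos mult_pos_pos) auto
  \<comment> \<open>Two values of \<open>gam\<close> are compared, each within a factor
    \<open>s\<close> of the limit, so \<open>s * s\<close> has to be \<open>\<eta>\<close>.\<close>
  define s where "s = sqrt \<eta>"
  have s: "0 < s" "s < 1" "s * s = \<eta>" using \<eta> by (auto simp: s_def)
  have "\<forall>\<^sub>F t in sequentially. \<forall>b\<in>{..<B}. \<eta> * x t (ib b) b \<le> sig t b \<and> \<eta> * sig t b \<le> x t (ib b) b"
  proof (intro eventually_ball_finite ballI)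
    fix b assume "b \<in> {..<B}"
    then have b: "b < B" by simp
    have "1 < 1 / \<eta>" using \<eta> by simp
    with \<eta> have "\<forall>\<^sub>F t in sequentially. \<eta> < sig t b / x t (ib b) b"
      and "\<forall>\<^sub>F t in sequentially. sig t b / x t (ib b) b < 1 / \<eta>"
      using order_tendstoD[OF balance_lim[OF b]] by auto
    then show "\<forall>\<^sub>F t in sequentially. \<eta> * x t (ib b) b \<le> sig t b \<and> \<eta> * sig t b \<le> x t (ib b) b"
    proof eventually_elim
      case (elim t)
      then show ?case using x_pos[OF ib_less[OF b] b, of t] \<eta> by (auto simp: field_simps)
    qed
  qed simp
  moreover have "\<forall>\<^sub>F t in sequentially. \<forall>b\<in>{..<B}. \<forall>i\<in>{..<k} - {ib b}.
      s * c i b \<le> gam t i b \<and> gam t i b \<le> c i b / s \<and> \<eta> * (x t i b + 1 / lam i b) \<le> x t i b"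
  proof (intro eventually_ball_finite ballI)
    fix b i assume "b \<in> {..<B}" "i \<in> {..<k} - {ib b}"
    then have b: "b < B" and i: "i < k" "i \<noteq> ib b" by auto
    have g: "(\<lambda>t. gam t i b) \<longlonglongrightarrow> c i b" unfolding c_def by (rule gam_lim[OF b i])
    have "s * c i b < c i b" "c i b < c i b / s" using s c[OF b i] by (auto simp: field_simps)
    then have "\<forall>\<^sub>F t in sequentially. s * c i b < gam t i b" "\<forall>\<^sub>F t in sequentially. gam t i b < c i b / s"
      using order_tendstoD[OF g] by auto
    \<comment> \<open>This threshold is
      \<open>\<eta> * (x t i b + 1 / lam i b) \<le> x t i b\<close> solved for
      \<open>x t i b\<close>.\<close>
    moreover have "\<forall>\<^sub>F t in sequentially. (\<eta> / lam i b) / (1 - \<eta>) \<le> x t i b"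
      using x_top[OF i(1) b] unfolding filterlim_at_top by blast
    ultimately show "\<forall>\<^sub>F t in sequentially. s * c i b \<le> gam t i b \<and> gam t i b \<le> c i b / s \<and>
        \<eta> * (x t i b + 1 / lam i b) \<le> x t i b"
    proof eventually_elim
      case (elim t)
      have "\<eta> / lam i b \<le> x t i b * (1 - \<eta>)" using elim(3) \<eta> pos_divide_le_eq[of "1 - \<eta>" "\<eta> / lam i b" "x t i b"] by linarith
      then show ?case using elim by (simp add: algebra_simps)
    qed
  qed auto
  ultimately have "\<forall>\<^sub>F t in sequentially. \<forall>b\<in>{..<B}. best t b = ib b \<and>
     \<eta> * x t (ib b) b \<le> sig t b \<and> \<eta> * sig t b \<le> x t (ib b) b \<and>
     (\<forall>i\<in>{..<k} - {ib b}. s * c i b \<le> gam t i b \<and> gam t i b \<le> c i b / s \<and>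
        \<eta> * (x t i b + 1 / lam i b) \<le> x t i b)"
    using eventually_best by eventually_elim blast
  then obtain T where T: "\<And>t b. T \<le> t \<Longrightarrow> b \<in> {..<B} \<Longrightarrow> best t b = ib b \<and>
     \<eta> * x t (ib b) b \<le> sig t b \<and> \<eta> * sig t b \<le> x t (ib b) b \<and>
     (\<forall>i\<in>{..<k} - {ib b}. s * c i b \<le> gam t i b \<and> gam t i b \<le> c i b / s \<and>
        \<eta> * (x t i b + 1 / lam i b) \<le> x t i b)"
    unfolding eventually_sequentially by blast
  have "0 < gam t i b \<and> \<eta> * gam t' i b \<le> gam t i b"
    if "T \<le> t" "T \<le> t'" "b \<in> {..<B}" "i \<in> {..<k} - {ib b}" for t t' b i
  proof -
    have lo: "s * c i b \<le> gam t i b" and hi: "gam t' i b \<le> c i b / s" using T that by blast+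
    have cp: "0 < c i b" using c that by auto
    then have "0 < s * c i b" using s by simp
    moreover have "\<eta> * gam t' i b \<le> \<eta> * (c i b / s)" using hi \<eta> by (intro mult_left_mono) auto
    moreover have "\<eta> * (c i b / s) = s * c i b" using s by (simp add: field_simps flip: s(3))
    ultimately show ?thesis using lo by linarith
  qed
  then show ?thesis using T unfolding settled_def by blast
qed

context
  fixes \<eta> :: real and T :: nat
  assumes \<eta>: "0 < \<eta>" "\<eta> < 1" and settled: "settled \<eta> T"
begin

lemma settledD:
  assumes "T \<le> t" "b < B"
  shows "best t b = ib b" "\<eta> * x t (ib b) b \<le> sig t b" "\<eta> * sig t b \<le> x t (ib b) b"
    and "i < k \<Longrightarrow> i \<noteq> ib b \<Longrightarrow> 0 < gam t i b"
    and "i < k \<Longrightarrow> i \<noteq> ib b \<Longrightarrow> T \<le> t' \<Longrightarrow> \<eta> * gam t' i b \<le> gam t i b"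
    and "i < k \<Longrightarrow> i \<noteq> ib b \<Longrightarrow> \<eta> * (x t i b + 1 / lam i b) \<le> x t i b"
  using settled assms unfolding settled_def by auto

lemma v_settled:
  assumes "T \<le> t" "b < B" "i < k"
  shows "v t i b = gam t i b * (1 / (lam i b / x t i b + lam (ib b) b / x t (ib b) b))"
  using settledD(1)[OF assms(1,2)] by (simp add: v_def V_eq[OF assms(3,2)] gam_def)

lemma v_scale:
  assumes t: "T \<le> t" "T \<le> t'" and b: "b < B" and i: "i < k" "i \<noteq> ib b" and c: "0 < c"
    and xi: "c * x t i b \<le> x t' i b" and xb: "c * x t (ib b) b \<le> x t' (ib b) b"
  shows "\<eta> * c * v t i b \<le> v t' i b"
proof -
  let ?f = "\<lambda>t. 1 / (lam i b / x t i b + lam (ib b) b / x t (ib b) b)"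
  have f: "c * ?f t \<le> ?f t'"
    by (intro harmonic_scale lam_pos x_pos ib_less b i c xi xb)
  have f0: "0 < ?f t" by (intro divide_pos_pos add_pos_pos lam_pos x_pos ib_less b i) simp
  have "\<eta> * c * v t i b = (\<eta> * gam t i b) * (c * ?f t)"
    unfolding v_settled[OF t(1) b i(1)] by (simp only: mult_ac)
  also have "\<dots> \<le> gam t' i b * ?f t'"
    using settledD(5)[OF t(2) b i t(1)] settledD(4)[OF t(2) b i] f f0 c
    by (intro mult_mono) (auto simp: less_imp_le)
  also have "\<dots> = v t' i b" by (rule v_settled[OF t(2) b i(1), symmetric])
  finally show ?thesis .
qed

lemma v_pos:
  assumes "T \<le> t" "b < B" "i < k" "i \<noteq> ib b"
  shows "0 < v t i b"
proof -
  have "0 < lam i b / x t i b + lam (ib b) b / x t (ib b) b"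
    by (intro add_pos_pos divide_pos_pos lam_pos x_pos ib_less assms)
  then show ?thesis
    unfolding v_settled[OF assms(1-3)] using settledD(4)[OF assms] by simp
qed

lemma si_valid: "T \<le> t \<Longrightarrow> si t \<noteq> ib (sb t)"
  using si_neq[of t] settledD(1)[OF _ sb_less, of t t] by simp

lemma vmin_pos: "T \<le> t \<Longrightarrow> 0 < vmin t"
  unfolding vmin_def by (intro v_pos sb_less si_less si_valid)

lemma vmin_le:
  assumes t: "T \<le> t" and b: "b < B" and i: "i < k" "i \<noteq> ib b"
  shows "vmin t \<le> v t i b"
proof -
  have best: "\<forall>b<B. best t b = ib b" using settledD(1)[OF t] by blast
  show ?thesis
    using sel_min[of i b t] W_lim[OF best] t b i si_less sb_less si_valid[OF t] best
    by (simp add: vmin_def v_def)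
qed

text \<open>Counts only grow, so up to \<open>\<eta>\<close> the pair that is minimal at
  \<open>t'\<close> had no larger rate at \<open>t\<close>, where its rate bounds the minimum from
  above.\<close>

lemma vmin_mono:
  assumes "T \<le> t" "t \<le> t'"
  shows "\<eta> * vmin t \<le> vmin t'"
proof -
  have t': "T \<le> t'" using assms by simp
  have "\<eta> * vmin t \<le> \<eta> * v t (si t') (sb t')"
    using vmin_le[OF assms(1) sb_less si_less si_valid[OF t']] \<eta> by (intro mult_left_mono) auto
  also have "\<dots> \<le> vmin t'"
    using v_scale[OF assms(1) t' sb_less si_less si_valid[OF t'], of 1] assms(2)
    by (simp add: vmin_def x_mono si_less sb_less ib_less)
  finally show ?thesis .
qed

text \<open>After \<open>T\<close> a non-optimal solution is sampled only as the minimizer, so its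
  last replication before \<open>t\<close> marks a time when its rate was minimal. The optimum is at
  rest in that step; this lets the induction in \<open>growth\<close> restart at
  \<open>Suc s\<close> with the same \<open>x\<close>.\<close>

lemma last_step_selected:
  assumes "T \<le> t1" "t1 \<le> t" "b < B" "i < k" "i \<noteq> ib b" "N t1 i b < N t i b"
  obtains s where "t1 \<le> s" "s < t" "vmin s = v s i b" "N (Suc s) i b = N t i b"
    "\<eta> * x t i b \<le> x s i b" "x (Suc s) (ib b) b = x s (ib b) b"
proof -
  obtain s where s: "t1 \<le> s" "s < t" "sb s = b" "arm s b = i" "N (Suc s) i b = N t i b"
    using last_step[OF assms(2,6)] .
  have T: "T \<le> s" using assms s by simp
  have "si s = i" using s(4) assms(5) settledD(1)[OF T assms(3)] by (auto simp: arm_def split: if_splits)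
  then have "vmin s = v s i b" using s(3) by (simp add: vmin_def)
  moreover have "x t i b = x s i b + 1 / lam i b"
    using s(3-5) x_step[of s i b] by (simp add: x_def)
  then have "\<eta> * x t i b \<le> x s i b" using settledD(6)[OF T assms(3-5)] by simp
  moreover have "x (Suc s) (ib b) b = x s (ib b) b" using assms(5) s(4) by (simp add: x_step)
  ultimately show ?thesis using that s by blast
qed

text \<open>Relative growth of the replications spent on the conditional optimum never outpaces that of the
  minimal rate: the non-optimal solution \<open>j\<close> that grew most did so at least as much as the optimum,
  and the rate of \<open>j\<close> was the minimal one when \<open>j\<close> was last sampled. After that time \<open>j\<close> is
  at rest, so the number of moving solutions has dropped.\<close>

lemma growth:
  assumes b: "b < B" and t: "T \<le> t1" "t1 \<le> t"
    and n: "card {j \<in> {..<k} - {ib b}. N t1 j b \<noteq> N t j b} \<le> n"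
  shows "\<eta> ^ (3 + 5 * n) * vmin t1 * x t (ib b) b \<le> vmin t * x t1 (ib b) b"
  using t n
proof (induction n arbitrary: t1)
  case (0 t1)
  let ?x = "\<lambda>t. x t (ib b) b"
  have Tt: "T \<le> t" using 0 by simp
  have "{j \<in> {..<k} - {ib b}. N t1 j b \<noteq> N t j b} = {}" using 0(3) by simp
  then have "N t1 j b = N t j b" if "j \<in> {..<k} - {ib b}" for j using that by blast
  \<comment> \<open>With \<open>sig\<close> unchanged, the optimum, balanced against it at both
    ends, moves by a factor of at most \<open>1 / \<eta>\<^sup>2\<close>; \<open>vmin_mono\<close>
    costs the third \<open>\<eta>\<close> of the base exponent.\<close>
  then have sg: "sig t b = sig t1 b" unfolding sig_def x_def by simp
  have "\<eta>\<^sup>2 * ?x t \<le> \<eta> * sig t b"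
    using settledD(2)[OF Tt b] \<eta> by (simp add: power2_eq_square mult.assoc)
  also have "\<dots> \<le> ?x t1" unfolding sg by (rule settledD(3)[OF 0(1) b])
  finally have "\<eta> * vmin t1 * (\<eta>\<^sup>2 * ?x t) \<le> vmin t * ?x t1"
    using vmin_mono[OF 0(1,2)] vmin_pos[OF Tt] x_pos[OF ib_less[OF b] b, of t] \<eta>
    by (intro mult_mono) auto
  then show ?case by (simp add: power3_eq_cube power2_eq_square mult_ac)
next
  case (Suc n t1)
  let ?x = "\<lambda>t. x t (ib b) b" and ?J = "{..<k} - {ib b}"
  let ?mv = "\<lambda>t1. {j \<in> ?J. N t1 j b \<noteq> N t j b}"
  have Tt: "T \<le> t" using Suc by simp
  have xp: "0 < ?x t" for t by (rule x_pos[OF ib_less[OF b] b])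
  show ?case
  proof (cases "?mv t1 = {}")
    case True
    have "\<eta> ^ (3 + 5 * Suc n) * vmin t1 * ?x t \<le> \<eta> ^ (3 + 5 * n) * vmin t1 * ?x t"
      using \<eta> vmin_pos[OF Suc.prems(1)] xp[of t]
      by (intro mult_right_mono power_decreasing) auto
    also have "\<dots> \<le> vmin t * ?x t1" using Suc.prems by (intro Suc.IH) (simp_all only: True card.empty)
    finally show ?thesis .
  next
    case False
    \<comment> \<open>Growth factors over the time from \<open>t1\<close> to \<open>t\<close>.
      \<open>sig\<close>, being a norm, grows by at most the largest of them, and so does the
      optimum up to \<open>\<eta>\<^sup>2\<close>.\<close>
    define r where "r j = x t j b / x t1 j b" for j
    have fin: "finite ?J" and ne: "?J \<noteq> {}" using False by auto
    obtain j where j: "j \<in> ?J" "r j = Max (r ` ?J)"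
    proof -
      have "Max (r ` ?J) \<in> r ` ?J" using fin ne by (intro Max_in) simp_all
      then show ?thesis using that by (elim imageE) simp
    qed
    have max: "r j' \<le> r j" if "j' \<in> ?J" for j'
      unfolding j(2) using fin that by (intro Max_ge) auto
    have jj: "j < k" "j \<noteq> ib b" using j by auto
    obtain m where m: "m \<in> ?J" "N t1 m b \<noteq> N t m b" using False by blast
    then have "N t1 m b < N t m b" using N_mono[OF Suc.prems(2)] by (simp add: le_neq_implies_less)
    then have "1 < r m" using x_pos[of m b t1] lam_pos[of m b] m(1) b N_pos[of t1 m b]
      by (simp add: r_def x_def)
    then have r1: "1 < r j" using max[OF m(1)] by simp
    then have Nj: "N t1 j b < N t j b"
      using x_pos[OF jj(1) b, of t1] lam_pos[OF jj(1) b] N_pos[of t1 j b]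
      by (simp add: r_def x_def)
    have "sig t b \<le> sqrt ((r j)\<^sup>2 * (\<Sum>j'\<in>?J. (x t1 j' b)\<^sup>2))"
      unfolding sig_def sum_distrib_left power_mult_distrib[symmetric]
    proof (intro real_sqrt_le_mono sum_mono power_mono)
      fix j' assume j': "j' \<in> ?J"
      then show "x t j' b \<le> r j * x t1 j' b"
        using max[OF j'] x_pos[of j' b t1] b by (simp add: r_def divide_le_eq)
      show "0 \<le> x t j' b" using x_pos[of j' b t] j' b by simp
    qed
    also have "\<dots> = r j * sig t1 b" using r1 by (simp add: real_sqrt_mult sig_def)
    finally have sr: "sig t b \<le> r j * sig t1 b" .
    have "\<eta>\<^sup>2 * ?x t \<le> \<eta> * sig t b"
      using settledD(2)[OF Tt b] \<eta> by (simp add: power2_eq_square mult.assoc)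
    also have "\<dots> \<le> r j * (\<eta> * sig t1 b)" using sr \<eta> by (simp add: mult_left_mono mult.left_commute)
    also have "\<dots> \<le> r j * ?x t1"
      using settledD(3)[OF Suc.prems(1) b] r1 by (intro mult_left_mono) auto
    finally have rx: "\<eta>\<^sup>2 * ?x t \<le> r j * ?x t1" .
    obtain s where s: "t1 \<le> s" "s < t" "vmin s = v s j b" "N (Suc s) j b = N t j b"
        "\<eta> * x t j b \<le> x s j b" "?x (Suc s) = ?x s"
      using last_step_selected[OF Suc.prems(1,2) b jj Nj] .
    \<comment> \<open>\<open>\<rho>\<close> is the growth of the optimum up to the last replication
      of \<open>j\<close>. By then both \<open>j\<close> and the optimum have grown by at least
      \<open>\<eta> ^ 3 * \<rho>\<close>, so the rate of \<open>j\<close>, minimal at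
      \<open>s\<close>, lies above the old minimum by a factor of nearly
      \<open>\<rho>\<close>.\<close>
    define \<rho> where "\<rho> = ?x s / ?x t1"
    have \<rho>: "0 < \<rho>" "\<rho> * ?x t1 = ?x s" using xp[of s] xp[of t1] by (auto simp: \<rho>_def)
    have xst: "?x s \<le> ?x t" using s(2) by (intro x_mono ib_less b) auto
    have "\<eta>\<^sup>2 * (\<rho> * ?x t1) \<le> r j * ?x t1"
      using rx mult_left_mono[OF xst, of "\<eta>\<^sup>2"] unfolding \<rho>(2) by simp
    then have "\<eta>\<^sup>2 * \<rho> \<le> r j" using xp[of t1] by (simp add: mult.assoc[symmetric])
    then have "\<eta> * (\<eta>\<^sup>2 * \<rho>) * x t1 j b \<le> \<eta> * r j * x t1 j b"
      using \<eta> x_pos[OF jj(1) b, of t1] by (intro mult_right_mono mult_left_mono) auto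
    also have "\<dots> = \<eta> * x t j b" using x_pos[OF jj(1) b, of t1] by (simp add: r_def)
    also have "\<dots> \<le> x s j b" by (rule s(5))
    finally have c1: "\<eta> ^ 3 * \<rho> * x t1 j b \<le> x s j b"
      by (simp add: power3_eq_cube power2_eq_square mult_ac)
    have c2: "\<eta> ^ 3 * \<rho> * ?x t1 \<le> ?x s"
      using \<eta> xp[of s] \<rho>(2) by (simp add: mult.assoc mult_left_le_one_le power_le_one)
    have Ts: "T \<le> s" "T \<le> Suc s" using s(1) Suc.prems by auto
    have "\<eta> ^ 4 * \<rho> * vmin t1 \<le> \<eta> ^ 4 * \<rho> * v t1 j b"
      using \<eta> \<rho> vmin_le[OF Suc.prems(1) b jj] by (intro mult_left_mono) auto
    also have "\<dots> = \<eta> * (\<eta> ^ 3 * \<rho>) * v t1 j b" by (simp add: eval_nat_numeral)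
    also have "\<dots> \<le> vmin s" unfolding s(3)
      using \<eta> \<rho> c1 c2 by (intro v_scale Suc.prems Ts b jj) auto
    finally have "\<eta> * (\<eta> ^ 4 * \<rho> * vmin t1) \<le> \<eta> * vmin s" using \<eta> by simp
    also have "\<dots> \<le> vmin (Suc s)" by (intro vmin_mono Ts) simp
    \<comment> \<open>Of the five factors \<open>\<eta>\<close>, three come from \<open>c1\<close>,
      one from \<open>v_scale\<close> and one from passing to \<open>Suc s\<close>.\<close>
    finally have ms: "\<eta> ^ 5 * \<rho> * vmin t1 \<le> vmin (Suc s)" by (simp add: eval_nat_numeral)
    have "N t1 j' b = N t j' b \<Longrightarrow> N (Suc s) j' b = N t j' b" for j'
      using N_mono[of t1 "Suc s" j' b] N_mono[of "Suc s" t j' b] s(1,2) by simp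
    then have "?mv (Suc s) \<subseteq> ?mv t1 - {j}" using s(4) by auto
    then have "card (?mv (Suc s)) \<le> card (?mv t1 - {j})" by (intro card_mono) auto
    also have "\<dots> \<le> n" using Suc.prems(3) jj Nj by (subst card_Diff_singleton) auto
    finally have IH: "\<eta> ^ (3 + 5 * n) * vmin (Suc s) * ?x t \<le> vmin t * ?x s"
      using Suc.IH[of "Suc s"] Ts s(2,6) by simp
    have "\<eta> ^ (3 + 5 * n) * (\<eta> ^ 5 * \<rho> * vmin t1) * ?x t \<le> \<eta> ^ (3 + 5 * n) * vmin (Suc s) * ?x t"
      using ms \<eta> xp[of t] by (intro mult_right_mono mult_left_mono) auto
    also have "\<dots> \<le> vmin t * (\<rho> * ?x t1)" using IH \<rho> by simp
    finally have "\<rho> * (\<eta> ^ (3 + 5 * Suc n) * vmin t1 * ?x t) \<le> \<rho> * (vmin t * ?x t1)"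
      by (simp add: power_add mult_ac)
    then show ?thesis using \<rho>(1) by simp
  qed
qed

text \<open>When \<open>i\<close> was last sampled its rate was minimal. Apart from that replication
  and the variation of \<open>gam\<close>, the rate has risen since only through the optimum, and by
  \<open>growth\<close> the minimal rate has risen by nearly the same factor.\<close>

lemma v_le_vmin:
  assumes b: "b < B" and i: "i < k" "i \<noteq> ib b"
  shows "\<forall>\<^sub>F t in sequentially. \<eta> ^ (5 + 5 * k) * v t i b \<le> vmin t"
proof -
  let ?x = "\<lambda>t. x t (ib b) b"
  have xp: "0 < ?x t" for t by (rule x_pos[OF ib_less[OF b] b])
  have "\<forall>\<^sub>F t in sequentially. N T i b < N t i b"
    using N_top[OF i(1) b] unfolding filterlim_at_top
    by (auto dest: spec[of _ "Suc (N T i b)"] simp: Suc_le_eq)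
  with eventually_ge_at_top[of T] show ?thesis
  proof eventually_elim
    case (elim t)
    obtain s where s: "T \<le> s" "s < t" "vmin s = v s i b" "\<eta> * x t i b \<le> x s i b"
      using last_step_selected[OF order_refl elim(1) b i elim(2)] by blast
    \<comment> \<open>\<open>c\<close> undoes the growth of the optimum since \<open>s\<close>; its
      \<open>\<eta>\<close> covers the last replication of \<open>i\<close>. Together with one
      \<open>\<eta>\<close> from \<open>v_scale\<close> and \<open>3 + 5 * k\<close> from
      \<open>growth\<close> this is the exponent \<open>5 + 5 * k\<close>.\<close>
    define c where "c = \<eta> * ?x s / ?x t"
    have st: "?x s \<le> ?x t" using s(2) by (intro x_mono ib_less b) auto
    have c0: "0 < c" using xp[of s] xp[of t] \<eta> by (simp add: c_def)
    have "c = \<eta> * (?x s / ?x t)" by (simp add: c_def)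
    also have "\<dots> \<le> \<eta>" using st xp[of t] \<eta> by (intro mult_left_le) auto
    finally have "c * x t i b \<le> \<eta> * x t i b" using x_pos[OF i(1) b, of t] by (intro mult_right_mono) auto
    then have c1: "c * x t i b \<le> x s i b" using s(4) by simp
    have ct: "c * ?x t = \<eta> * ?x s" using xp[of t] by (simp add: c_def)
    then have c2: "c * ?x t \<le> ?x s" using \<eta> xp[of s] by simp
    have vs: "\<eta> * c * v t i b \<le> vmin s"
      unfolding s(3) by (rule v_scale[OF elim(1) s(1) b i c0 c1 c2])
    have "card {j \<in> {..<k} - {ib b}. N s j b \<noteq> N t j b} \<le> card {..<k}" by (intro card_mono) auto
    then have g: "\<eta> ^ (3 + 5 * k) * vmin s * ?x t \<le> vmin t * ?x s"
      using s by (intro growth b) auto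
    have "\<eta> ^ (3 + 5 * k) * (\<eta> * c * v t i b) * ?x t \<le> \<eta> ^ (3 + 5 * k) * vmin s * ?x t"
      using vs \<eta> xp[of t] by (intro mult_right_mono mult_left_mono) auto
    also note g
    finally have "\<eta> ^ (3 + 5 * k) * \<eta> * v t i b * (c * ?x t) \<le> vmin t * ?x s"
      by (simp add: mult_ac)
    then have "(\<eta> ^ (5 + 5 * k) * v t i b) * ?x s \<le> vmin t * ?x s"
      unfolding ct by (simp add: power_add eval_nat_numeral mult_ac)
    then show ?case using xp[of s] by simp
  qed
qed

end

lemma v_vmin_lim:
  assumes b: "b < B" and i: "i < k" "i \<noteq> ib b"
  shows "(\<lambda>t. v t i b / vmin t) \<longlonglongrightarrow> 1"
proof (rule order_tendstoI)
  fix a :: real assume a: "a < 1"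
  obtain T where T: "settled (1 / 2) T" using settled_exists[of "1 / 2"] by auto
  show "\<forall>\<^sub>F t in sequentially. a < v t i b / vmin t"
    using eventually_ge_at_top[of T]
  proof eventually_elim
    case (elim t)
    have "1 \<le> v t i b / vmin t"
      using vmin_le[OF _ _ T elim b i] vmin_pos[OF _ _ T elim] by simp
    then show ?case using a by simp
  qed
next
  fix a :: real assume a: "1 < a"
  \<comment> \<open>The loss is a fixed power of \<open>\<eta>\<close>, so it drops below any
    \<open>a > 1\<close> for \<open>\<eta>\<close> close enough to 1.\<close>
  have "((\<lambda>e::real. 1 / e ^ (5 + 5 * k)) \<longlongrightarrow> 1 / 1 ^ (5 + 5 * k)) (at_left 1)"
    by (intro tendsto_intros) auto
  then have "\<forall>\<^sub>F e in at_left 1. 1 / e ^ (5 + 5 * k) < a" using a by (intro order_tendstoD) auto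
  moreover have "\<forall>\<^sub>F e::real in at_left 1. e \<in> {0<..<1}" by (rule eventually_at_left_real) simp
  ultimately have "\<forall>\<^sub>F e::real in at_left 1. 1 / e ^ (5 + 5 * k) < a \<and> e \<in> {0<..<1}"
    by eventually_elim blast
  then obtain \<eta> :: real where e: "1 / \<eta> ^ (5 + 5 * k) < a" "0 < \<eta>" "\<eta> < 1"
    using eventually_happens' trivial_limit_at_left_real by (metis (no_types, lifting) greaterThanLessThan_iff)
  obtain T where T: "settled \<eta> T" using settled_exists[OF e(2,3)] by auto
  show "\<forall>\<^sub>F t in sequentially. v t i b / vmin t < a"
    using eventually_ge_at_top[of T] v_le_vmin[OF e(2,3) T b i]
  proof eventually_elim
    case (elim t)
    have "v t i b / vmin t \<le> 1 / \<eta> ^ (5 + 5 * k)"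
      using elim(2) vmin_pos[OF e(2,3) T elim(1)] e(2) by (simp add: field_simps)
    then show ?case using e(1) by simp
  qed
qed

section \<open>The limit statements along one path\<close>

lemma weighted_rate_ratio:
  assumes q: "b < B" "i < k" "i \<noteq> ib b" and q': "c < B" "j < k" "j \<noteq> ib c"
  shows "(\<lambda>t. (Ws i b * V t i b) / (Ws j c * V t j c)) \<longlonglongrightarrow> 1"
proof -
  obtain T where T: "settled (1 / 2) T" using settled_exists[of "1 / 2"] by auto
  have "(\<lambda>t. (v t i b / vmin t) / (v t j c / vmin t)) \<longlonglongrightarrow> 1 / 1"
    by (intro tendsto_divide v_vmin_lim q q') simp
  moreover have "\<forall>\<^sub>F t in sequentially. (v t i b / vmin t) / (v t j c / vmin t)
      = (Ws i b * V t i b) / (Ws j c * V t j c)"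
    using eventually_ge_at_top[of T]
  proof eventually_elim
    case (elim t)
    then show ?case using vmin_pos[OF _ _ T elim] by (simp add: v_def)
  qed
  ultimately show ?thesis by (simp add: tendsto_cong)
qed

text \<open>The imbalance is at most linear in the number of replications and is divided by its
  square.\<close>

lemma optimum_balance:
  assumes b: "b < B"
  shows "(\<lambda>t. (x t (ib b) b / real (n0 * k * B + t))\<^sup>2
     - (\<Sum>j\<in>{..<k} - {ib b}. (x t j b / real (n0 * k * B + t))\<^sup>2)) \<longlonglongrightarrow> 0"
proof -
  let ?n = "\<lambda>t. real (n0 * k * B + t)"
  obtain C0 C where C: "\<And>t. \<bar>(x t (ib b) b)\<^sup>2 - (sig t b)\<^sup>2\<bar> \<le> C0 + C * (\<Sum>i<k. x t i b)"
    using imbalance_bound[OF b] by blast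
  define L where "L = (\<Sum>i<k. 1 / lam i b)"
  have X: "(\<Sum>i<k. x t i b) \<le> L * ?n t" for t
    unfolding L_def sum_distrib_right
  proof (intro sum_mono)
    fix i assume "i \<in> {..<k}"
    then have i: "i < k" by simp
    have "N t i b \<le> (\<Sum>b<B. N t i b)" using b by (intro member_le_sum) auto
    also have "\<dots> \<le> (\<Sum>i<k. \<Sum>b<B. N t i b)" using i by (intro member_le_sum[of _ _ "\<lambda>i. \<Sum>b<B. N t i b"]) auto
    also have "\<dots> = n0 * k * B + t" by (rule N_total)
    finally have "real (N t i b) \<le> ?n t" using of_nat_mono by blast
    then show "x t i b \<le> 1 / lam i b * ?n t"
      using lam_pos[OF i b] by (simp add: x_def divide_right_mono)
  qed
  have X0: "0 \<le> (\<Sum>i<k. x t i b)" for t using x_pos[OF _ b] by (intro sum_nonneg) (auto simp: less_imp_le)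
  show ?thesis
  proof (rule Lim_null_comparison)
    show "\<forall>\<^sub>F t in sequentially. norm ((x t (ib b) b / ?n t)\<^sup>2 - (\<Sum>j\<in>{..<k} - {ib b}. (x t j b / ?n t)\<^sup>2))
        \<le> (\<bar>C0\<bar> + \<bar>C\<bar> * (L * ?n t)) / (?n t)\<^sup>2"
    proof (intro always_eventually allI)
      fix t
      have "(x t (ib b) b / ?n t)\<^sup>2 - (\<Sum>j\<in>{..<k} - {ib b}. (x t j b / ?n t)\<^sup>2)
          = ((x t (ib b) b)\<^sup>2 - (sig t b)\<^sup>2) / (?n t)\<^sup>2"
        by (simp add: sig_sq power_divide diff_divide_distrib sum_divide_distrib)
      moreover have "C0 + C * (\<Sum>i<k. x t i b) \<le> \<bar>C0\<bar> + \<bar>C\<bar> * (L * ?n t)"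
        using X[of t] X0[of t] by (intro add_mono order_trans[OF mult_right_mono mult_left_mono]) auto
      ultimately show "norm ((x t (ib b) b / ?n t)\<^sup>2 - (\<Sum>j\<in>{..<k} - {ib b}. (x t j b / ?n t)\<^sup>2))
          \<le> (\<bar>C0\<bar> + \<bar>C\<bar> * (L * ?n t)) / (?n t)\<^sup>2"
        using C[of t] by (simp add: abs_divide divide_right_mono)
    qed
    have nt: "filterlim ?n at_top sequentially"
      by (rule filterlim_compose[OF filterlim_real_sequentially])
        (auto simp: filterlim_at_top eventually_sequentially intro: trans_le_add2)
    have "((\<lambda>z. (\<bar>C0\<bar> + \<bar>C\<bar> * (L * z)) / z\<^sup>2) \<longlongrightarrow> 0) at_top" by real_asymp
    then show "(\<lambda>t. (\<bar>C0\<bar> + \<bar>C\<bar> * (L * ?n t)) / (?n t)\<^sup>2) \<longlonglongrightarrow> 0"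
      by (rule filterlim_compose[OF _ nt])
  qed
qed

text \<open>\<open>vmin\<close> is a yardstick common to all parameter values. The rate of a
  non-optimal \<open>j\<close> is eventually within a factor 2 of it, and is itself of the order of
  \<open>x t j b\<close>, because \<open>x t j b\<close> is at most twice the \<open>x\<close> of
  the optimum. The optimum follows by its balance with \<open>sig\<close>.\<close>

lemma x_vmin_comparable:
  assumes b: "b < B" and i: "i < k"
  shows "\<exists>c1>0. \<exists>c2. \<forall>\<^sub>F t in sequentially. 0 < vmin t \<and> c1 * vmin t \<le> x t i b \<and> x t i b \<le> c2 * vmin t"
proof -
  obtain T where T: "settled (1 / 2) T" using settled_exists[of "1 / 2"] by auto
  have h: "0 < (1 / 2 :: real)" "(1 / 2 :: real) < 1" by auto
  note S = settledD[OF h T]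
  let ?x = "\<lambda>t. x t (ib b) b"
  have nonopt: "\<exists>c1>0. \<exists>c2>0. \<forall>\<^sub>F t in sequentially. c1 * vmin t \<le> x t j b \<and> x t j b \<le> c2 * vmin t"
    if j: "j < k" "j \<noteq> ib b" for j
  proof -
    define g where "g = gam T j b"
    have g0: "0 < g" unfolding g_def by (rule S(4)[OF order_refl b j])
    \<comment> \<open>The 2 reflects \<open>x2\<close> below: \<open>lam (ib b) b / ?x t\<close> is
      at most \<open>2 * lam (ib b) b / x t j b\<close>.\<close>
    define p where "p = lam j b + 2 * lam (ib b) b"
    have lp: "0 < lam j b" "0 < p" using lam_pos[OF j(1) b] lam_pos[OF ib_less[OF b] b] by (auto simp: p_def)
    have "\<forall>\<^sub>F t in sequentially. v t j b / vmin t < 2"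
      using order_tendstoD(2)[OF v_vmin_lim[OF b j]] by auto
    with eventually_ge_at_top[of T]
    have "\<forall>\<^sub>F t in sequentially. lam j b / (2 * g) * vmin t \<le> x t j b \<and> x t j b \<le> 4 * p / g * vmin t"
    proof eventually_elim
      case (elim t)
      have m0: "0 < vmin t" by (rule vmin_pos[OF h T elim(1)])
      have v2: "v t j b < 2 * vmin t" using elim(2) m0 by (simp add: divide_less_eq)
      have mv: "vmin t \<le> v t j b" by (rule vmin_le[OF h T elim(1) b j])
      have xj: "0 < x t j b" by (rule x_pos[OF j(1) b])
      have xb: "0 < ?x t" by (rule x_pos[OF ib_less[OF b] b])
      have "x t j b \<le> sig t b" by (rule x_le_sig[OF b j])
      then have x2: "x t j b \<le> 2 * ?x t" using S(3)[OF elim(1) b] by simp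
      let ?d = "lam j b / x t j b + lam (ib b) b / ?x t"
      have "lam (ib b) b / ?x t \<le> lam (ib b) b / (x t j b / 2)"
        using x2 xj xb lam_pos[OF ib_less[OF b] b] by (intro divide_left_mono) auto
      then have d1: "?d \<le> p / x t j b" by (simp add: p_def add_divide_distrib mult.commute)
      have d2: "lam j b / x t j b \<le> ?d" using xb lam_pos[OF ib_less[OF b] b] by simp
      have d0: "0 < lam j b / x t j b" using xj lp by simp
      have ga: "gam t j b \<le> 2 * g" "g \<le> 2 * gam t j b" "0 < gam t j b"
        using S(5)[OF order_refl b j elim(1)] S(5)[OF elim(1) b j order_refl] S(4)[OF elim(1) b j]
        by (auto simp: g_def)
      have v: "v t j b = gam t j b / ?d" using v_settled[OF h T elim(1) b j(1)] by simp
      have "vmin t \<le> 2 * g / (lam j b / x t j b)"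
        using mv unfolding v using ga d2 d0 g0 by (elim order_trans) (intro frac_le, auto)
      then have 1: "lam j b / (2 * g) * vmin t \<le> x t j b"
        using g0 lp xj by (simp add: field_simps)
      have "g / 2 / (p / x t j b) \<le> gam t j b / ?d"
        using ga d1 d2 d0 g0 by (intro frac_le) auto
      then have "g / 2 / (p / x t j b) \<le> 2 * vmin t" using v v2 by simp
      then have "x t j b \<le> 4 * p / g * vmin t" using g0 lp xj by (simp add: field_simps)
      with 1 show ?case by simp
    qed
    moreover have "0 < lam j b / (2 * g)" "0 < 4 * p / g" using lp g0 by auto
    ultimately show ?thesis by blast
  qed
  have vp: "\<forall>\<^sub>F t in sequentially. 0 < vmin t"
    using eventually_ge_at_top[of T] by eventually_elim (rule vmin_pos[OF h T])
  show ?thesis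
  proof (cases "i = ib b")
    case False
    then obtain c1 c2 where "0 < c1" "\<forall>\<^sub>F t in sequentially. c1 * vmin t \<le> x t i b \<and> x t i b \<le> c2 * vmin t"
      using nonopt[OF i] by blast
    then show ?thesis using eventually_conj[OF vp] by blast
  next
    case True
    let ?J = "{..<k} - {ib b}"
    have "\<forall>j\<in>?J. \<exists>c. 0 < fst c \<and>
        (\<forall>\<^sub>F t in sequentially. fst c * vmin t \<le> x t j b \<and> x t j b \<le> snd c * vmin t)"
    proof
      fix j assume "j \<in> ?J"
      then obtain c1 c2 where "0 < c1"
        "\<forall>\<^sub>F t in sequentially. c1 * vmin t \<le> x t j b \<and> x t j b \<le> c2 * vmin t"
        using nonopt[of j] by blast
      then show "\<exists>c. 0 < fst c \<and>
          (\<forall>\<^sub>F t in sequentially. fst c * vmin t \<le> x t j b \<and> x t j b \<le> snd c * vmin t)"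
        by (intro exI[of _ "(c1, c2)"]) simp
    qed
    from bchoice[OF this] obtain C where C: "\<forall>j\<in>?J. 0 < fst (C j) \<and>
        (\<forall>\<^sub>F t in sequentially. fst (C j) * vmin t \<le> x t j b \<and> x t j b \<le> snd (C j) * vmin t)"
      by blast
    define c1 c2 where "c1 j = fst (C j)" and "c2 j = snd (C j)" for j
    have c: "0 < c1 j" "\<forall>\<^sub>F t in sequentially. c1 j * vmin t \<le> x t j b \<and> x t j b \<le> c2 j * vmin t"
      if "j \<in> ?J" for j
      using C that by (auto simp: c1_def c2_def)
    have ev: "\<forall>\<^sub>F t in sequentially. \<forall>j\<in>?J. c1 j * vmin t \<le> x t j b \<and> x t j b \<le> c2 j * vmin t"
      using c(2) by (intro eventually_ball_finite) auto
    obtain j where j: "j \<in> ?J"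
      using k2 by (cases "ib b = 0") (auto intro: that[of 0] that[of 1])
    have "\<forall>\<^sub>F t in sequentially. 0 < vmin t \<and> c1 j / 2 * vmin t \<le> ?x t \<and> ?x t \<le> 2 * sum c2 ?J * vmin t"
      using ev vp eventually_ge_at_top[of T]
    proof eventually_elim
      case (elim t)
      have xJ: "0 \<le> x t j b" if "j \<in> ?J" for j using x_pos[of j b t] that b by auto
      have "x t j b \<le> sig t b" using j by (intro x_le_sig b) auto
      then have "c1 j / 2 * vmin t \<le> ?x t" using S(3)[OF elim(3) b] elim(1) j by force
      moreover have "sig t b \<le> (\<Sum>j\<in>?J. x t j b)"
        using L2_set_le_sum[of ?J "\<lambda>j. x t j b"] xJ by (simp add: sig_def L2_set_def)
      then have "?x t \<le> 2 * (\<Sum>j\<in>?J. x t j b)" using S(2)[OF elim(3) b] by simp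
      moreover have "(\<Sum>j\<in>?J. x t j b) \<le> sum c2 ?J * vmin t"
        unfolding sum_distrib_right using elim(1) by (intro sum_mono) auto
      ultimately show ?case using elim(2) by simp
    qed
    moreover have "0 < c1 j / 2" using c(1)[OF j] by simp
    ultimately show ?thesis unfolding True by blast
  qed
qed

lemma count_ratio_bounded:
  assumes "b < B" "i < k" "b' < B" "j < k"
  shows "\<exists>C. \<forall>\<^sub>F t in sequentially. real (N t i b) / real (N t j b') \<le> C"
proof -
  obtain c c2 where ev1: "\<forall>\<^sub>F t in sequentially. 0 < vmin t \<and> c * vmin t \<le> x t i b \<and> x t i b \<le> c2 * vmin t"
    using x_vmin_comparable[OF assms(1,2)] by blast
  obtain c1 c' where "0 < c1"
    and ev2: "\<forall>\<^sub>F t in sequentially. 0 < vmin t \<and> c1 * vmin t \<le> x t j b' \<and> x t j b' \<le> c' * vmin t"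
    using x_vmin_comparable[OF assms(3,4)] by blast
  from ev1 ev2 have "\<forall>\<^sub>F t in sequentially. real (N t i b) / real (N t j b') \<le> c2 / c1 * (lam i b / lam j b')"
  proof eventually_elim
    fix t assume elim: "0 < vmin t \<and> c * vmin t \<le> x t i b \<and> x t i b \<le> c2 * vmin t"
      "0 < vmin t \<and> c1 * vmin t \<le> x t j b' \<and> x t j b' \<le> c' * vmin t"
    have l: "0 < lam i b" "0 < lam j b'" using lam_pos assms by auto
    have "real (N t i b) / real (N t j b') = x t i b / x t j b' * (lam i b / lam j b')"
      using l by (simp add: x_def)
    also have "\<dots> \<le> (c2 * vmin t) / (c1 * vmin t) * (lam i b / lam j b')"
      using elim l \<open>0 < c1\<close> x_pos[OF assms(2,1), of t] by (intro mult_right_mono frac_le) auto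
    finally show "real (N t i b) / real (N t j b') \<le> c2 / c1 * (lam i b / lam j b')"
      using elim by simp
  qed
  then show ?thesis by blast
qed

end

section \<open>Fluctuations of normal samples\<close>

context prob_space
begin

section \<open>Tails, strong law and maximal inequality for normal sums\<close>

lemma indep_vars_reindex_inj:
  assumes "indep_vars M' X I" "inj_on f J" "f ` J \<subseteq> I"
  shows "indep_vars (\<lambda>j. M' (f j)) (\<lambda>j. X (f j)) J"
proof -
  have "indep_vars (\<lambda>j. PiM {f j} M') (\<lambda>j \<omega>. restrict (\<lambda>i. X i \<omega>) {f j}) J"
    using assms by (intro indep_vars_restrict) (auto simp: disjoint_family_on_def inj_on_def)
  from indep_vars_compose2[OF this, of "\<lambda>j g. g (f j)" "\<lambda>j. M' (f j)"]
  show ?thesis by simp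
qed

lemma std_normal_sum:
  assumes "indep_vars (\<lambda>_. borel) Z I" "finite J" "J \<noteq> {}" "J \<subseteq> I"
    and "\<And>i. i \<in> J \<Longrightarrow> distributed M lborel (Z i) std_normal_density"
  shows "distributed M lborel (\<lambda>w. (\<Sum>i\<in>J. Z i w) / sqrt (card J)) std_normal_density"
proof -
  have c: "0 < sqrt (card J)" using assms(2,3) by (simp add: card_gt_0_iff)
  have "distributed M lborel (\<lambda>w. \<Sum>i\<in>J. Z i w) (normal_density (\<Sum>i\<in>J. 0) (sqrt (\<Sum>i\<in>J. 1\<^sup>2)))"
    using assms by (intro sum_indep_normal indep_vars_subset[OF assms(1,4)]) auto
  then show ?thesis using normal_standard_normal_convert[OF c, of "\<lambda>w. \<Sum>i\<in>J. Z i w" 0] by simp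
qed

text \<open>Markov's inequality for the fourth moment, which is 3. The fourth power makes the tails
  in the strong law summable.\<close>

lemma std_normal_tail:
  assumes D: "distributed M lborel Y std_normal_density" and a: "0 < a"
  shows "prob {w \<in> space M. a \<le> \<bar>Y w\<bar>} \<le> 3 / a ^ 4"
proof -
  have "integrable lborel (\<lambda>z. std_normal_density z * z ^ 4)" by (rule integrable_std_normal_moment)
  then have int: "integrable M (\<lambda>w. (Y w) ^ 4)"
    using distributed_integrable[OF D, of "\<lambda>z. z ^ 4"] by simp
  have "(\<integral>w. (Y w) ^ 4 \<partial>M) = (\<integral>z. std_normal_density z * z ^ 4 \<partial>lborel)"
    using distributed_integral[OF D, of "\<lambda>z. z ^ 4"] by simp
  also have "\<dots> = 3" using integral_std_normal_moment_even[of 2] by (simp add: fact_numeral)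
  finally have e: "(\<integral>w. (Y w) ^ 4 \<partial>M) = 3" .
  have "{w \<in> space M. a \<le> \<bar>Y w\<bar>} = {w \<in> space M. a ^ 4 \<le> (Y w) ^ 4}"
  proof (intro Collect_cong conj_cong refl)
    fix w
    have "a \<le> \<bar>Y w\<bar> \<longleftrightarrow> a ^ 4 \<le> \<bar>Y w\<bar> ^ 4"
      using a by (intro power_mono_iff[symmetric]) auto
    then show "a \<le> \<bar>Y w\<bar> \<longleftrightarrow> a ^ 4 \<le> (Y w) ^ 4" by (simp add: power_even_abs)
  qed
  also have "prob \<dots> \<le> (\<integral>w. (Y w) ^ 4 \<partial>M) / a ^ 4"
    using a by (intro integral_Markov_inequality_measure[OF int, of "{}"]) auto
  finally show ?thesis by (simp add: e)
qed

text \<open>\<open>n\<close> may exceed \<open>card J\<close>, so that one threshold serves all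
  remaining increments in the maximal inequality, the empty one included.\<close>

lemma std_normal_sum_tail:
  fixes n :: nat
  assumes "indep_vars (\<lambda>_. borel) Z I" "finite J" "J \<subseteq> I"
    and "\<And>i. i \<in> J \<Longrightarrow> distributed M lborel (Z i) std_normal_density"
    and n: "card J \<le> n" and c: "0 < c" "0 < n"
  shows "prob {w \<in> space M. c * sqrt n \<le> \<bar>\<Sum>i\<in>J. Z i w\<bar>} \<le> 3 / c ^ 4"
proof (cases "J = {}")
  case True
  have "\<not> c * sqrt n \<le> 0" using c by (simp add: not_le)
  then show ?thesis using True c by simp
next
  case False
  let ?Y = "\<lambda>w. (\<Sum>i\<in>J. Z i w) / sqrt (card J)"
  have D: "distributed M lborel ?Y std_normal_density"
    using assms False by (intro std_normal_sum) auto
  have c0: "0 < sqrt (card J)" using assms(2) False by (simp add: card_gt_0_iff)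
  have [measurable]: "random_variable borel ?Y"
    using distributed_measurable[OF D] by simp
  have "prob {w \<in> space M. c * sqrt n \<le> \<bar>\<Sum>i\<in>J. Z i w\<bar>} \<le> prob {w \<in> space M. c \<le> \<bar>?Y w\<bar>}"
  proof (intro finite_measure_mono subsetI)
    fix w assume w: "w \<in> {w \<in> space M. c * sqrt n \<le> \<bar>\<Sum>i\<in>J. Z i w\<bar>}"
    have "c * sqrt (card J) \<le> c * sqrt n" using n c by simp
    then have "c * sqrt (card J) \<le> \<bar>\<Sum>i\<in>J. Z i w\<bar>" using w by simp
    then show "w \<in> {w \<in> space M. c \<le> \<bar>?Y w\<bar>}"
      using w c0 by (simp add: abs_divide pos_le_divide_eq)
  qed measurable
  also have "\<dots> \<le> 3 / c ^ 4" by (rule std_normal_tail[OF D c(1)])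
  finally show ?thesis .
qed

text \<open>Exceeding \<open>e * n\<close> means exceeding \<open>e * sqrt n\<close> standard
  deviations; the tail bound is then of order \<open>1 / n\<^sup>2\<close>, and Borel-Cantelli
  applies.\<close>

lemma std_normal_strong_law:
  fixes Z :: "nat \<Rightarrow> 'a \<Rightarrow> real"
  assumes ind: "indep_vars (\<lambda>_. borel) Z UNIV"
    and D: "\<And>m. distributed M lborel (Z m) std_normal_density"
  shows "AE w in M. (\<lambda>n. (\<Sum>m<n. Z m w) / real n) \<longlonglongrightarrow> 0"
proof -
  have [measurable]: "random_variable borel (Z m)" for m
    using distributed_measurable[OF D] by simp
  have ev: "AE w in M. \<forall>\<^sub>F n in sequentially. \<bar>\<Sum>m<n. Z m w\<bar> < e * real n" if e: "0 < e" for e :: real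
  proof -
    define A where "A n = {w \<in> space M. e * real n \<le> \<bar>\<Sum>m<n. Z m w\<bar>}" for n
    have [measurable]: "A n \<in> sets M" for n unfolding A_def by measurable
    have bound: "norm (measure M (A n)) \<le> 3 / e ^ 4 * (1 / real n ^ 2)" if n: "1 \<le> n" for n
    proof -
      have "A n = {w \<in> space M. (e * sqrt n) * sqrt n \<le> \<bar>\<Sum>m<n. Z m w\<bar>}"
        by (simp add: A_def mult.assoc)
      then have "measure M (A n) \<le> 3 / (e * sqrt n) ^ 4"
        using std_normal_sum_tail[OF ind, of "{..<n}" n "e * sqrt n"] D e n by simp
      also have "(e * sqrt n) ^ 4 = e ^ 4 * real n ^ 2"
        by (simp add: power_mult_distrib flip: power_mult[of "sqrt n" 2 2, simplified])
      finally show ?thesis by simp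
    qed
    have "summable (\<lambda>n. 3 / e ^ 4 * (1 / real n ^ 2))"
      by (intro summable_mult inverse_power_summable[of 2, simplified inverse_eq_divide power_one_over])
        (auto simp: inverse_eq_divide)
    then have "summable (\<lambda>n. measure M (A n))"
      by (rule summable_comparison_test'[where N=1]) (rule bound)
    then have "AE w in M. \<forall>\<^sub>F n in sequentially. w \<in> space M - A n"
      by (intro borel_cantelli_AE1) (auto simp: emeasure_eq_measure)
    then show ?thesis by (rule AE_mp) (auto simp: A_def not_le elim!: eventually_mono)
  qed
  have "AE w in M. \<forall>j::nat. \<forall>\<^sub>F n in sequentially. \<bar>\<Sum>m<n. Z m w\<bar> < 1 / real (Suc j) * real n"
    unfolding AE_all_countable by (intro allI ev) simp
  then show ?thesis
  proof (rule AE_mp, intro AE_I2 impI)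
    fix w assume w: "\<forall>j::nat. \<forall>\<^sub>F n in sequentially. \<bar>\<Sum>m<n. Z m w\<bar> < 1 / real (Suc j) * real n"
    show "(\<lambda>n. (\<Sum>m<n. Z m w) / real n) \<longlonglongrightarrow> 0"
    proof (rule tendstoI)
      fix e :: real assume "0 < e"
      then obtain j where j: "1 / real (Suc j) < e" using nat_approx_posE by blast
      show "\<forall>\<^sub>F n in sequentially. dist ((\<Sum>m<n. Z m w) / real n) 0 < e"
        using w[rule_format, of j] eventually_gt_at_top[of 0]
      proof eventually_elim
        case (elim n)
        then have "\<bar>\<Sum>m<n. Z m w\<bar> / real n < 1 / real (Suc j)" by (simp add: divide_less_eq)
        then show ?case using j by (simp add: abs_divide)
      qed
    qed
  qed
qed

text \<open>Ottaviani's inequality: after the first exit from \<open>[-4\<surd>n, 4\<surd>n]\<close>, the independent remaining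
  increment leaves the final sum outside \<open>[-2\<surd>n, 2\<surd>n]\<close> with probability at least \<open>13/16\<close>.\<close>

lemma std_normal_maximal:
  fixes Z :: "nat \<Rightarrow> 'a \<Rightarrow> real" and a n :: nat
  assumes ind: "indep_vars (\<lambda>_. borel) Z UNIV"
    and D: "\<And>m. distributed M lborel (Z m) std_normal_density" and n: "0 < n"
  shows "prob {w \<in> space M. \<exists>s\<le>n. 4 * sqrt n < \<bar>\<Sum>m\<in>{a..<a + s}. Z m w\<bar>} \<le> 1 / 2"
proof -
  have [measurable]: "random_variable borel (Z m)" for m
    using distributed_measurable[OF D] by simp
  define S where "S s f = (\<Sum>m\<in>{a..<a + s}. f m)" for s and f :: "nat \<Rightarrow> real"
  define exits where "exits s f \<longleftrightarrow> 4 * sqrt n < \<bar>S s f\<bar> \<and> (\<forall>r<s. \<bar>S r f\<bar> \<le> 4 * sqrt n)" for s f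
  define A where "A s = {w \<in> space M. exits s (\<lambda>m. Z m w)}" for s
  define Bs where "Bs s = {w \<in> space M. \<bar>\<Sum>m\<in>{a + s..<a + n}. Z m w\<bar> < 2 * sqrt n}" for s
  define F where "F = {w \<in> space M. 2 * sqrt n \<le> \<bar>\<Sum>m\<in>{a..<a + n}. Z m w\<bar>}"
  have [measurable]: "A s \<in> sets M" "Bs s \<in> sets M" "F \<in> sets M" for s
    unfolding A_def Bs_def F_def exits_def S_def by measurable
  have disj: "disjoint_family_on A {..n}"
    unfolding disjoint_family_on_def
  proof (intro ballI impI)
    fix s s' :: nat assume "s \<noteq> s'"
    then show "A s \<inter> A s' = {}"
      by (auto simp: A_def exits_def not_le) (metis linorder_neqE_nat not_le)
  qed
  have AF: "A s \<inter> Bs s \<subseteq> F" if s: "s \<le> n" for s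
  proof
    fix w assume w: "w \<in> A s \<inter> Bs s"
    have "(\<Sum>m\<in>{a..<a + n}. Z m w) = (\<Sum>m\<in>{a..<a + s}. Z m w) + (\<Sum>m\<in>{a + s..<a + n}. Z m w)"
      using s by (simp add: sum.atLeastLessThan_concat)
    then show "w \<in> F" using w by (auto simp: A_def Bs_def F_def exits_def S_def)
  qed
  have PB: "13 / 16 \<le> prob (Bs s)" for s
  proof -
    have "prob {w \<in> space M. 2 * sqrt n \<le> \<bar>\<Sum>m\<in>{a + s..<a + n}. Z m w\<bar>} \<le> 3 / 2 ^ 4"
      by (rule std_normal_sum_tail[OF ind]) (use D n in auto)
    moreover have "Bs s = space M - {w \<in> space M. 2 * sqrt n \<le> \<bar>\<Sum>m\<in>{a + s..<a + n}. Z m w\<bar>}"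
      by (auto simp: Bs_def)
    then have "prob (Bs s) = 1 - prob {w \<in> space M. 2 * sqrt n \<le> \<bar>\<Sum>m\<in>{a + s..<a + n}. Z m w\<bar>}"
      by (simp add: prob_compl)
    ultimately show ?thesis by simp
  qed
  \<comment> \<open>The exit at \<open>s\<close> is decided by the samples before
    \<open>a + s\<close>, the increment by the later ones. Both events are read off the restrictions
    to these disjoint index sets.\<close>
  have indAB: "prob (A s \<inter> Bs s) = prob (A s) * prob (Bs s)" for s
  proof -
    let ?I = "{a..<a + s}" and ?J = "{a + s..<a + n}"
    let ?XA = "{f \<in> space (PiM ?I (\<lambda>_. borel)). exits s f}"
    let ?XB = "{f \<in> space (PiM ?J (\<lambda>_. borel)). \<bar>\<Sum>m\<in>?J. f m\<bar> < 2 * sqrt n}"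
    have iv: "indep_var (PiM ?I (\<lambda>_. borel)) (\<lambda>w. restrict (\<lambda>i. Z i w) ?I)
        (PiM ?J (\<lambda>_. borel)) (\<lambda>w. restrict (\<lambda>i. Z i w) ?J)"
      by (rule indep_var_restrict[OF ind]) auto
    have Sm: "S r \<in> borel_measurable (PiM ?I (\<lambda>_. borel))" if "r \<le> s" for r
      unfolding S_def using that by (intro borel_measurable_sum measurable_component_singleton) auto
    have "{f \<in> space (PiM ?I (\<lambda>_. borel)). \<bar>S r f\<bar> \<le> 4 * sqrt n} \<in> sets (PiM ?I (\<lambda>_. borel))"
      if "r \<in> {..<s}" for r
    proof -
      have [measurable]: "S r \<in> borel_measurable (PiM ?I (\<lambda>_. borel))" using that by (intro Sm) simp
      show ?thesis by measurable
    qed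
    then have "{f \<in> space (PiM ?I (\<lambda>_. borel)). \<forall>r\<in>{..<s}. \<bar>S r f\<bar> \<le> 4 * sqrt n}
        \<in> sets (PiM ?I (\<lambda>_. borel))"
      by (rule sets.sets_Collect_finite_All) auto
    moreover have "{f \<in> space (PiM ?I (\<lambda>_. borel)). 4 * sqrt n < \<bar>S s f\<bar>} \<in> sets (PiM ?I (\<lambda>_. borel))"
      using Sm[OF order_refl] by measurable
    ultimately have "{f \<in> space (PiM ?I (\<lambda>_. borel)). 4 * sqrt n < \<bar>S s f\<bar> \<and>
        (\<forall>r\<in>{..<s}. \<bar>S r f\<bar> \<le> 4 * sqrt n)} \<in> sets (PiM ?I (\<lambda>_. borel))"
      by (intro sets.sets_Collect_conj)
    then have "?XA \<in> sets (PiM ?I (\<lambda>_. borel))" by (simp add: exits_def Ball_def)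
    moreover have "(\<lambda>f. \<Sum>m\<in>?J. f m) \<in> borel_measurable (PiM ?J (\<lambda>_. borel :: real measure))"
      by (intro borel_measurable_sum measurable_component_singleton) auto
    then have "?XB \<in> sets (PiM ?J (\<lambda>_. borel))" by measurable
    ultimately have "prob ((\<lambda>w. (restrict (\<lambda>i. Z i w) ?I, restrict (\<lambda>i. Z i w) ?J)) -` (?XA \<times> ?XB) \<inter> space M)
        = prob ((\<lambda>w. restrict (\<lambda>i. Z i w) ?I) -` ?XA \<inter> space M)
          * prob ((\<lambda>w. restrict (\<lambda>i. Z i w) ?J) -` ?XB \<inter> space M)"
      by (rule indep_varD[OF iv])
    moreover have eS: "S r (restrict (\<lambda>i. Z i w) ?I) = S r (\<lambda>i. Z i w)" if "r \<le> s" for r w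
      unfolding S_def using that by (intro sum.cong) auto
    then have ex: "exits s (restrict (\<lambda>i. Z i w) ?I) \<longleftrightarrow> exits s (\<lambda>i. Z i w)" for w
      by (auto simp: exits_def)
    have "(\<lambda>w. restrict (\<lambda>i. Z i w) ?I) -` ?XA \<inter> space M = A s"
      "(\<lambda>w. restrict (\<lambda>i. Z i w) ?J) -` ?XB \<inter> space M = Bs s"
      "(\<lambda>w. (restrict (\<lambda>i. Z i w) ?I, restrict (\<lambda>i. Z i w) ?J)) -` (?XA \<times> ?XB) \<inter> space M = A s \<inter> Bs s"
      by (auto simp: A_def Bs_def ex space_PiM)
    ultimately show ?thesis by simp
  qed
  have "13 / 16 * (\<Sum>s\<le>n. prob (A s)) \<le> (\<Sum>s\<le>n. prob (A s \<inter> Bs s))"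
    unfolding sum_distrib_left indAB
  proof (intro sum_mono)
    fix s
    show "13 / 16 * prob (A s) \<le> prob (A s) * prob (Bs s)"
      using mult_right_mono[OF PB measure_nonneg, of M "A s" s] by (simp add: mult.commute)
  qed
  also have "\<dots> = prob (\<Union>s\<le>n. A s \<inter> Bs s)"
    using disj by (intro finite_measure_finite_Union[symmetric]) (auto simp: disjoint_family_on_def)
  also have "\<dots> \<le> prob F" using AF by (intro finite_measure_mono) auto
  also have "\<dots> \<le> 3 / 2 ^ 4"
    unfolding F_def by (rule std_normal_sum_tail[OF ind]) (use D n in auto)
  \<comment> \<open>The quotient of \<open>3 / 16\<close> and \<open>13 / 16\<close> is
    \<open>3 / 13\<close>.\<close>
  finally have sum: "(\<Sum>s\<le>n. prob (A s)) \<le> 1 / 2" by simp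
  have "{w \<in> space M. \<exists>s\<le>n. 4 * sqrt n < \<bar>\<Sum>m\<in>{a..<a + s}. Z m w\<bar>} \<subseteq> (\<Union>s\<le>n. A s)"
  proof
    fix w assume w: "w \<in> {w \<in> space M. \<exists>s\<le>n. 4 * sqrt n < \<bar>\<Sum>m\<in>{a..<a + s}. Z m w\<bar>}"
    define s where "s = (LEAST s. 4 * sqrt n < \<bar>S s (\<lambda>m. Z m w)\<bar>)"
    obtain s' where s': "s' \<le> n" "4 * sqrt n < \<bar>S s' (\<lambda>m. Z m w)\<bar>" using w by (auto simp: S_def)
    then have "s \<le> n" "4 * sqrt n < \<bar>S s (\<lambda>m. Z m w)\<bar>"
      unfolding s_def by (auto intro: LeastI order_trans[OF Least_le])
    moreover have "\<bar>S r (\<lambda>m. Z m w)\<bar> \<le> 4 * sqrt n" if "r < s" for r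
      using not_less_Least[OF that[unfolded s_def]] by simp
    ultimately show "w \<in> (\<Union>s\<le>n. A s)" using w by (auto simp: A_def exits_def)
  qed
  then have "prob {w \<in> space M. \<exists>s\<le>n. 4 * sqrt n < \<bar>\<Sum>m\<in>{a..<a + s}. Z m w\<bar>} \<le> prob (\<Union>s\<le>n. A s)"
    by (intro finite_measure_mono) auto
  also have "\<dots> \<le> (\<Sum>s\<le>n. prob (A s))" by (intro finite_measure_subadditive_finite) auto
  also note sum
  finally show ?thesis .
qed

end

section \<open>Excursions recurring at infinitely many scales\<close>

lemma measurable_row_sum:
  assumes "{i} \<times> A \<subseteq> K"
  shows "(\<lambda>f. \<Sum>m\<in>A. f (i, m)) \<in> borel_measurable (PiM K (\<lambda>_. borel :: real measure))"
  using assms by (intro borel_measurable_sum measurable_component_singleton) auto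

context prob_space
begin

text \<open>\<open>\<delta>\<close> is chosen before \<open>Y\<close>, so that one bound serves the
  normalized sums of blocks at all scales.\<close>

lemma std_normal_prob_interval:
  assumes c: "c < d"
  shows "\<exists>\<delta>>0. \<forall>Y. distributed M lborel Y std_normal_density \<longrightarrow>
    \<delta> \<le> prob {w \<in> space M. c \<le> Y w \<and> Y w \<le> (d::real)}"
proof (intro exI conjI allI impI)
  let ?D = "density lborel std_normal_density"
  interpret D: prob_space ?D by (rule prob_space_normal_density) simp
  have "emeasure ?D {c..d} \<noteq> 0"
  proof
    assume "emeasure ?D {c..d} = 0"
    then have "{c..d} \<in> null_sets ?D" by (intro null_setsI) auto
    then have "AE z in lborel. z \<in> {c..d} \<longrightarrow> ennreal (std_normal_density z) = 0"
      by (subst (asm) null_sets_density_iff) auto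
    then have "AE z in lborel. z \<notin> {c..d}"
      by eventually_elim (metis ennreal_eq_0_iff linorder_not_le normal_density_pos zero_less_one)
    then have "{c..d} \<in> null_sets lborel" by (simp add: AE_iff_null_sets)
    then show False using c by (auto simp: null_sets_def)
  qed
  then show "0 < D.prob {c..d}" by (simp add: D.emeasure_eq_measure zero_less_measure_iff)
  fix Y assume Y: "distributed M lborel Y std_normal_density"
  have "D.prob {c..d} = measure (distr M lborel Y) {c..d}"
    using distributed_distr_eq_density[OF Y] by simp
  also have "\<dots> = prob (Y -` {c..d} \<inter> space M)"
    using distributed_measurable[OF Y] by (intro measure_distr) auto
  also have "Y -` {c..d} \<inter> space M = {w \<in> space M. c \<le> Y w \<and> Y w \<le> d}" by auto
  finally show "D.prob {c..d} \<le> prob {w \<in> space M. c \<le> Y w \<and> Y w \<le> d}" by simp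
qed

text \<open>At scale \<open>l\<close>, row \<open>i\<close> has to make an excursion on the samples
  from \<open>r l\<close> to \<open>a l i\<close> and then to stay near the value reached. The next
  scale starts beyond all these samples, so the scales are independent, and their success
  probabilities have a common positive lower bound. Leaving out the first \<open>r l\<close> samples
  is the price for independence.\<close>

lemma std_normal_windows_infinite:
  fixes Z :: "nat \<Rightarrow> nat \<Rightarrow> 'a \<Rightarrow> real" and k R :: nat and a :: "nat \<Rightarrow> nat \<Rightarrow> nat" and r :: "nat \<Rightarrow> nat"
    and C :: "nat \<Rightarrow> real"
  assumes ind: "indep_vars (\<lambda>_. borel) (\<lambda>(i, m). Z i m) ({..<k} \<times> UNIV)"
    and D: "\<And>i m. i < k \<Longrightarrow> distributed M lborel (Z i m) std_normal_density"
    and k: "0 < k" and R: "0 < R" and C: "\<And>i. i < k \<Longrightarrow> 0 < C i"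
    and a0: "\<And>l i. i < k \<Longrightarrow> 0 < a l i" and ra: "\<And>l i. i < k \<Longrightarrow> 2 * r l \<le> a l i"
    and ar: "\<And>l i. i < k \<Longrightarrow> a l i + R * a l i \<le> r (Suc l)"
  shows "AE w in M. infinite {l. \<forall>i<k.
      C i * sqrt (a l i) \<le> (\<Sum>m\<in>{r l..<a l i}. Z i m w) \<and>
      (\<Sum>m\<in>{r l..<a l i}. Z i m w) \<le> 2 * C i * sqrt (a l i) \<and>
      (\<forall>s\<le>R * a l i. \<bar>\<Sum>m\<in>{a l i..<a l i + s}. Z i m w\<bar> \<le> 4 * sqrt (R * a l i))}"
proof -
  define up where "up l i f \<longleftrightarrow> C i * sqrt (a l i) \<le> (\<Sum>m\<in>{r l..<a l i}. f (i, m)) \<and>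
      (\<Sum>m\<in>{r l..<a l i}. f (i, m)) \<le> 2 * C i * sqrt (a l i)" for l i and f :: "nat \<times> nat \<Rightarrow> real"
  define stay where "stay l i f \<longleftrightarrow> (\<forall>s\<in>{..R * a l i}.
      \<bar>\<Sum>m\<in>{a l i..<a l i + s}. f (i, m)\<bar> \<le> 4 * sqrt (R * a l i))"
    for l i and f :: "nat \<times> nat \<Rightarrow> real"
  define ZZ where "ZZ w = (\<lambda>(i, m). Z i m w)" for w
  have ZZ: "ZZ w (i, m) = Z i m w" for w i m by (simp add: ZZ_def)
  have ind': "indep_vars (\<lambda>_. borel) (\<lambda>j w. ZZ w j) ({..<k} \<times> UNIV)"
  proof -
    have "(\<lambda>j w. ZZ w j) = (\<lambda>(i, m). Z i m)" by (auto simp: ZZ_def fun_eq_iff)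
    then show ?thesis using ind by simp
  qed
  have row: "indep_vars (\<lambda>_. borel) (Z i) UNIV" if "i < k" for i
    using indep_vars_reindex_inj[OF ind, of "\<lambda>m. (i, m)" UNIV] that by (auto simp: inj_on_def)
  have Zm: "random_variable borel (Z i m)" if "i < k" for i m
    using distributed_measurable[OF D[OF that]] by simp
  have up_sets: "{f \<in> space (PiM K (\<lambda>_. borel)). up l i f} \<in> sets (PiM K (\<lambda>_. borel))"
    if "{i} \<times> {r l..<a l i} \<subseteq> K" for l i K
  proof -
    note [measurable] = measurable_row_sum[OF that]
    show ?thesis unfolding up_def by measurable
  qed
  have stay_sets: "{f \<in> space (PiM K (\<lambda>_. borel)). stay l i f} \<in> sets (PiM K (\<lambda>_. borel))"
    if K: "{i} \<times> {a l i..<a l i + R * a l i} \<subseteq> K" for l i K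
    unfolding stay_def
  proof (rule sets.sets_Collect_finite_All)
    fix s assume "s \<in> {..R * a l i}"
    then have "{i} \<times> {a l i..<a l i + s} \<subseteq> {i} \<times> {a l i..<a l i + R * a l i}" by auto
    then have "{i} \<times> {a l i..<a l i + s} \<subseteq> K" using K by (rule order_trans)
    note [measurable] = measurable_row_sum[OF this]
    show "{f \<in> space (PiM K (\<lambda>_. borel)). \<bar>\<Sum>m\<in>{a l i..<a l i + s}. f (i, m)\<bar> \<le> 4 * sqrt (R * a l i)}
        \<in> sets (PiM K (\<lambda>_. borel))" by measurable
  qed simp
  have up_restrict: "up l i (restrict f K) \<longleftrightarrow> up l i f" if "{i} \<times> {r l..<a l i} \<subseteq> K" for l i f K
  proof -
    have "(\<Sum>m\<in>{r l..<a l i}. restrict f K (i, m)) = (\<Sum>m\<in>{r l..<a l i}. f (i, m))"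
      using that by (intro sum.cong refl restrict_apply') blast
    then show ?thesis by (simp add: up_def)
  qed
  have stay_restrict: "stay l i (restrict f K) \<longleftrightarrow> stay l i f"
    if K: "{i} \<times> {a l i..<a l i + R * a l i} \<subseteq> K" for l i f K
  proof -
    have "(\<Sum>m\<in>{a l i..<a l i + s}. restrict f K (i, m)) = (\<Sum>m\<in>{a l i..<a l i + s}. f (i, m))"
      if s: "s \<le> R * a l i" for s
    proof (intro sum.cong refl restrict_apply')
      fix m assume "m \<in> {a l i..<a l i + s}"
      then have "(i, m) \<in> {i} \<times> {a l i..<a l i + R * a l i}" using s by simp
      then show "(i, m) \<in> K" using K by blast
    qed
    then show ?thesis by (simp add: stay_def)
  qed
  \<comment> \<open>At least half of the \<open>a l i\<close> samples lie in the block, so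
    \<open>sqrt (a l i)\<close> is at most \<open>sqrt 2\<close> times the norming constant of the
    block sum.\<close>
  have "\<forall>i\<in>{..<k}. \<exists>\<delta>. 0 < \<delta> \<and> (\<forall>Y. distributed M lborel Y std_normal_density \<longrightarrow>
      \<delta> \<le> prob {w \<in> space M. sqrt 2 * C i \<le> Y w \<and> Y w \<le> 2 * C i})"
    using C by (intro ballI std_normal_prob_interval) (simp add: sqrt2_less_2)
  from bchoice[OF this] obtain \<delta> where \<delta>_all: "\<forall>i\<in>{..<k}. 0 < \<delta> i \<and>
      (\<forall>Y. distributed M lborel Y std_normal_density \<longrightarrow>
        \<delta> i \<le> prob {w \<in> space M. sqrt 2 * C i \<le> Y w \<and> Y w \<le> 2 * C i})"
    by (elim exE)
  have \<delta>: "0 < \<delta> i" if "i < k" for i using \<delta>_all that by simp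
  have \<delta>_le: "\<delta> i \<le> prob {w \<in> space M. sqrt 2 * C i \<le> Y w \<and> Y w \<le> 2 * C i}"
    if "i < k" "distributed M lborel Y std_normal_density" for i Y
    using \<delta>_all that by simp
  have r_le: "r l \<le> a l i" if "i < k" for l i using ra[OF that, of l] by simp
  have P_up: "\<delta> i \<le> prob {w \<in> space M. up l i (ZZ w)}" if i: "i < k" for l i
  proof -
    let ?J = "{r l..<a l i}"
    let ?Y = "\<lambda>w. (\<Sum>m\<in>?J. Z i m w) / sqrt (card ?J)"
    have card: "0 < card ?J" "real (a l i) \<le> 2 * real (card ?J)" "card ?J \<le> a l i"
      using ra[OF i, of l] a0[OF i, of l] by auto
    have "\<delta> i \<le> prob {w \<in> space M. sqrt 2 * C i \<le> ?Y w \<and> ?Y w \<le> 2 * C i}"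
      using card D[OF i] by (intro \<delta>_le[OF i] std_normal_sum[OF row[OF i]]) (auto simp: card_gt_0_iff)
    also have "\<dots> \<le> prob {w \<in> space M. up l i (ZZ w)}"
    proof (intro finite_measure_mono subsetI)
      fix w assume "w \<in> {w \<in> space M. sqrt 2 * C i \<le> ?Y w \<and> ?Y w \<le> 2 * C i}"
      then have w: "w \<in> space M" "sqrt 2 * C i \<le> ?Y w" "?Y w \<le> 2 * C i" by auto
      let ?q = "sqrt (card ?J)"
      have q: "0 < ?q" using card by simp
      have "sqrt (a l i) \<le> sqrt (2 * real (card ?J))" using card by (intro real_sqrt_le_mono)
      then have "C i * sqrt (a l i) \<le> sqrt 2 * C i * ?q"
        using C[OF i] by (simp add: real_sqrt_mult mult.assoc mult.left_commute)
      also have "\<dots> \<le> (\<Sum>m\<in>?J. Z i m w)" using w(2) q by (simp add: pos_le_divide_eq)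
      finally have 1: "C i * sqrt (a l i) \<le> (\<Sum>m\<in>?J. Z i m w)" .
      have "(\<Sum>m\<in>?J. Z i m w) \<le> 2 * C i * ?q" using w(3) q by (simp add: pos_divide_le_eq)
      also have "\<dots> \<le> 2 * C i * sqrt (a l i)"
        using C[OF i] card(3) by (intro mult_left_mono real_sqrt_le_mono) auto
      finally show "w \<in> {w \<in> space M. up l i (ZZ w)}" using 1 w(1) by (simp add: up_def ZZ)
    next
      note [measurable] = Zm[OF i]
      show "{w \<in> space M. up l i (ZZ w)} \<in> events" unfolding up_def ZZ by measurable
    qed
    finally show ?thesis .
  qed
  have P_stay: "1 / 2 \<le> prob {w \<in> space M. stay l i (ZZ w)}" if i: "i < k" for l i
  proof -
    note [measurable] = Zm[OF i]
    let ?n = "R * a l i"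
    let ?E = "{w \<in> space M. \<exists>s\<le>?n. 4 * sqrt ?n < \<bar>\<Sum>m\<in>{a l i..<a l i + s}. Z i m w\<bar>}"
    have [measurable]: "?E \<in> events" by measurable
    have "prob ?E \<le> 1 / 2" using R a0[OF i] by (intro std_normal_maximal row i D) simp
    moreover have "stay l i (ZZ w) \<longleftrightarrow> \<not> (\<exists>s\<le>?n. 4 * sqrt ?n < \<bar>\<Sum>m\<in>{a l i..<a l i + s}. Z i m w\<bar>)" for w
      unfolding stay_def ZZ Ball_def atMost_iff by (meson not_le)
    then have "{w \<in> space M. stay l i (ZZ w)} = space M - ?E" by blast
    then have "prob {w \<in> space M. stay l i (ZZ w)} = 1 - prob ?E" by (simp add: prob_compl)
    ultimately show ?thesis by simp
  qed
  define G where "G l f \<longleftrightarrow> (\<forall>i\<in>{..<k}. up l i f \<and> stay l i f)" for l f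
  define F where "F l = {w \<in> space M. G l (ZZ w)}" for l
  have P_F: "(\<Prod>i<k. \<delta> i * (1 / 2)) \<le> prob (F l)" for l
  proof -
    \<comment> \<open>The boolean separates the two events of a row, \<open>True\<close> for staying
      and \<open>False\<close> for the excursion. They involve disjoint samples, so all
      \<open>2 * k\<close> events are independent.\<close>
    define P where "P j f = (if snd j then stay l (fst j) f else up l (fst j) f)"
      for j :: "nat \<times> bool" and f
    define K where "K j = {fst j} \<times> (if snd j then {a l (fst j)..<a l (fst j) + R * a l (fst j)}
        else {r l..<a l (fst j)})" for j :: "nat \<times> bool"
    let ?L = "{..<k} \<times> (UNIV :: bool set)"
    have "indep_vars (\<lambda>j. PiM (K j) (\<lambda>_. borel)) (\<lambda>j w. restrict (ZZ w) (K j)) ?L"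
      by (intro indep_vars_restrict[OF ind', simplified])
        (auto simp: K_def disjoint_family_on_def split: if_splits)
    then have "indep_events (\<lambda>j. {w \<in> space M. P j (restrict (ZZ w) (K j))}) ?L"
      by (rule indep_eventsI_indep_vars) (auto simp: P_def K_def intro!: up_sets stay_sets)
    moreover have "P j (restrict (ZZ w) (K j)) \<longleftrightarrow> P j (ZZ w)" for j w
      by (auto simp: P_def K_def up_restrict stay_restrict)
    ultimately have "indep_events (\<lambda>j. {w \<in> space M. P j (ZZ w)}) ?L" by simp
    then have "prob (\<Inter>j\<in>?L. {w \<in> space M. P j (ZZ w)}) = (\<Prod>j\<in>?L. prob {w \<in> space M. P j (ZZ w)})"
      using k unfolding indep_events_def by (auto simp: lessThan_empty_iff)
    moreover have "(\<Inter>j\<in>?L. {w \<in> space M. P j (ZZ w)}) = F l"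
    proof -
      have PL: "G l f \<longleftrightarrow> (\<forall>j\<in>?L. P j f)" for f by (auto simp: G_def P_def UNIV_bool)
      \<comment> \<open>A nonempty index set keeps the intersection inside
        \<open>space M\<close>.\<close>
      have "(0, True) \<in> ?L" using k by simp
      then show ?thesis unfolding F_def PL by blast
    qed
    moreover have "(\<Prod>j\<in>?L. prob {w \<in> space M. P j (ZZ w)})
        = (\<Prod>i<k. \<Prod>h\<in>UNIV. prob {w \<in> space M. P (i, h) (ZZ w)})"
      by (simp add: prod.cartesian_product)
    moreover have "\<dots> = (\<Prod>i<k. prob {w \<in> space M. up l i (ZZ w)} * prob {w \<in> space M. stay l i (ZZ w)})"
      by (simp add: UNIV_bool P_def mult.commute)
    moreover have "(\<Prod>i<k. \<delta> i * (1 / 2))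
        \<le> (\<Prod>i<k. prob {w \<in> space M. up l i (ZZ w)} * prob {w \<in> space M. stay l i (ZZ w)})"
      using \<delta> P_up P_stay by (intro prod_mono conjI mult_mono) (auto simp: less_imp_le)
    ultimately show ?thesis by simp
  qed
  have \<delta>_pos: "0 < (\<Prod>i<k. \<delta> i * (1 / 2))" using \<delta> by (intro prod_pos) auto
  have r_mono: "r l \<le> r l'" if "l \<le> l'" for l l'
  proof (rule lift_Suc_mono_le[OF _ that])
    fix l show "r l \<le> r (Suc l)" using r_le[OF k, of l] ar[OF k, of l] by simp
  qed
  have "indep_events F UNIV"
  proof -
    define K where "K l = {..<k} \<times> {r l..<r (Suc l)}" for l
    have K: "{i} \<times> {r l..<a l i} \<subseteq> K l" "{i} \<times> {a l i..<a l i + R * a l i} \<subseteq> K l" if "i < k" for i l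
      using that ar[OF that, of l] r_le[OF that, of l] by (auto simp: K_def)
    have disj: "disjoint_family_on K UNIV"
      unfolding disjoint_family_on_def
    proof (intro ballI impI)
      fix l l' :: nat assume "l \<noteq> l'"
      then consider "Suc l \<le> l'" | "Suc l' \<le> l" by linarith
      then show "K l \<inter> K l' = {}"
      proof cases
        case 1
        then show ?thesis using r_mono[OF 1] by (auto simp: K_def)
      next
        case 2
        then show ?thesis using r_mono[OF 2] by (auto simp: K_def)
      qed
    qed
    have "indep_vars (\<lambda>l. PiM (K l) (\<lambda>_. borel)) (\<lambda>l w. restrict (ZZ w) (K l)) UNIV"
      by (intro indep_vars_restrict[OF ind', simplified] disj) (auto simp: K_def)
    then have "indep_events (\<lambda>l. {w \<in> space M. G l (restrict (ZZ w) (K l))}) UNIV"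
    proof (rule indep_eventsI_indep_vars)
      fix l
      show "{f \<in> space (PiM (K l) (\<lambda>_. borel)). G l f} \<in> sets (PiM (K l) (\<lambda>_. borel))"
        unfolding G_def
        by (intro sets.sets_Collect_finite_All sets.sets_Collect_conj up_sets stay_sets K) auto
    qed
    moreover have "G l (restrict (ZZ w) (K l)) \<longleftrightarrow> G l (ZZ w)" for l w
      using up_restrict[OF K(1)] stay_restrict[OF K(2)] by (auto simp: G_def)
    ultimately show ?thesis by (simp add: F_def[abs_def])
  qed
  then have "(AE w in M. infinite {l. G l (ZZ w)}) \<or> (AE w in M. finite {l. G l (ZZ w)})"
    unfolding F_def[abs_def] by (rule borel_0_1_law_AE)
  \<comment> \<open>The zero-one law leaves only this case to exclude: the tail unions
    \<open>U n\<close> would decrease to a null set, against their uniform lower bound.\<close>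
  moreover have "\<not> (AE w in M. finite {l. G l (ZZ w)})"
  proof
    assume fin: "AE w in M. finite {l. G l (ZZ w)}"
    have [measurable]: "F l \<in> events" for l using \<open>indep_events F UNIV\<close> by (auto simp: indep_events_def)
    define U where "U n = (\<Union>l\<in>{n..}. F l)" for n
    have [measurable]: "U n \<in> events" for n unfolding U_def by measurable
    have "(\<lambda>n. prob (U n)) \<longlonglongrightarrow> prob (\<Inter>n. U n)"
      by (intro finite_Lim_measure_decseq) (auto simp: decseq_def U_def intro: order_trans)
    moreover have "(\<Prod>i<k. \<delta> i * (1 / 2)) \<le> prob (U n)" for n
      using P_F[of n] by (rule order_trans) (intro finite_measure_mono, auto simp: U_def)
    ultimately have "(\<Prod>i<k. \<delta> i * (1 / 2)) \<le> prob (\<Inter>n. U n)" by (intro LIMSEQ_le_const) auto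
    moreover have "AE w in M. w \<notin> (\<Inter>n. U n)"
      using fin
    proof (rule AE_mp, intro AE_I2 impI)
      fix w assume "finite {l. G l (ZZ w)}"
      then obtain n where "\<forall>l\<in>{l. G l (ZZ w)}. l < n" using finite_nat_set_iff_bounded by blast
      then have "w \<notin> U n" by (auto simp: U_def F_def)
      then show "w \<notin> (\<Inter>n. U n)" by blast
    qed
    then have "prob (\<Inter>n. U n) = 0" by (subst prob_eq_0) auto
    ultimately show False using \<delta>_pos by simp
  qed
  ultimately have "AE w in M. infinite {l. G l (ZZ w)}" by blast
  then show ?thesis by (simp add: G_def up_def stay_def ZZ Ball_def)
qed

end

section \<open>From excursions of sums to separated windows of means\<close>

lemma separated_window_antimono:
  assumes "K \<le> K'" "separated_window k lam mu K' q"
  shows "separated_window k lam mu K q"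
proof -
  from assms(2) obtain l u g where *: "0 < g" "\<forall>i<k. l i \<le> u i"
     "\<forall>i<k. \<forall>s. q \<le> real s / lam i \<longrightarrow> real s / lam i \<le> real k ^ k * q \<longrightarrow>
        l i \<le> mu i s \<and> mu i s \<le> u i"
     "\<forall>i<k. \<forall>j<k. i \<noteq> j \<longrightarrow> u i + g \<le> l j \<or> u j + g \<le> l i"
     "\<forall>i<k. \<forall>j<k. K' < g\<^sup>2 * q / (2 * (lam i + lam j))"
    unfolding separated_window_def by (elim exE conjE) (rule that)
  have "\<forall>i<k. \<forall>j<k. K < g\<^sup>2 * q / (2 * (lam i + lam j))"
    using assms(1) *(5) le_less_trans by blast
  with * show ?thesis unfolding separated_window_def
    by (intro exI[of _ l] exI[of _ u] exI[of _ g] conjI)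
qed

text \<open>Excursions of sizes \<open>c i\<close> growing geometrically in \<open>i\<close> separate the sample means uniformly over
  the window, although each mean may shrink by a factor \<open>R\<close> while the sample size runs through it.\<close>

lemma separated_window_if_excursions:
  fixes k R :: nat and lam y c :: "nat \<Rightarrow> real" and S :: "nat \<Rightarrow> nat \<Rightarrow> real" and g q K :: real
    and a :: "nat \<Rightarrow> nat"
  assumes R: "R = k ^ k" "0 < R" and q: "0 < q" and g: "0 < g"
    and lam: "\<And>i. i < k \<Longrightarrow> 0 < lam i"
    and gK: "\<And>i j. i < k \<Longrightarrow> j < k \<Longrightarrow> K < g\<^sup>2 / (2 * (lam i + lam j))"
    and c: "\<And>i. i < k \<Longrightarrow> g \<le> c i" and c_geom: "\<And>i j. i < j \<Longrightarrow> j < k \<Longrightarrow> 12 * real R * c i \<le> c j"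
    and a: "\<And>i. i < k \<Longrightarrow> a i = nat \<lceil>lam i * q\<rceil>"
    and S: "\<And>i s. i < k \<Longrightarrow> a i \<le> s \<Longrightarrow> s \<le> R * a i \<Longrightarrow>
      c i / sqrt (lam i) / 2 * sqrt (a i) \<le> S i s \<and> S i s \<le> 3 * (c i / sqrt (lam i)) * sqrt (a i)"
    and y: "\<And>i j. i < k \<Longrightarrow> j < k \<Longrightarrow> y i < y j \<Longrightarrow> (3 * c i + g) / sqrt q \<le> y j - y i"
  shows "separated_window k lam (\<lambda>i s. y i + lam i * S i s / real s) K q"
proof -
  \<comment> \<open>Dividing the bounds on \<open>S\<close> by the smallest sample size of the
    window gives \<open>?u\<close>, by the largest gives \<open>?l\<close>; hence \<open>R\<close>
    in \<open>?l\<close> only.\<close>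
  let ?l = "\<lambda>i. y i + c i / (2 * real R) / sqrt q" and ?u = "\<lambda>i. y i + 3 * c i / sqrt q"
  have R1: "1 \<le> real R" using R(2) by simp
  have h: "0 < sqrt q" using q by simp
  have c0: "0 < c i" if "i < k" for i using c[OF that] g by simp
  have lu: "?l i \<le> ?u i" if "i < k" for i
  proof -
    have "c i / (2 * real R) \<le> c i / 1" using c0[OF that] R1 by (intro divide_left_mono) auto
    then have "c i / (2 * real R) \<le> 3 * c i" using c0[OF that] by simp
    then have "c i / (2 * real R) / sqrt q \<le> 3 * c i / sqrt q" using h by (intro divide_right_mono) auto
    then show ?thesis by (rule add_left_mono)
  qed
  have win: "?l i \<le> y i + lam i * S i s / real s \<and> y i + lam i * S i s / real s \<le> ?u i"
    if i: "i < k" and s: "q \<le> real s / lam i" "real s / lam i \<le> real k ^ k * q" for i s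
  proof -
    let ?x = "lam i * q"
    define C where "C = c i / sqrt (lam i)"
    have li: "0 < lam i" by (rule lam[OF i])
    have x0: "0 < ?x" using li q by simp
    have C0: "0 < C" using c0[OF i] li by (simp add: C_def)
    have qs: "?x \<le> real s" "real s \<le> real R * ?x"
      using s li by (simp_all add: R(1) field_simps)
    have xa: "?x \<le> real (a i)" unfolding a[OF i] by (rule real_nat_ceiling_ge)
    have as: "a i \<le> s" using qs(1) by (simp add: a[OF i] nat_le_iff ceiling_le_iff)
    have "real s \<le> real R * real (a i)" using qs(2) mult_left_mono[OF xa, of "real R"] by simp
    then have "s \<le> R * a i" by (metis of_nat_le_iff of_nat_mult)
    from S[OF i as this] have S1: "C / 2 * sqrt (a i) \<le> S i s" and S2: "S i s \<le> 3 * C * sqrt (a i)"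
      by (auto simp: C_def)
    have s0: "0 < real s" "0 < real (a i)" using qs(1) x0 xa by linarith+
    have lc: "lam i * C = c i * sqrt (lam i)"
    proof -
      have "lam i * C = c i * (lam i / sqrt (lam i))" by (simp add: C_def)
      then show ?thesis using li by (simp add: real_div_sqrt)
    qed
    have "c i / (2 * real R) / sqrt q = lam i * (C / 2 * sqrt ?x) / (real R * ?x)"
    proof -
      have "lam i * (C / 2 * sqrt ?x) / (real R * ?x) = (lam i * C) * sqrt (lam i) / (2 * real R * lam i) * (sqrt q / q)"
        by (simp add: real_sqrt_mult)
      also have "\<dots> = c i * (sqrt (lam i) * sqrt (lam i)) / (2 * real R * lam i) * (sqrt q / q)"
        unfolding lc by simp
      also have "\<dots> = c i / (2 * real R) / sqrt q"
        using li q by (simp add: sqrt_divide_self_eq inverse_eq_divide)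
      finally show ?thesis by simp
    qed
    also have "\<dots> \<le> lam i * S i s / real s"
    proof (rule frac_le)
      have "C / 2 * sqrt ?x \<le> C / 2 * sqrt (a i)"
        using C0 xa by (intro mult_left_mono real_sqrt_le_mono) auto
      also note S1
      finally show "lam i * (C / 2 * sqrt ?x) \<le> lam i * S i s" using li by (intro mult_left_mono) auto
      have "0 \<le> C / 2 * sqrt (a i)" using C0 by simp
      then have "0 \<le> S i s" using S1 by (rule order_trans)
      then show "0 \<le> lam i * S i s" using li by simp
    qed (use qs s0 in auto)
    finally have lo: "c i / (2 * real R) / sqrt q \<le> lam i * S i s / real s" .
    have "lam i * S i s / real s \<le> lam i * (3 * C * sqrt (a i)) / real (a i)"
    proof (rule frac_le)
      show "lam i * S i s \<le> lam i * (3 * C * sqrt (a i))" using S2 li by (intro mult_left_mono) auto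
      show "0 \<le> lam i * (3 * C * sqrt (a i))" using C0 li by simp
    qed (use as s0 in auto)
    also have "\<dots> = 3 * (lam i * C) / sqrt (a i)"
    proof -
      have "lam i * (3 * C * sqrt (a i)) / real (a i) = 3 * (lam i * C) * (sqrt (a i) / real (a i))" by simp
      also have "sqrt (a i) / real (a i) = 1 / sqrt (a i)"
        by (simp add: sqrt_divide_self_eq inverse_eq_divide)
      finally show ?thesis by simp
    qed
    also have "\<dots> \<le> 3 * (lam i * C) / sqrt ?x"
      using C0 li x0 xa by (intro divide_left_mono) auto
    also have "\<dots> = 3 * c i / sqrt q" unfolding lc using li by (simp add: real_sqrt_mult)
    finally show ?thesis using lo by simp
  qed
  have sep1: "?u i + g / sqrt q \<le> ?l j" if ij: "i < k" "j < k" and yy: "y i < y j" for i j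
  proof -
    have "0 \<le> c j / (2 * real R) / sqrt q" using c0[OF ij(2)] R1 h by simp
    then show ?thesis using y[OF ij yy] by (simp add: add_divide_distrib)
  qed
  \<comment> \<open>For equal true means only the noise separates:
    \<open>12 * R * c i / (2 * R) = 6 * c i \<ge> 3 * c i + g\<close>, which fixes the ratio in
    \<open>c_geom\<close>.\<close>
  have sep2: "?u i + g / sqrt q \<le> ?l j" if ij: "i < j" "j < k" and yy: "y i = y j" for i j
  proof -
    have "c j / (2 * real R) \<ge> 12 * real R * c i / (2 * real R)"
      using c_geom[OF ij] R1 by (intro divide_right_mono) auto
    then have "3 * c i + g \<le> c j / (2 * real R)" using c[of i] g ij R1 by simp
    then have "(3 * c i + g) / sqrt q \<le> c j / (2 * real R) / sqrt q" using h by (intro divide_right_mono) auto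
    then show ?thesis using yy by (simp add: add_divide_distrib)
  qed
  have sep: "?u i + g / sqrt q \<le> ?l j \<or> ?u j + g / sqrt q \<le> ?l i" if ij: "i < k" "j < k" "i \<noteq> j" for i j
  proof -
    consider "y i < y j" | "y j < y i" | "y i = y j" "i < j" | "y j = y i" "j < i"
      using ij(3) by linarith
    then show ?thesis by cases (use sep1 sep2 ij in blast)+
  qed
  have gap: "K < (g / sqrt q)\<^sup>2 * q / (2 * (lam i + lam j))" if "i < k" "j < k" for i j
    using gK[OF that] q by (simp add: power_divide)
  show ?thesis unfolding separated_window_def
    using lu win sep gap g h
    by (intro exI[of _ ?l] exI[of _ ?u] exI[of _ "g / sqrt q"] conjI) auto
qed

context prob_space
begin

text \<open>The constants are chosen in the order \<open>g\<close>, \<open>c\<close>, block ends.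
  None depends on the sample point, because independence of the scales requires blocks that are
  fixed in advance.\<close>

lemma separated_windows_fixed_level:
  fixes Z :: "nat \<Rightarrow> nat \<Rightarrow> 'a \<Rightarrow> real" and lam y :: "nat \<Rightarrow> real" and K :: real
  assumes k: "0 < k" and lam: "\<And>i. i < k \<Longrightarrow> 0 < lam i"
    and ind: "indep_vars (\<lambda>_. borel) (\<lambda>(i, m). Z i m) ({..<k} \<times> UNIV)"
    and D: "\<And>i m. i < k \<Longrightarrow> distributed M lborel (Z i m) std_normal_density"
    and sl: "AE w in M. \<forall>i<k. (\<lambda>n. (\<Sum>m<n. Z i m w) / real n) \<longlonglongrightarrow> 0"
  shows "AE w in M. \<forall>q0. \<exists>q>q0.
    separated_window k lam (\<lambda>i s. y i + lam i * (\<Sum>m<s. Z i m w) / real s) K q"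
proof -
  define R where "R = k ^ k"
  have R: "0 < R" using k by (simp add: R_def)
  define Lam where "Lam = (\<Sum>i<k. lam i)"
  have Lam: "lam i \<le> Lam" if "i < k" for i
    unfolding Lam_def using that lam by (intro member_le_sum) (auto simp: less_imp_le)
  have Lam0: "0 < Lam" using lam[OF k] Lam[OF k] by simp
  define g where "g = sqrt (4 * \<bar>K\<bar> * Lam) + 1"
  have g: "0 < g" unfolding g_def by (intro add_nonneg_pos) (auto simp: Lam0 less_imp_le)
  have gK: "K < g\<^sup>2 / (2 * (lam i + lam j))" if "i < k" "j < k" for i j
  proof -
    have "K * (2 * (lam i + lam j)) \<le> \<bar>K\<bar> * (2 * (Lam + Lam))"
      using Lam[OF that(1)] Lam[OF that(2)] lam[OF that(1)] lam[OF that(2)]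
      by (intro mult_mono) auto
    also have "\<dots> = (sqrt (4 * \<bar>K\<bar> * Lam))\<^sup>2" using Lam0 by simp
    also have "\<dots> < g\<^sup>2" unfolding g_def using Lam0 by (intro power_strict_mono) auto
    finally show ?thesis using lam[OF that(1)] lam[OF that(2)] by (simp add: pos_less_divide_eq)
  qed
  \<comment> \<open>In units of \<open>sqrt a\<close>: \<open>4 * sqrt R\<close> for the motion
    inside the window, \<open>1\<close> for the samples before the block.\<close>
  define L where "L = 4 * sqrt R + 1"
  have L0: "0 < L" by (simp add: L_def add_nonneg_pos)
  \<comment> \<open>The prefactor makes every \<open>C i\<close> at least \<open>2 * L\<close>, so
    these disturbances consume at most half of an excursion; the powers give
    \<open>c_geom\<close>.\<close>
  define c where "c i = (g + 2 * L * sqrt Lam) * (12 * real R) ^ i" for i :: nat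
  have R12: "1 \<le> 12 * real R" using R by simp
  have gc: "g + 2 * L * sqrt Lam \<le> c i" for i
  proof -
    have "(g + 2 * L * sqrt Lam) * 1 \<le> c i" unfolding c_def
      using g L0 Lam0 R12 by (intro mult_left_mono one_le_power) auto
    then show ?thesis by simp
  qed
  have c: "g \<le> c i" for i using gc[of i] L0 Lam0 by (smt (verit) mult_nonneg_nonneg real_sqrt_ge_zero)
  have c0: "0 < c i" for i using c[of i] g by simp
  have c_geom: "12 * real R * c i \<le> c j" if "i < j" for i j
  proof -
    have "12 * real R * c i = (g + 2 * L * sqrt Lam) * (12 * real R) ^ Suc i" by (simp add: c_def)
    also have "\<dots> \<le> c j" unfolding c_def
      using that g L0 Lam0 R12 by (intro mult_left_mono power_increasing) auto
    finally show ?thesis .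
  qed
  define C where "C i = c i / sqrt (lam i)" for i
  have C0: "0 < C i" if "i < k" for i using c0[of i] lam[OF that] by (simp add: C_def)
  have CL: "L \<le> C i / 2" if "i < k" for i
  proof -
    have "2 * L * sqrt (lam i) \<le> 2 * L * sqrt Lam"
      using Lam[OF that] L0 by (intro mult_left_mono real_sqrt_le_mono) auto
    also have "\<dots> \<le> c i" using gc[of i] g by simp
    finally show ?thesis using lam[OF that] by (simp add: C_def pos_le_divide_eq)
  qed
  define A where "A = nat \<lceil>\<Sum>i<k. 1 / lam i\<rceil>"
  have A: "1 \<le> lam i * real A" if "i < k" for i
  proof -
    have "1 / lam i \<le> (\<Sum>i<k. 1 / lam i)"
      using that lam by (intro member_le_sum) (auto simp: less_imp_le)
    also have "\<dots> \<le> real A" unfolding A_def by (rule real_nat_ceiling_ge)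
    finally show ?thesis using lam[OF that] by (simp add: pos_divide_le_eq mult.commute)
  qed
  have A0: "0 < A" using A[OF k] by (cases A) auto
  \<comment> \<open>Quadratic in \<open>r\<close>, so that the bound \<open>r\<close> on the sum of
    the first \<open>r\<close> samples, valid for large \<open>r\<close> by the strong law, is at
    most the square root of the new sample size. \<open>A\<close> compensates for small
    \<open>lam i\<close>.\<close>
  define qf :: "nat \<Rightarrow> nat" where "qf r = 2 * A * (r + 1)\<^sup>2" for r
  define af where "af r i = nat \<lceil>lam i * real (qf r)\<rceil>" for r i
  define r where "r = rec_nat 0 (\<lambda>_ r. \<Sum>i<k. af r i + R * af r i)"
  have r_Suc: "r (Suc l) = (\<Sum>i<k. af (r l) i + R * af (r l) i)" for l by (simp add: r_def)
  have af: "2 * (s + 1)\<^sup>2 \<le> af s i" if "i < k" for s i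
  proof -
    have "real (2 * (s + 1)\<^sup>2) = 1 * real (2 * (s + 1)\<^sup>2)" by simp
    also have "\<dots> \<le> (lam i * real A) * real (2 * (s + 1)\<^sup>2)" using A[OF that] by (intro mult_right_mono) auto
    also have "\<dots> = lam i * real (qf s)" by (simp add: qf_def)
    also have "\<dots> \<le> real (af s i)" unfolding af_def by (rule real_nat_ceiling_ge)
    finally show ?thesis by (simp only: of_nat_le_iff)
  qed
  have af_r: "2 * s \<le> af s i" "s\<^sup>2 \<le> af s i" "0 < af s i" if "i < k" for s i
    using af[OF that, of s] by (auto simp: power2_eq_square)
  have ar: "af (r l) i + R * af (r l) i \<le> r (Suc l)" if "i < k" for l i
    unfolding r_Suc using that by (intro member_le_sum[of i _ "\<lambda>i. af (r l) i + R * af (r l) i"]) auto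
  have r_ge: "l \<le> r l" for l
  proof (induction l)
    case (Suc l)
    have "r l + 1 \<le> 2 * (r l + 1)\<^sup>2" by (simp add: power2_eq_square)
    then show ?case using Suc af[OF k, of "r l"] ar[OF k, of l] by linarith
  qed simp
  have inf: "AE w in M. infinite {l. \<forall>i<k.
      C i * sqrt (af (r l) i) \<le> (\<Sum>m\<in>{r l..<af (r l) i}. Z i m w) \<and>
      (\<Sum>m\<in>{r l..<af (r l) i}. Z i m w) \<le> 2 * C i * sqrt (af (r l) i) \<and>
      (\<forall>s\<le>R * af (r l) i. \<bar>\<Sum>m\<in>{af (r l) i..<af (r l) i + s}. Z i m w\<bar> \<le> 4 * sqrt (R * af (r l) i))}"
    using ind D k R C0 af_r ar by (intro std_normal_windows_infinite[where a="\<lambda>l. af (r l)"]) auto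
  show ?thesis
    using inf sl
  proof eventually_elim
    case (elim w)
    define S where "S i s = (\<Sum>m<s. Z i m w)" for i s
    have small: "\<forall>\<^sub>F n in sequentially. \<forall>i\<in>{..<k}. \<bar>S i n\<bar> \<le> real n"
    proof (intro eventually_ball_finite ballI)
      fix i assume "i \<in> {..<k}"
      then have "(\<lambda>n. S i n / real n) \<longlonglongrightarrow> 0" using elim(2) by (simp add: S_def)
      then have "\<forall>\<^sub>F n in sequentially. \<bar>S i n / real n\<bar> < 1"
        by (auto dest: tendstoD[of _ 0 _ 1] simp: dist_real_def)
      with eventually_gt_at_top[of 0] show "\<forall>\<^sub>F n in sequentially. \<bar>S i n\<bar> \<le> real n"
      proof eventually_elim
        case (elim n)
        then show ?case by (simp add: abs_divide divide_less_eq)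
      qed
    qed simp
    then obtain n1 where n1: "\<And>n i. n1 \<le> n \<Longrightarrow> i < k \<Longrightarrow> \<bar>S i n\<bar> \<le> real n"
      unfolding eventually_sequentially by auto
    define cm where "cm = 3 * (\<Sum>i<k. c i) + g"
    have cm: "3 * c i + g \<le> cm" if "i < k" for i
      unfolding cm_def using that c0 member_le_sum[of i "{..<k}" c] by (auto simp: less_imp_le)
    have cm0: "0 < cm" using cm[OF k] c0[of 0] g by simp
    \<comment> \<open>Distinct true means differ by a fixed amount, so separating them only asks for
      \<open>q \<ge> h\<^sup>2\<close>.\<close>
    have "\<exists>h>0. \<forall>i<k. \<forall>j<k. y i < y j \<longrightarrow> cm / h \<le> y j - y i"
    proof -
      define P where "P = {(i, j). i < k \<and> j < k \<and> y i < y j}"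
      have fin: "finite P" by (rule finite_subset[of _ "{..<k} \<times> {..<k}"]) (auto simp: P_def)
      define h where "h = 1 + (\<Sum>(i, j)\<in>P. cm / (y j - y i))"
      have pos: "0 \<le> (case p of (i, j) \<Rightarrow> cm / (y j - y i))" if "p \<in> P" for p
        using that cm0 by (auto simp: P_def)
      have h0: "0 < h" unfolding h_def using pos by (intro add_pos_nonneg sum_nonneg) auto
      moreover have "cm / h \<le> y j - y i" if "i < k" "j < k" "y i < y j" for i j
      proof -
        have ij: "(i, j) \<in> P" using that by (simp add: P_def)
        have "cm / (y j - y i) \<le> h"
          unfolding h_def using member_le_sum[OF ij, of "\<lambda>(i, j). cm / (y j - y i)"] pos fin by auto
        then show ?thesis using that(3) h0 by (simp add: field_simps)
      qed
      ultimately show ?thesis by blast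
    qed
    then obtain h where h: "0 < h" "\<And>i j. i < k \<Longrightarrow> j < k \<Longrightarrow> y i < y j \<Longrightarrow> cm / h \<le> y j - y i"
      by blast
    show ?case
    proof
      fix q0 :: real
      define n2 where "n2 = n1 + nat \<lceil>q0\<rceil> + nat \<lceil>h\<^sup>2\<rceil> + 1"
      obtain l where l: "n2 \<le> l" and ev: "\<And>i. i < k \<Longrightarrow>
          C i * sqrt (af (r l) i) \<le> (\<Sum>m\<in>{r l..<af (r l) i}. Z i m w) \<and>
          (\<Sum>m\<in>{r l..<af (r l) i}. Z i m w) \<le> 2 * C i * sqrt (af (r l) i) \<and>
          (\<forall>s\<le>R * af (r l) i. \<bar>\<Sum>m\<in>{af (r l) i..<af (r l) i + s}. Z i m w\<bar> \<le> 4 * sqrt (R * af (r l) i))"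
        using elim(1) unfolding infinite_nat_iff_unbounded_le by blast
      define q where "q = real (qf (r l))"
      have "n2 \<le> r l" using l r_ge[of l] by simp
      moreover have "r l \<le> qf (r l)"
      proof -
        have "r l \<le> 1 * (r l + 1)\<^sup>2" by (simp add: power2_eq_square)
        also have "\<dots> \<le> qf (r l)" unfolding qf_def using A0 by (intro mult_le_mono1) simp
        finally show ?thesis .
      qed
      ultimately have "real n2 \<le> q" unfolding q_def by simp
      then have q_ge: "real n1 + real (nat \<lceil>q0\<rceil>) + real (nat \<lceil>h\<^sup>2\<rceil>) + 1 \<le> q"
        by (simp only: n2_def of_nat_add of_nat_1)
      have q0: "q0 < q" using q_ge real_nat_ceiling_ge[of q0] by linarith
      have hq: "h\<^sup>2 \<le> q" using q_ge real_nat_ceiling_ge[of "h\<^sup>2"] by linarith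
      then have hs: "h \<le> sqrt q" using h(1) by (simp add: real_le_rsqrt)
      have q_pos: "0 < q" using q_ge by linarith
      have "separated_window k lam (\<lambda>i s. y i + lam i * S i s / real s) K q"
      proof (rule separated_window_if_excursions[OF R_def R q_pos g lam gK c c_geom])
        show "af (r l) i = nat \<lceil>lam i * q\<rceil>" for i by (simp add: af_def q_def)
        show "(3 * c i + g) / sqrt q \<le> y j - y i" if "i < k" "j < k" "y i < y j" for i j
        proof -
          have "(3 * c i + g) / sqrt q \<le> cm / h"
            using cm[OF that(1)] hs h(1) cm0 by (intro frac_le) auto
          then show ?thesis using h(2)[OF that] by simp
        qed
        fix i s assume i: "i < k" and s: "af (r l) i \<le> s" "s \<le> R * af (r l) i"
        let ?a = "af (r l) i"
        \<comment> \<open>The first and third piece together are at most \<open>L * sqrt ?a\<close>,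
          hence at most half the lower bound of the excursion in the middle.\<close>
        have "S i s = S i (r l) + (\<Sum>m\<in>{r l..<?a}. Z i m w) + (\<Sum>m\<in>{?a..<s}. Z i m w)"
          unfolding S_def lessThan_atLeast0 using af_r(1)[OF i, of "r l"] s
          by (simp add: sum.atLeastLessThan_concat)
        moreover have "\<bar>S i (r l)\<bar> \<le> sqrt ?a"
        proof -
          have "\<bar>S i (r l)\<bar> \<le> real (r l)" using l r_ge[of l] i by (intro n1) (auto simp: n2_def)
          also have "\<dots> \<le> sqrt ?a"
            using af_r(2)[OF i, of "r l"] by (intro real_le_rsqrt) (metis of_nat_le_iff of_nat_power)
          finally show ?thesis .
        qed
        moreover have "\<bar>\<Sum>m\<in>{?a..<s}. Z i m w\<bar> \<le> 4 * sqrt R * sqrt ?a"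
          using ev[OF i] s by (auto simp: real_sqrt_mult dest!: spec[of _ "s - ?a"])
        moreover have "L * sqrt ?a \<le> C i / 2 * sqrt ?a" using CL[OF i] by (intro mult_right_mono) auto
        moreover have "L * sqrt ?a = 4 * sqrt R * sqrt ?a + sqrt ?a" by (simp add: L_def algebra_simps)
        moreover have "C i * sqrt ?a \<le> (\<Sum>m\<in>{r l..<?a}. Z i m w)"
          "(\<Sum>m\<in>{r l..<?a}. Z i m w) \<le> 2 * C i * sqrt ?a" using ev[OF i] by auto
        moreover have "0 \<le> C i / 2 * sqrt ?a" using C0[OF i] by simp
        ultimately have "C i / 2 * sqrt ?a \<le> S i s \<and> S i s \<le> 3 * C i * sqrt ?a"
          by (simp add: field_simps) linarith
        then show "c i / sqrt (lam i) / 2 * sqrt ?a \<le> S i s \<and> S i s \<le> 3 * (c i / sqrt (lam i)) * sqrt ?a"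
          by (simp add: C_def)
      qed
      then show "\<exists>q>q0. separated_window k lam (\<lambda>i s. y i + lam i * (\<Sum>m<s. Z i m w) / real s) K q"
        using q0 unfolding S_def by blast
    qed
  qed
qed

lemma normal_means_separated:
  fixes X :: "nat \<Rightarrow> nat \<Rightarrow> 'a \<Rightarrow> real" and lam y :: "nat \<Rightarrow> real"
  assumes k: "0 < k" and lam: "\<And>i. i < k \<Longrightarrow> 0 < lam i"
    and ind: "indep_vars (\<lambda>_. borel) (\<lambda>(i, m). X i m) ({..<k} \<times> UNIV)"
    and D: "\<And>i m. i < k \<Longrightarrow> distributed M lborel (X i m) (normal_density (y i) (lam i))"
  shows "AE w in M. (\<forall>i<k. (\<lambda>n. (\<Sum>m<n. X i m w) / real n) \<longlonglongrightarrow> y i) \<and>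
    (\<forall>K q0. \<exists>q>q0. separated_window k lam (\<lambda>i s. (\<Sum>m<s. X i m w) / real s) K q)"
proof -
  define Z where "Z i m w = (X i m w - y i) / lam i" for i m w
  have DZ: "distributed M lborel (Z i m) std_normal_density" if "i < k" for i m
    using D[OF that, of m] normal_standard_normal_convert[OF lam[OF that], of "X i m" "y i"]
    unfolding Z_def[abs_def] by blast
  have "indep_vars (\<lambda>_. borel) (\<lambda>j w. ((\<lambda>(i, m). X i m) j w - y (fst j)) / lam (fst j)) ({..<k} \<times> UNIV)"
    by (rule indep_vars_compose2[OF ind]) measurable
  moreover have "(\<lambda>j w. ((\<lambda>(i, m). X i m) j w - y (fst j)) / lam (fst j)) = (\<lambda>(i, m). Z i m)"
    by (auto simp: Z_def fun_eq_iff)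
  ultimately have indZ: "indep_vars (\<lambda>_. borel) (\<lambda>(i, m). Z i m) ({..<k} \<times> UNIV)" by simp
  have row: "indep_vars (\<lambda>_. borel) (Z i) UNIV" if "i < k" for i
    using indep_vars_reindex_inj[OF indZ, of "\<lambda>m. (i, m)" UNIV] that by (auto simp: inj_on_def)
  have "AE w in M. \<forall>i\<in>{..<k}. (\<lambda>n. (\<Sum>m<n. Z i m w) / real n) \<longlonglongrightarrow> 0"
    by (intro AE_finite_allI std_normal_strong_law row DZ) auto
  then have sl: "AE w in M. \<forall>i<k. (\<lambda>n. (\<Sum>m<n. Z i m w) / real n) \<longlonglongrightarrow> 0"
    by eventually_elim simp
  have mean: "(\<Sum>m<n. X i m w) / real n = y i + lam i * (\<Sum>m<n. Z i m w) / real n"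
    if "i < k" "0 < n" for i n w
  proof -
    have "lam i * (\<Sum>m<n. Z i m w) = (\<Sum>m<n. X i m w) - real n * y i"
      unfolding sum_distrib_left Z_def using lam[OF that(1)] by (simp add: sum_subtractf)
    then show ?thesis using that(2) by (simp add: diff_divide_distrib)
  qed
  \<comment> \<open>Natural levels keep the exceptional sets countable; monotonicity in
    \<open>K\<close> covers real levels.\<close>
  have "AE w in M. \<forall>n::nat. \<forall>q0. \<exists>q>q0.
      separated_window k lam (\<lambda>i s. y i + lam i * (\<Sum>m<s. Z i m w) / real s) (real n) q"
    unfolding AE_all_countable using k lam indZ DZ sl
    by (intro allI separated_windows_fixed_level) auto
  with sl show ?thesis
  proof eventually_elim
    case (elim w)
    show ?case
    proof (intro conjI allI impI)
      fix i assume i: "i < k"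
      have "(\<lambda>n. y i + lam i * ((\<Sum>m<n. Z i m w) / real n)) \<longlonglongrightarrow> y i + lam i * 0"
        using elim(1) i by (intro tendsto_intros) auto
      moreover have "\<forall>\<^sub>F n in sequentially. y i + lam i * ((\<Sum>m<n. Z i m w) / real n) = (\<Sum>m<n. X i m w) / real n"
        using eventually_gt_at_top[of 0] by eventually_elim (simp add: mean[OF i])
      ultimately show "(\<lambda>n. (\<Sum>m<n. X i m w) / real n) \<longlonglongrightarrow> y i"
        using tendsto_cong by fastforce
    next
      fix K q0 :: real
      obtain n :: nat where n: "K \<le> real n" using real_arch_simple by blast
      \<comment> \<open>\<open>q > 0\<close> excludes \<open>s = 0\<close>, where the mean of
        \<open>X\<close> is 0 by division by zero but the shifted form equals
        \<open>y i\<close>.\<close>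
      obtain q where q: "max q0 0 < q"
        "separated_window k lam (\<lambda>i s. y i + lam i * (\<Sum>m<s. Z i m w) / real s) (real n) q"
        using elim(2) by blast
      have "separated_window k lam (\<lambda>i s. y i + lam i * (\<Sum>m<s. Z i m w) / real s) K q"
        by (rule separated_window_antimono[OF n q(2)])
      moreover have "(\<Sum>m<s. X i m w) / real s = y i + lam i * (\<Sum>m<s. Z i m w) / real s"
        if "i < k" "q \<le> real s / lam i" for i s
        using mean[OF that(1), of s w] that q(1) by (cases "s = 0") auto
      ultimately have "separated_window k lam (\<lambda>i s. (\<Sum>m<s. X i m w) / real s) K q"
        unfolding separated_window_def by simp
      then show "\<exists>q>q0. separated_window k lam (\<lambda>i s. (\<Sum>m<s. X i m w) / real s) K q"
        using q(1) by auto
    qed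
  qed
qed

end

section \<open>The sampling algorithms\<close>

lemma freq_cong: "(\<And>b. b < B \<Longrightarrow> f b = g b) \<Longrightarrow> freq B p f j = freq B p g j"
  unfolding freq_def by (intro sum.cong) auto

lemma LEAST_exists_arg:
  fixes f :: "nat \<Rightarrow> 'b :: linorder"
  assumes "finite T" "T \<noteq> {}"
  shows "(LEAST j. j \<in> T \<and> (\<forall>j'\<in>T. f j \<le> f j')) \<in> T"
    and "\<forall>j'\<in>T. f (LEAST j. j \<in> T \<and> (\<forall>j'\<in>T. f j \<le> f j')) \<le> f j'"
proof -
  have "Min (f ` T) \<in> f ` T" using assms by (intro Min_in) auto
  then obtain j where "j \<in> T" "f j = Min (f ` T)" by auto
  then have "j \<in> T \<and> (\<forall>j'\<in>T. f j \<le> f j')" using assms by auto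
  from LeastI[of "\<lambda>j. j \<in> T \<and> (\<forall>j'\<in>T. f j \<le> f j')", OF this]
  show "(LEAST j. j \<in> T \<and> (\<forall>j'\<in>T. f j \<le> f j')) \<in> T"
    and "\<forall>j'\<in>T. f (LEAST j. j \<in> T \<and> (\<forall>j'\<in>T. f j \<le> f j')) \<le> f j'" by blast+
qed

lemma sbest:
  assumes "0 < k"
  shows "sbest k X N w b < k" "j < k \<Longrightarrow> smean X N w (sbest k X N w b) b \<le> smean X N w j b"
proof -
  have "{..<k} \<noteq> {}" using assms by (simp add: lessThan_empty_iff)
  from LEAST_exists_arg[OF finite_lessThan this, of "\<lambda>i. smean X N w i b"]
  show "sbest k X N w b < k" "j < k \<Longrightarrow> smean X N w (sbest k X N w b) b \<le> smean X N w j b"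
    by (simp_all add: sbest_def Ball_def)
qed

lemma sstar_less:
  assumes "0 < k"
  shows "sstar k B p lam X N w < k"
proof -
  let ?f = "freq B p (sbest k X N w)"
  define T where "T = {j. j < k \<and> (\<forall>j'<k. ?f j' \<le> ?f j)}"
  define sc where "sc j = Min {Grate k B lam X N w j b | b. b < B \<and> sbest k X N w b \<noteq> j}" for j
  have "{..<k} \<noteq> {}" using assms by (simp add: lessThan_empty_iff)
  then have "Max (?f ` {..<k}) \<in> ?f ` {..<k}" by (intro Max_in) auto
  then obtain j where "j < k" "?f j = Max (?f ` {..<k})" by auto
  then have "j \<in> T" by (auto simp: T_def)
  then have T: "T \<noteq> {}" "finite T" by (auto simp: T_def)
  \<comment> \<open>The largest score is the smallest negated score.\<close>
  have "(LEAST j. j \<in> T \<and> (\<forall>j'\<in>T. - sc j \<le> - sc j')) \<in> T" by (rule LEAST_exists_arg(1)[OF T(2,1)])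
  then have "(LEAST j. j \<in> T \<and> (\<forall>j'\<in>T. sc j' \<le> sc j)) \<in> T" by simp
  then show ?thesis unfolding sstar_def Let_def T_def sc_def by simp
qed

lemma sstar_unique:
  assumes i: "i < k" and u: "\<And>j. j < k \<Longrightarrow> j \<noteq> i \<Longrightarrow> freq B p (sbest k X N w) j < freq B p (sbest k X N w) i"
  shows "sstar k B p lam X N w = i"
proof -
  have "{j. j < k \<and> (\<forall>j'<k. freq B p (sbest k X N w) j' \<le> freq B p (sbest k X N w) j)} = {i}"
    using i u by (force intro: less_imp_le)
  then show ?thesis unfolding sstar_def Let_def by (intro Least_equality) simp_all
qed

lemma mpb_unique:
  assumes i: "i < k" and u: "\<And>j. j < k \<Longrightarrow> j \<noteq> i \<Longrightarrow> freq B p ib j < freq B p ib i"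
  shows "mpb k B p ib = i"
  unfolding mpb_def
proof (rule Least_equality)
  show "i < k \<and> (\<forall>j<k. freq B p ib j \<le> freq B p ib i)"
    using i u by (metis less_imp_le order_refl)
  fix j assume j: "j < k \<and> (\<forall>j'<k. freq B p ib j' \<le> freq B p ib j)"
  then have "freq B p ib i \<le> freq B p ib j" using i by blast
  then have "j = i" using u[of j] j by (metis not_less)
  then show "i \<le> j" by simp
qed

lemma cond_opt_unique:
  assumes i: "i < k" and u: "\<And>j. j < k \<Longrightarrow> j \<noteq> i \<Longrightarrow> y i b < y j b"
  shows "cond_opt k y b = i"
  unfolding cond_opt_def
proof (rule Least_equality)
  show "i < k \<and> (\<forall>j<k. y i b \<le> y j b)"
    using i u by (metis less_imp_le order_refl)
  fix j assume j: "j < k \<and> (\<forall>j'<k. y j b \<le> y j' b)"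
  then have "y j b \<le> y i b" using i by blast
  then have "j = i" using u[of j] j by (metis not_less)
  then show "i \<le> j" by simp
qed

text \<open>\<open>inXi\<close> omits \<open>ist\<close>, and \<open>inXiadv\<close> returns it
  wherever it is not conditionally optimal; together they leave out exactly the conditional
  optima.\<close>

lemma cand_iff:
  assumes "ist < k"
  shows "(i, b) \<in> cand k B ib ist \<longleftrightarrow> i < k \<and> b < B \<and> i \<noteq> ib b"
  using assms by (auto simp: cand_def inXi_def inXiadv_def)

lemma Wt_cong:
  assumes "\<And>b. b < B \<Longrightarrow> f b = g b" "b < B"
  shows "Wt v k B p f ist i b = Wt v k B p g ist i b"
proof -
  have "freq B p f = freq B p g" using freq_cong[OF assms(1)] by (simp add: fun_eq_iff)
  then have "dd B p f = dd B p g" by (simp add: dd_def fun_eq_iff)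
  moreover have "f b = g b" using assms by blast
  ultimately have "Wbase k B p f ist i b = Wbase k B p g ist i b"
    and "inXiadv B f ist i b \<longleftrightarrow> inXiadv B g ist i b" and "f b = g b"
    by (simp_all add: Wbase_def inXiadv_def)
  then show ?thesis unfolding Wt_def by (cases v) simp_all
qed

lemma Wt_ge_1: "1 \<le> Wt v k B p ib ist i b"
  by (simp add: Wt_def Wbase_def split: variant.split)

text \<open>Frequencies lie between 0 and 1, so every \<open>dd\<close> is at most 1. Summing over
  \<open>b\<close> makes the bound independent of the pair and of the plug-in optima.\<close>

lemma Wt_le:
  assumes p: "\<forall>b<B. 0 < p b" "(\<Sum>b<B. p b) = 1" and b: "b < B"
  shows "Wt v k B p ib ist i b \<le> (\<Sum>b<B. 1 / p b)"
proof -
  have f0: "0 \<le> freq B p ib j" for j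
    unfolding freq_def using p(1) by (intro sum_nonneg) (auto simp: less_imp_le)
  have f1: "freq B p ib j \<le> 1" for j
    unfolding freq_def p(2)[symmetric] using p(1) by (intro sum_mono) (auto simp: less_imp_le)
  have pb: "0 < p b" using p b by blast
  have "p b \<le> (\<Sum>b<B. p b)" using p(1) b by (intro member_le_sum) (auto simp: less_imp_le)
  then have p1: "1 \<le> 1 / p b" using p(2) pb by simp
  have le: "1 / p b \<le> (\<Sum>b<B. 1 / p b)" using p(1) b by (intro member_le_sum) (auto simp: less_imp_le)
  have d: "dd B p ib ist i \<le> 1" using f0[of i] f1[of ist] by (simp add: dd_def)
  then have "dd B p ib ist i / p b \<le> 1 / p b" using pb by (simp add: divide_right_mono)
  moreover have "min z (dd B p ib ist i / 2) / p b \<le> 1 / p b" for z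
    using pb d by (intro divide_right_mono) auto
  ultimately have "Wbase k B p ib ist i b \<le> 1 / p b" using p1 by (simp add: Wbase_def)
  then show ?thesis using le p1 by (auto simp: Wt_def split: variant.split)
qed

section \<open>One step of the algorithm in terms of counts\<close>

lemma Grate_eq:
  "Grate k B lam X N w i b = (smean X N w i b - smean X N w (sbest k X N w b) b)\<^sup>2 /
     (2 * ((lam i b)\<^sup>2 / real (N i b) + (lam (sbest k X N w b) b)\<^sup>2 / real (N (sbest k X N w b) b)))
     / real (total k B N)"
proof -
  have "(lam i b)\<^sup>2 / frac k B N i b + (lam j b)\<^sup>2 / frac k B N j b
      = real (total k B N) * ((lam i b)\<^sup>2 / real (N i b) + (lam j b)\<^sup>2 / real (N j b))" for j
    by (simp add: frac_def distrib_left mult.commute)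
  then show ?thesis by (simp add: Grate_def Let_def mult.left_commute mult.commute)
qed

text \<open>The choice made inside \<open>next_pair\<close>, named so that its minimality can be
  stated apart from the norm test.\<close>

definition selected_pair :: "variant \<Rightarrow> nat \<Rightarrow> nat \<Rightarrow> (nat \<Rightarrow> real) \<Rightarrow> (nat \<Rightarrow> nat \<Rightarrow> real)
    \<Rightarrow> (nat \<Rightarrow> nat \<Rightarrow> nat \<Rightarrow> 'a \<Rightarrow> real) \<Rightarrow> (nat \<Rightarrow> nat \<Rightarrow> nat) \<Rightarrow> 'a \<Rightarrow> nat \<times> nat" where
  "selected_pair v k B p lam X N w =
     (let ib = sbest k X N w; ist = sstar k B p lam X N w;
          val = (\<lambda>(i, b). Wt v k B p ib ist i b * Grate k B lam X N w i b)
      in SOME q. q \<in> cand k B ib ist \<and> (\<forall>q'\<in>cand k B ib ist. val q \<le> val q'))"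

lemma selected_pair:
  assumes k: "2 \<le> k" and B: "1 \<le> B" and s: "selected_pair v k B p lam X N w = (i, b)"
  shows "i < k" "b < B" "i \<noteq> sbest k X N w b"
    and "\<And>j c. j < k \<Longrightarrow> c < B \<Longrightarrow> j \<noteq> sbest k X N w c \<Longrightarrow>
      Wt v k B p (sbest k X N w) (sstar k B p lam X N w) i b * Grate k B lam X N w i b
      \<le> Wt v k B p (sbest k X N w) (sstar k B p lam X N w) j c * Grate k B lam X N w j c"
proof -
  let ?ib = "sbest k X N w" and ?ist = "sstar k B p lam X N w"
  let ?val = "\<lambda>(i, b). Wt v k B p ?ib ?ist i b * Grate k B lam X N w i b"
  let ?C = "cand k B ?ib ?ist"
  have C: "(i, b) \<in> ?C \<longleftrightarrow> i < k \<and> b < B \<and> i \<noteq> ?ib b" for i b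
    using k by (intro cand_iff sstar_less) simp
  then have "?C \<subseteq> {..<k} \<times> {..<B}" by auto
  then have fin: "finite ?C" by (rule finite_subset) auto
  obtain j where "j < k" "j \<noteq> ?ib 0"
    using k by (cases "?ib 0 = 0") (auto intro: that[of 0] that[of 1])
  then have "(j, 0) \<in> ?C" using B C by simp
  then have "?C \<noteq> {}" by blast
  then have "Min (?val ` ?C) \<in> ?val ` ?C" using fin by (intro Min_in) auto
  then obtain q where "q \<in> ?C" "?val q = Min (?val ` ?C)" by (metis (no_types, lifting) imageE)
  then have "\<exists>q. q \<in> ?C \<and> (\<forall>q'\<in>?C. ?val q \<le> ?val q')" using fin by (metis (no_types, lifting) Min_le finite_imageI imageI)
  from someI_ex[OF this] s have "(i, b) \<in> ?C" "\<And>q'. q' \<in> ?C \<Longrightarrow> ?val (i, b) \<le> ?val q'"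
    unfolding selected_pair_def Let_def by auto
  then show "i < k" "b < B" "i \<noteq> sbest k X N w b"
    and "\<And>j c. j < k \<Longrightarrow> c < B \<Longrightarrow> j \<noteq> sbest k X N w c \<Longrightarrow>
      Wt v k B p ?ib ?ist i b * Grate k B lam X N w i b \<le> Wt v k B p ?ib ?ist j c * Grate k B lam X N w j c"
    unfolding C by (auto simp: C)
qed

text \<open>The norm test is evaluated at \<open>b\<close> instead of \<open>b0\<close>, the same
  thing under the conjunct \<open>b = b0\<close>; this is the form that \<open>sampling_path\<close>
  expects.\<close>

lemma alloc_Suc:
  fixes k B n0 :: nat and p :: "nat \<Rightarrow> real" and lam :: "nat \<Rightarrow> nat \<Rightarrow> real"
    and X :: "nat \<Rightarrow> nat \<Rightarrow> nat \<Rightarrow> 'a \<Rightarrow> real" and w :: 'a and v :: variant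
  defines "N \<equiv> alloc v n0 k B p lam X w"
  assumes s: "selected_pair v k B p lam X (N t) w = (i0, b0)"
  shows "N (Suc t) i b = N t i b + (if b = b0 \<and> i = (if (real (N t (sbest k X (N t) w b) b) / lam (sbest k X (N t) w b) b)\<^sup>2
              < (\<Sum>j\<in>{..<k} - {sbest k X (N t) w b}. (real (N t j b) / lam j b)\<^sup>2)
         then sbest k X (N t) w b else i0) then 1 else 0)"
proof -
  have "next_pair v k B p lam X (N t) w =
      (if (real (N t (sbest k X (N t) w b0) b0) / lam (sbest k X (N t) w b0) b0)\<^sup>2
              < (\<Sum>j\<in>{..<k} - {sbest k X (N t) w b0}. (real (N t j b0) / lam j b0)\<^sup>2)
         then (sbest k X (N t) w b0, b0) else (i0, b0))"
    using s unfolding next_pair_def selected_pair_def Let_def by simp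
  then show ?thesis unfolding N_def by (auto simp: Let_def)
qed

text \<open>All randomness has been condensed into \<open>lim\<close> and \<open>win\<close> at the
  sample point \<open>w\<close>; what is left concerns a single path.\<close>

lemma allocation_limits:
  fixes k B n0 :: nat and p :: "nat \<Rightarrow> real" and y lam :: "nat \<Rightarrow> nat \<Rightarrow> real"
    and X :: "nat \<Rightarrow> nat \<Rightarrow> nat \<Rightarrow> 'a \<Rightarrow> real" and w :: 'a and v :: variant
  defines "N \<equiv> alloc v n0 k B p lam X w" and "ib \<equiv> cond_opt k y" and "ist \<equiv> mpb k B p (cond_opt k y)"
  assumes k: "2 \<le> k" and B: "1 \<le> B" and n0: "1 \<le> n0"
    and p: "\<forall>b<B. p b > 0" "(\<Sum>b<B. p b) = 1"
    and lam: "\<forall>i<k. \<forall>b<B. lam i b > 0"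
    and y: "\<forall>b<B. \<exists>i<k. \<forall>j<k. j \<noteq> i \<longrightarrow> y i b < y j b"
    and u: "\<exists>i<k. \<forall>j<k. j \<noteq> i \<longrightarrow> freq B p (cond_opt k y) j < freq B p (cond_opt k y) i"
    and lim: "\<And>i b. i < k \<Longrightarrow> b < B \<Longrightarrow> (\<lambda>n. (\<Sum>m<n. X i b m w) / real n) \<longlonglongrightarrow> y i b"
    and win: "\<And>b K q0. b < B \<Longrightarrow> \<exists>q>q0.
      separated_window k (\<lambda>i. lam i b) (\<lambda>i n. (\<Sum>m<n. X i b m w) / real n) K q"
  shows "b < B \<Longrightarrow> (\<lambda>t. (frac k B (N t) (ib b) b / lam (ib b) b)\<^sup>2
        - (\<Sum>j\<in>{..<k} - {ib b}. (frac k B (N t) j b / lam j b)\<^sup>2)) \<longlonglongrightarrow> 0"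
    and "(i, b) \<in> cand k B ib ist \<Longrightarrow> (j, c) \<in> cand k B ib ist \<Longrightarrow>
      (\<lambda>t. (Wt v k B p ib ist i b * Grate k B lam X (N t) w i b)
         / (Wt v k B p ib ist j c * Grate k B lam X (N t) w j c)) \<longlonglongrightarrow> 1"
    and "i < k \<Longrightarrow> b < B \<Longrightarrow> j < k \<Longrightarrow> c < B \<Longrightarrow>
      limsup (\<lambda>t. ereal (real (N t i b) / real (N t j c))) < \<infinity>"
proof -
  define mu where "mu i b n = (\<Sum>m<n. X i b m w) / real n" for i b n
  define best where "best t b = sbest k X (N t) w b" for t b
  define ss where "ss t = sstar k B p lam X (N t) w" for t
  define W where "W t i b = Wt v k B p (best t) (ss t) i b" for t i b
  define si sb where "si t = fst (selected_pair v k B p lam X (N t) w)"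
    and "sb t = snd (selected_pair v k B p lam X (N t) w)" for t
  define Wm where "Wm = (\<Sum>b<B. 1 / p b)"
  define V where "V t i b = (mu i b (N t i b) - mu (best t b) b (N t (best t b) b))\<^sup>2 /
      (2 * ((lam i b)\<^sup>2 / real (N t i b) + (lam (best t b) b)\<^sup>2 / real (N t (best t b) b)))" for t i b
  define x where "x t i b = real (N t i b) / lam i b" for t i b
  have k0: "0 < k" using k by simp
  have sp: "selected_pair v k B p lam X (N t) w = (si t, sb t)" for t by (simp add: si_def sb_def)
  have mean: "smean X (N t) w i b = mu i b (N t i b)" for t i b by (simp add: smean_def mu_def)
  have G: "Grate k B lam X (N t) w i b = V t i b / real (total k B (N t))" for t i b
    by (simp add: Grate_eq mean V_def best_def)
  have best_eta: "best t = sbest k X (N t) w" for t by (simp add: best_def fun_eq_iff)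
  have Nge: "1 \<le> N t i b" for t i b
  proof (induction t)
    case 0
    then show ?case using n0 by (simp add: N_def)
  next
    case (Suc t)
    then show ?case using alloc_Suc[OF sp[unfolded N_def], of t i b] by (simp add: N_def)
  qed
  have tot: "0 < total k B (N t)" for t
  proof -
    have "0 < N t 0 0" using Nge[of t 0 0] by simp
    also have "\<dots> \<le> (\<Sum>b<B. N t 0 b)" using B by (intro member_le_sum) auto
    also have "\<dots> \<le> total k B (N t)" unfolding total_def
      using k0 by (intro member_le_sum[of 0 _ "\<lambda>i. \<Sum>b<B. N t i b"]) auto
    finally show ?thesis .
  qed
  interpret sampling_path k B n0 lam mu N best W Wm si sb V x
  proof (unfold_locales, goal_cases)
    case 1 show ?case by (rule k)
  next
    case 2 show ?case by (rule n0)
  next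
    case (3 i b) then show ?case using lam by blast
  next
    case (4 i b) show ?case by (simp add: N_def)
  next
    case (5 t b) show ?case unfolding best_def by (rule sbest(1)[OF k0])
  next
    case (6 t b j) then show ?case using sbest(2)[OF k0, of j X "N t" w b] by (simp add: mean best_def)
  next
    case (7 t) show ?case by (rule selected_pair(1)[OF k B sp])
  next
    case (8 t) show ?case by (rule selected_pair(2)[OF k B sp])
  next
    case (9 t) show ?case unfolding best_def by (rule selected_pair(3)[OF k B sp])
  next
    case (10 t i b)
    have "W t (si t) (sb t) * (V t (si t) (sb t) / real (total k B (N t)))
        \<le> W t i b * (V t i b / real (total k B (N t)))"
      using selected_pair(4)[OF k B sp, of i b t] 10 unfolding W_def ss_def best_eta G by simp
    then have "W t (si t) (sb t) * V t (si t) (sb t) \<le> W t i b * V t i b"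
      using tot[of t] by (simp add: divide_le_cancel)
    then show ?case unfolding V_def .
  next
    case (11 t i b) show ?case unfolding W_def by (rule Wt_ge_1)
  next
    case (12 t i b) then show ?case unfolding W_def Wm_def by (intro Wt_le p)
  next
    case (13 t i b) show ?case
      using alloc_Suc[OF sp[unfolded N_def], of t i b] unfolding x_def best_def N_def .
  \<comment> \<open>The remaining goals are the defining equations of the locale parameters
    \<open>V\<close> and \<open>x\<close>.\<close>
  qed (intro eq_reflection ext, rule V_def, intro eq_reflection ext, rule x_def)
  have total: "total k B (N t) = n0 * k * B + t" for t unfolding total_def by (rule N_total)
  obtain i0 where i0: "i0 < k" "\<And>j. j < k \<Longrightarrow> j \<noteq> i0 \<Longrightarrow> freq B p ib j < freq B p ib i0"
    using u by (auto simp: ib_def)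
  have ist: "ist = i0" unfolding ist_def ib_def[symmetric] by (rule mpb_unique[OF i0])
  have ib: "ib b < k \<and> (\<forall>j<k. j \<noteq> ib b \<longrightarrow> y (ib b) b < y j b)" if "b < B" for b
  proof -
    obtain i where i: "i < k" "\<And>j. j < k \<Longrightarrow> j \<noteq> i \<Longrightarrow> y i b < y j b" using y \<open>b < B\<close> by blast
    then show ?thesis using cond_opt_unique[of i k y b] by (auto simp: ib_def)
  qed
  \<comment> \<open>\<open>counts_at_top\<close> asks for one bound on the sample means over all
    sample sizes; convergence provides it.\<close>
  have "\<exists>M. \<forall>i<k. \<forall>b<B. \<forall>s. \<bar>mu i b s\<bar> \<le> M"
  proof -
    have "\<forall>q\<in>{..<k} \<times> {..<B}. \<exists>M. 0 \<le> M \<and> (\<forall>s. \<bar>mu (fst q) (snd q) s\<bar> \<le> M)"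
    proof
      fix q assume "q \<in> {..<k} \<times> {..<B}"
      then have "(\<lambda>n. mu (fst q) (snd q) n) \<longlonglongrightarrow> y (fst q) (snd q)"
        unfolding mu_def by (intro lim) auto
      then have "Bseq (\<lambda>n. mu (fst q) (snd q) n)" by (intro convergent_imp_Bseq convergentI)
      then show "\<exists>M. 0 \<le> M \<and> (\<forall>s. \<bar>mu (fst q) (snd q) s\<bar> \<le> M)"
        by (auto elim!: BseqE intro: less_imp_le)
    qed
    from bchoice[OF this] obtain f where f: "\<forall>q\<in>{..<k} \<times> {..<B}. 0 \<le> f q \<and> (\<forall>s. \<bar>mu (fst q) (snd q) s\<bar> \<le> f q)"
      by blast
    have "\<bar>mu i b s\<bar> \<le> sum f ({..<k} \<times> {..<B})" if "i < k" "b < B" for i b s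
    proof -
      have "\<bar>mu i b s\<bar> \<le> f (i, b)" using f that by auto
      also have "\<dots> \<le> sum f ({..<k} \<times> {..<B})" using f that by (intro member_le_sum) auto
      finally show ?thesis .
    qed
    then show ?thesis by blast
  qed
  then obtain M where M: "\<And>i b s. i < k \<Longrightarrow> b < B \<Longrightarrow> \<bar>mu i b s\<bar> \<le> M" by blast
  interpret consistent_sampling_path k B n0 lam mu N best W Wm si sb V x y ib "Wt v k B p ib ist"
  proof (unfold_locales, goal_cases)
    case (1 i b) then show ?case unfolding mu_def by (rule lim)
  next
    case (2 i b)
    show ?case
    proof (rule counts_at_top[OF M _ 2])
      fix b K q0 assume "b < B"
      then show "\<exists>q>q0. separated_window k (\<lambda>i. lam i b) (\<lambda>i. mu i b) K q"
        using win[of b q0 K] unfolding mu_def by simp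
    qed
  next
    case (3 b) then show ?case using ib by blast
  next
    case (4 b j) then show ?case using ib by blast
  next
    case (5 t i b)
    \<comment> \<open>Correct sample bests give the true frequencies, whose unique maximizer is
      \<open>ist\<close>; so the plug-in weights equal the true ones.\<close>
    have "freq B p (best t) j = freq B p ib j" for j using 5 by (intro freq_cong) auto
    then have "ss t = ist"
      using i0 unfolding ss_def ist by (intro sstar_unique) (auto simp: best_eta[symmetric])
    then show ?case using 5 unfolding W_def by (auto intro: Wt_cong)
  next
    case (6 i b) show ?case using Wt_ge_1[of v k B p ib ist i b] by simp
  qed
  have ist_less: "ist < k" using ist i0 by simp
  show "(\<lambda>t. (frac k B (N t) (ib b) b / lam (ib b) b)\<^sup>2
        - (\<Sum>j\<in>{..<k} - {ib b}. (frac k B (N t) j b / lam j b)\<^sup>2)) \<longlonglongrightarrow> 0" if "b < B"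
    using optimum_balance[OF that] by (simp add: frac_def total x_def mult.commute)
  show "(\<lambda>t. (Wt v k B p ib ist i b * Grate k B lam X (N t) w i b)
         / (Wt v k B p ib ist j c * Grate k B lam X (N t) w j c)) \<longlonglongrightarrow> 1"
    if "(i, b) \<in> cand k B ib ist" "(j, c) \<in> cand k B ib ist"
  proof -
    have q: "i < k" "b < B" "i \<noteq> ib b" "j < k" "c < B" "j \<noteq> ib c"
      using that by (auto simp: cand_iff[OF ist_less])
    have "(Wt v k B p ib ist i b * Grate k B lam X (N t) w i b)
         / (Wt v k B p ib ist j c * Grate k B lam X (N t) w j c)
       = (Wt v k B p ib ist i b * V t i b) / (Wt v k B p ib ist j c * V t j c)" for t
      using tot[of t] by (simp add: G)
    then show ?thesis using weighted_rate_ratio[OF q(2,1,3,5,4,6)] by simp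
  qed
  show "limsup (\<lambda>t. ereal (real (N t i b) / real (N t j c))) < \<infinity>"
    if q: "i < k" "b < B" "j < k" "c < B"
  proof -
    obtain C where "\<forall>\<^sub>F t in sequentially. real (N t i b) / real (N t j c) \<le> C"
      using count_ratio_bounded[OF q(2,1,4,3)] by blast
    then have "limsup (\<lambda>t. ereal (real (N t i b) / real (N t j c))) \<le> ereal C"
      by (intro Limsup_bounded) simp
    then show ?thesis using le_less_trans by fastforce
  qed
qed

theorem theorem6:
  fixes M :: "'a measure" and k B n0 :: nat and p :: "nat \<Rightarrow> real"
    and y lam :: "nat \<Rightarrow> nat \<Rightarrow> real" and X :: "nat \<Rightarrow> nat \<Rightarrow> nat \<Rightarrow> 'a \<Rightarrow> real"
  assumes "prob_space M"
    and "k \<ge> 2" and "B \<ge> 1" and "n0 \<ge> 1"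
    and "\<forall>b<B. p b > 0" and "(\<Sum>b<B. p b) = 1"
    and "\<forall>i<k. \<forall>b<B. lam i b > 0"
    and "\<forall>i<k. \<forall>b<B. \<forall>m. distributed M lborel (X i b m) (normal_density (y i b) (lam i b))"
    and "prob_space.indep_vars M (\<lambda>_. borel) (\<lambda>(i, b, m). X i b m) ({..<k} \<times> {..<B} \<times> UNIV)"
    and "\<forall>b<B. \<exists>i<k. \<forall>j<k. j \<noteq> i \<longrightarrow> y i b < y j b"
    and "\<exists>i<k. \<forall>j<k. j \<noteq> i \<longrightarrow> freq B p (cond_opt k y) j < freq B p (cond_opt k y) i"
  shows "\<forall>v. AE w in M.
     (let N = alloc v n0 k B p lam X w;
          ib = cond_opt k y;
          ist = mpb k B p ib
      in (\<forall>b<B. (\<lambda>t. (frac k B (N t) (ib b) b / lam (ib b) b)\<^sup>2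
                     - (\<Sum>j\<in>{..<k} - {ib b}. (frac k B (N t) j b / lam j b)\<^sup>2)) \<longlonglongrightarrow> 0)
       \<and> (\<forall>(i, b)\<in>cand k B ib ist. \<forall>(j, c)\<in>cand k B ib ist.
            (\<lambda>t. (Wt v k B p ib ist i b * Grate k B lam X (N t) w i b)
                 / (Wt v k B p ib ist j c * Grate k B lam X (N t) w j c)) \<longlonglongrightarrow> 1)
       \<and> (\<forall>i<k. \<forall>b<B. \<forall>j<k. \<forall>b'<B. (i, b) \<noteq> (j, b') \<longrightarrow>
            limsup (\<lambda>t. ereal (real (N t i b) / real (N t j b'))) < \<infinity>))"
proof
  fix v
  interpret prob_space M by (rule assms(1))
  \<comment> \<open>This almost sure event concerns the replications alone and serves both variants;
    the algorithm enters only at a fixed \<open>w\<close>.\<close>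
  have "AE w in M. \<forall>b\<in>{..<B}. (\<forall>i<k. (\<lambda>n. (\<Sum>m<n. X i b m w) / real n) \<longlonglongrightarrow> y i b) \<and>
    (\<forall>K q0. \<exists>q>q0. separated_window k (\<lambda>i. lam i b) (\<lambda>i s. (\<Sum>m<s. X i b m w) / real s) K q)"
  proof (intro AE_finite_allI normal_means_separated)
    fix b assume b: "b \<in> {..<B}"
    show "0 < k" using assms(2) by simp
    show "0 < lam i b" if "i < k" for i using assms(7) that b by simp
    show "distributed M lborel (X i b m) (normal_density (y i b) (lam i b))" if "i < k" for i m
      using assms(8) that b by simp
    have "indep_vars (\<lambda>_. borel) (\<lambda>j. (\<lambda>(i, b, m). X i b m) ((\<lambda>(i, m). (i, b, m)) j)) ({..<k} \<times> UNIV)"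
      by (rule indep_vars_reindex_inj[OF assms(9)]) (use b in \<open>auto simp: inj_on_def\<close>)
    moreover have "(\<lambda>j. (\<lambda>(i, b, m). X i b m) ((\<lambda>(i, m). (i, b, m)) j)) = (\<lambda>(i, m). X i b m)"
      by (auto simp: fun_eq_iff)
    ultimately show "indep_vars (\<lambda>_. borel) (\<lambda>(i, m). X i b m) ({..<k} \<times> UNIV)" by simp
  qed simp
  then show "AE w in M.
     (let N = alloc v n0 k B p lam X w;
          ib = cond_opt k y;
          ist = mpb k B p ib
      in (\<forall>b<B. (\<lambda>t. (frac k B (N t) (ib b) b / lam (ib b) b)\<^sup>2
                     - (\<Sum>j\<in>{..<k} - {ib b}. (frac k B (N t) j b / lam j b)\<^sup>2)) \<longlonglongrightarrow> 0)
       \<and> (\<forall>(i, b)\<in>cand k B ib ist. \<forall>(j, c)\<in>cand k B ib ist.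
            (\<lambda>t. (Wt v k B p ib ist i b * Grate k B lam X (N t) w i b)
                 / (Wt v k B p ib ist j c * Grate k B lam X (N t) w j c)) \<longlonglongrightarrow> 1)
       \<and> (\<forall>i<k. \<forall>b<B. \<forall>j<k. \<forall>b'<B. (i, b) \<noteq> (j, b') \<longrightarrow>
            limsup (\<lambda>t. ereal (real (N t i b) / real (N t j b'))) < \<infinity>))"
  proof eventually_elim
    case (elim w)
    have lim: "(\<lambda>n. (\<Sum>m<n. X i b m w) / real n) \<longlonglongrightarrow> y i b" if "i < k" "b < B" for i b
      using elim that by blast
    have win: "\<exists>q>q0. separated_window k (\<lambda>i. lam i b) (\<lambda>i n. (\<Sum>m<n. X i b m w) / real n) K q"
      if "b < B" for b K q0
      using elim that by blast
    note L = allocation_limits[where v=v and X=X and w=w, OF assms(2-7,10,11) lim win]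
    show ?case unfolding Let_def
      by (intro conjI allI impI; ((rule L(3); assumption) | (auto intro: L)[1]))
  qed
qed

end
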